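(* Let $n\ge1$. If $S_1,\dots,S_n$ are strictly singular operators on $\mathfrak Z_n$, then the composition $S_1S_2\cdots S_n$ is compact.
   Context: Let $\mathbb S=\{z\in\mathbb C:0<\mathrm{Re}\,z<1\}$ and let $\mathcal C$ be the Calderón space of the pair $(\ell_\infty,\ell_1)$: bounded continuous functions $f:\overline{\mathbb S}\to\ell_\infty$, holomorphic on $\mathbb S$, with $f(1+it)\in\ell_1$ for all real $t$ and $\|f\|_{\mathcal C}=\max(\sup_t\|f(it)\|_\infty,\sup_t\|f(1+it)\|_1)<\infty$. For $n\ge1$ the Rochberg space $\mathfrak Z_n$ is the space of arrays $(x_{n-1},\dots,x_0)\in\ell_\infty^n$ for which there is $f\in\mathcal C$ with $x_j=f^{(j)}(1/2)/j!$ for $0\le j\le n-1$, normed by the infimum of $\|f\|_{\mathcal C}$ over such $f$. An operator is strictly singular if its restriction to no infinite-dimensional closed subspace is an isomorphism. *)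

theory Defs
  imports "HOL-Complex_Analysis.Complex_Analysis"
begin

definition bounded_seq :: "(nat \<Rightarrow> complex) \<Rightarrow> bool" where
  "bounded_seq x \<longleftrightarrow> (\<exists>M. \<forall>k. cmod (x k) \<le> M)"

definition linf_norm :: "(nat \<Rightarrow> complex) \<Rightarrow> real" where
  "linf_norm x = (SUP k. cmod (x k))"

definition in_l1 :: "(nat \<Rightarrow> complex) \<Rightarrow> bool" where
  "in_l1 x \<longleftrightarrow> summable (\<lambda>k. cmod (x k))"

definition l1_norm :: "(nat \<Rightarrow> complex) \<Rightarrow> real" where
  "l1_norm x = (\<Sum>k. cmod (x k))"

definition strip :: "complex set" where
  "strip = {z. 0 < Re z \<and> Re z < 1}"

definition cstrip :: "complex set" where
  "cstrip = {z. 0 \<le> Re z \<and> Re z \<le> 1}"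

text \<open>A function f : closed strip -> l_infty is represented as complex => nat => complex
  (values off the closed strip are irrelevant).\<close>

definition calderon :: "(complex \<Rightarrow> nat \<Rightarrow> complex) set" where
  "calderon = {f.
     \<comment> \<open>bounded with values in l_infty on the closed strip\<close>
     (\<exists>M. \<forall>z\<in>cstrip. bounded_seq (f z) \<and> linf_norm (f z) \<le> M) \<and>
     \<comment> \<open>continuous on the closed strip for the l_infty norm\<close>
     (\<forall>z\<in>cstrip. \<forall>e>0. \<exists>d>0. \<forall>w\<in>cstrip. cmod (w - z) < d \<longrightarrow>
          linf_norm (\<lambda>k. f w k - f z k) < e) \<and>
     \<comment> \<open>holomorphic (as an l_infty-valued map) on the open strip\<close>
     (\<forall>z\<in>strip. \<exists>D. bounded_seq D \<and>
          ((\<lambda>w. linf_norm (\<lambda>k. (f w k - f z k) / (w - z) - D k)) \<longlongrightarrow> 0) (at z)) \<and>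
     \<comment> \<open>values on the line Re z = 1 lie in l_1, with bounded l_1 norm\<close>
     (\<forall>t::real. in_l1 (f (1 + \<i> * complex_of_real t))) \<and>
     (\<exists>M. \<forall>t::real. l1_norm (f (1 + \<i> * complex_of_real t)) \<le> M)}"

definition calderon_norm :: "(complex \<Rightarrow> nat \<Rightarrow> complex) \<Rightarrow> real" where
  "calderon_norm f = max (SUP t::real. linf_norm (f (\<i> * complex_of_real t)))
                         (SUP t::real. l1_norm (f (1 + \<i> * complex_of_real t)))"

text \<open>An array (x_{n-1},...,x_0) in l_infty^n is represented as x :: nat => nat => complex,
  where x j is the j-th entry x_j (for j < n) and x j = 0 for j >= n.
  The j-th Taylor coefficient f^(j)(1/2)/j! of the l_infty-valued holomorphic f is taken
  coordinatewise (coordinate functionals are bounded linear, so this is the same).\<close>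

definition taylor_coeff :: "(complex \<Rightarrow> nat \<Rightarrow> complex) \<Rightarrow> nat \<Rightarrow> nat \<Rightarrow> complex" where
  "taylor_coeff f j k = (deriv ^^ j) (\<lambda>z. f z k) (1/2) / of_nat (fact j)"

definition represents :: "nat \<Rightarrow> (complex \<Rightarrow> nat \<Rightarrow> complex) \<Rightarrow> (nat \<Rightarrow> nat \<Rightarrow> complex) \<Rightarrow> bool" where
  "represents n f x \<longleftrightarrow> f \<in> calderon \<and> (\<forall>j<n. x j = taylor_coeff f j)"

definition rochberg :: "nat \<Rightarrow> (nat \<Rightarrow> nat \<Rightarrow> complex) set" where
  "rochberg n = {x. (\<forall>j<n. bounded_seq (x j)) \<and> (\<forall>j\<ge>n. x j = (\<lambda>k. 0)) \<and>
                    (\<exists>f. represents n f x)}"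

definition rnorm :: "nat \<Rightarrow> (nat \<Rightarrow> nat \<Rightarrow> complex) \<Rightarrow> real" where
  "rnorm n x = Inf {calderon_norm f | f. represents n f x}"

definition vadd :: "(nat \<Rightarrow> nat \<Rightarrow> complex) \<Rightarrow> (nat \<Rightarrow> nat \<Rightarrow> complex) \<Rightarrow> (nat \<Rightarrow> nat \<Rightarrow> complex)" where
  "vadd x y = (\<lambda>j k. x j k + y j k)"

definition vsub :: "(nat \<Rightarrow> nat \<Rightarrow> complex) \<Rightarrow> (nat \<Rightarrow> nat \<Rightarrow> complex) \<Rightarrow> (nat \<Rightarrow> nat \<Rightarrow> complex)" where
  "vsub x y = (\<lambda>j k. x j k - y j k)"

definition scal :: "complex \<Rightarrow> (nat \<Rightarrow> nat \<Rightarrow> complex) \<Rightarrow> (nat \<Rightarrow> nat \<Rightarrow> complex)" where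
  "scal c x = (\<lambda>j k. c * x j k)"

definition bounded_operator :: "nat \<Rightarrow> ((nat \<Rightarrow> nat \<Rightarrow> complex) \<Rightarrow> (nat \<Rightarrow> nat \<Rightarrow> complex)) \<Rightarrow> bool" where
  "bounded_operator n T \<longleftrightarrow>
     (\<forall>x\<in>rochberg n. T x \<in> rochberg n) \<and>
     (\<forall>x\<in>rochberg n. \<forall>y\<in>rochberg n. T (vadd x y) = vadd (T x) (T y)) \<and>
     (\<forall>x\<in>rochberg n. \<forall>c. T (scal c x) = scal c (T x)) \<and>
     (\<exists>K. \<forall>x\<in>rochberg n. rnorm n (T x) \<le> K * rnorm n x)"

definition closed_subspace :: "nat \<Rightarrow> (nat \<Rightarrow> nat \<Rightarrow> complex) set \<Rightarrow> bool" where
  "closed_subspace n Y \<longleftrightarrow> Y \<subseteq> rochberg n \<and> (\<lambda>j k. 0) \<in> Y \<and>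
     (\<forall>x\<in>Y. \<forall>y\<in>Y. vadd x y \<in> Y) \<and> (\<forall>x\<in>Y. \<forall>c. scal c x \<in> Y) \<and>
     (\<forall>(s::nat\<Rightarrow>(nat\<Rightarrow>nat\<Rightarrow>complex)) x. (\<forall>i. s i \<in> Y) \<and> x \<in> rochberg n \<and>
        (\<lambda>i. rnorm n (vsub (s i) x)) \<longlonglongrightarrow> 0 \<longrightarrow> x \<in> Y)"

definition infinite_dimensional :: "(nat \<Rightarrow> nat \<Rightarrow> complex) set \<Rightarrow> bool" where
  "infinite_dimensional Y \<longleftrightarrow>
     (\<forall>B. finite B \<longrightarrow> \<not> (Y \<subseteq> {(\<lambda>j k. \<Sum>b\<in>B. c b * b j k) | c. True}))"

definition iso_on :: "nat \<Rightarrow> ((nat \<Rightarrow> nat \<Rightarrow> complex) \<Rightarrow> (nat \<Rightarrow> nat \<Rightarrow> complex)) \<Rightarrow>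
                      (nat \<Rightarrow> nat \<Rightarrow> complex) set \<Rightarrow> bool" where
  "iso_on n T Y \<longleftrightarrow> (\<exists>c>0. \<forall>y\<in>Y. c * rnorm n y \<le> rnorm n (T y))"

definition strictly_singular :: "nat \<Rightarrow> ((nat \<Rightarrow> nat \<Rightarrow> complex) \<Rightarrow> (nat \<Rightarrow> nat \<Rightarrow> complex)) \<Rightarrow> bool" where
  "strictly_singular n T \<longleftrightarrow> bounded_operator n T \<and>
     (\<forall>Y. closed_subspace n Y \<and> infinite_dimensional Y \<longrightarrow> \<not> iso_on n T Y)"

definition compact_operator :: "nat \<Rightarrow> ((nat \<Rightarrow> nat \<Rightarrow> complex) \<Rightarrow> (nat \<Rightarrow> nat \<Rightarrow> complex)) \<Rightarrow> bool" where
  "compact_operator n T \<longleftrightarrow> bounded_operator n T \<and>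
     (\<forall>s::nat\<Rightarrow>(nat\<Rightarrow>nat\<Rightarrow>complex). (\<forall>i. s i \<in> rochberg n) \<and> (\<exists>M. \<forall>i. rnorm n (s i) \<le> M) \<longrightarrow>
        (\<exists>(r::nat\<Rightarrow>nat) L. strict_mono r \<and> L \<in> rochberg n \<and>
           (\<lambda>i. rnorm n (vsub (T (s (r i))) L)) \<longlonglongrightarrow> 0))"

definition compose_ops :: "((nat \<Rightarrow> nat \<Rightarrow> complex) \<Rightarrow> (nat \<Rightarrow> nat \<Rightarrow> complex)) list \<Rightarrow>
                           (nat \<Rightarrow> nat \<Rightarrow> complex) \<Rightarrow> (nat \<Rightarrow> nat \<Rightarrow> complex)" where
  "compose_ops Ts = foldr (\<circ>) Ts id"

end

theory Submission
  imports Defs "HOL-Library.Function_Algebras"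
begin

text \<open>
  For \<open>l \<le> n\<close> the quantity \<open>rnorm l x\<close> is the distance of \<open>x\<close> in the space of order \<open>n\<close> to the arrays
  with \<open>x\<^sub>0 = \<dots> = x\<^sub>l\<^sub>-\<^sub>1 = 0\<close>. A bounded coordinatewise null sequence is, up to a small perturbation
  and a subsequence, a sequence of disjoint blocks. If \<open>rnorm l\<close> tends to zero along it, these blocks
  may be taken with \<open>x\<^sub>0 = \<dots> = x\<^sub>l\<^sub>-\<^sub>1 = 0\<close>, and multiplying representing functions shows that their
  linear combinations are dominated by those of the unit vectors placed in position \<open>0\<close> of the space
  of order \<open>n - l\<close>. If moreover \<open>rnorm (l + 1)\<close> stays away from zero, then pairing with extremal
  functions of the dual couple gives the converse estimate. Hence an operator \<open>T\<close> along which the level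
  \<open>l\<close> does not increase is bounded below on the span of a subsequence. A strictly singular operator
  therefore raises the level of every bounded coordinatewise null sequence, and \<open>n\<close> of them map
  such a sequence to a norm null sequence. Compactness follows by applying this to differences of a
  coordinatewise convergent subsequence.
\<close>

section \<open>Bounded holomorphic functions on the strip\<close>

text \<open>Sums of arguments at level \<open>k\<close> are dominated by unit vectors in order
  \<open>n - k\<close>, sums of images at level \<open>j\<close> dominate unit vectors in order
  \<open>n - j\<close>, and \<open>rnorm\<close> grows with the order, so \<open>j \<le> k\<close>
  closes the comparison. The norm of these model sums is never computed. Only two crude facts about
  it are used. It grows at least like a square root, which shows that the truncations of an array
  converge to it; without this no blocks could be cut out. For coefficients of modulus at most 1 it
  grows sublinearly, which shows that bounded functionals, hence bounded operators, respect bounded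
  coordinatewise null sequences; these therefore replace weakly null ones and no description of the
  dual is needed. The recurring obstacle is that an auxiliary scalar factor disturbs Taylor
  coefficients. If \<open>h\<close> equals 1 at 1/2, then
  \<open>h * (\<Sum>s<m. (1 - h) ^ s) = 1 - (1 - h) ^ m\<close> has the same Taylor coefficients as
  1 below order \<open>m\<close>, and it stays bounded where \<open>h\<close> is. This correction
  gives bounded substitutes for monomials, the lower block estimate and the sublinear bound.\<close>

abbreviation line0 :: "real \<Rightarrow> complex" where
  "line0 t \<equiv> \<i> * complex_of_real t"

abbreviation line1 :: "real \<Rightarrow> complex" where
  "line1 t \<equiv> 1 + \<i> * complex_of_real t"

lemma strip_subset_cstrip: "strip \<subseteq> cstrip"
  by (auto simp: strip_def cstrip_def)

lemma open_strip: "open strip"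
  unfolding strip_def by (intro open_Collect_conj open_Collect_less continuous_intros)

lemma half_in_strip: "1/2 \<in> strip"
  by (simp add: strip_def)

lemma ball_half_subset_strip: "ball (1/2) (1/2) \<subseteq> strip"
proof
  fix z :: complex assume "z \<in> ball (1/2) (1/2)"
  then have "cmod (z - 1/2) < 1/2" by (simp add: dist_norm norm_minus_commute)
  then have "\<bar>Re (z - 1/2)\<bar> < 1/2" using abs_Re_le_cmod le_less_trans by blast
  then have "\<bar>Re z - 1/2\<bar> < 1/2" by simp
  then show "z \<in> strip" unfolding strip_def mem_Collect_eq by linarith
qed

text \<open>The scalar class to which vector-valued functions are reduced coordinate by coordinate.
  Boundedness is included because on an unbounded strip the maximum principle fails without a growth
  condition.\<close>

definition strip_fun :: "(complex \<Rightarrow> complex) \<Rightarrow> bool" where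
  "strip_fun g \<longleftrightarrow> continuous_on cstrip g \<and> g holomorphic_on strip \<and> bounded (g ` cstrip)"

lemma strip_fun_boundedE:
  assumes "strip_fun g"
  obtains B where "B > 0" "\<And>z. z \<in> cstrip \<Longrightarrow> cmod (g z) \<le> B"
  using assms unfolding strip_fun_def bounded_pos by auto

lemma strip_funI:
  assumes "continuous_on cstrip g" "g holomorphic_on strip" "\<And>z. z \<in> cstrip \<Longrightarrow> cmod (g z) \<le> B"
  shows "strip_fun g"
  using assms unfolding strip_fun_def bounded_iff by auto

lemma strip_fun_holomorphic: "strip_fun g \<Longrightarrow> g holomorphic_on strip"
  and strip_fun_continuous: "strip_fun g \<Longrightarrow> continuous_on cstrip g"
  by (simp_all add: strip_fun_def)

lemma strip_fun_const [intro, simp]: "strip_fun (\<lambda>z. c)"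
  by (rule strip_funI[where B = "cmod c"]) (auto intro!: continuous_intros)

lemma strip_fun_add [intro]:
  assumes "strip_fun f" "strip_fun g" shows "strip_fun (\<lambda>z. f z + g z)"
proof -
  obtain A B where "\<And>z. z \<in> cstrip \<Longrightarrow> cmod (f z) \<le> A" "\<And>z. z \<in> cstrip \<Longrightarrow> cmod (g z) \<le> B"
    using assms strip_fun_boundedE by metis
  then show ?thesis using assms
    by (intro strip_funI[where B = "A + B"])
       (auto simp: strip_fun_def intro!: continuous_intros holomorphic_intros norm_triangle_mono)
qed

lemma strip_fun_mult [intro]:
  assumes "strip_fun f" "strip_fun g" shows "strip_fun (\<lambda>z. f z * g z)"
proof -
  obtain A B where "\<And>z. z \<in> cstrip \<Longrightarrow> cmod (f z) \<le> A" "\<And>z. z \<in> cstrip \<Longrightarrow> cmod (g z) \<le> B" "A > 0"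
    using assms strip_fun_boundedE by metis
  then show ?thesis using assms
    by (intro strip_funI[where B = "A * B"])
       (auto simp: strip_fun_def norm_mult intro!: continuous_intros holomorphic_intros mult_mono)
qed

lemma strip_fun_uminus [intro]: "strip_fun f \<Longrightarrow> strip_fun (\<lambda>z. - f z)"
  using strip_fun_mult[of "\<lambda>z. -1" f] by simp

lemma strip_fun_diff [intro]: "strip_fun f \<Longrightarrow> strip_fun g \<Longrightarrow> strip_fun (\<lambda>z. f z - g z)"
  using strip_fun_add[of f "\<lambda>z. - g z"] by auto

lemma strip_fun_sum [intro]:
  "(\<And>i. i \<in> A \<Longrightarrow> strip_fun (f i)) \<Longrightarrow> strip_fun (\<lambda>z. \<Sum>i\<in>A. f i z)"
  by (induction A rule: infinite_finite_induct) auto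

lemma strip_fun_power [intro]: "strip_fun f \<Longrightarrow> strip_fun (\<lambda>z. f z ^ n)"
  by (induction n) auto

text \<open>Dividing by \<open>1 + e z\<close> makes a bounded function vanish at infinity without
  increasing its modulus on the strip.\<close>

theorem three_lines:
  assumes g: "strip_fun g"
    and b0: "\<And>t. cmod (g (line0 t)) \<le> M"
    and b1: "\<And>t. cmod (g (line1 t)) \<le> M"
    and z: "z \<in> cstrip"
  shows "cmod (g z) \<le> M"
proof -
  obtain B where B: "B > 0" "\<And>z. z \<in> cstrip \<Longrightarrow> cmod (g z) \<le> B"
    using g strip_fun_boundedE by blast
  have M0: "0 \<le> M" using b0[of 0] norm_ge_zero order_trans by blast
  have key: "cmod (g z) \<le> (M + e) * cmod (1 + of_real e * z)" if e: "e > 0" for e :: real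
  proof -
    define h where "h w = g w / (1 + of_real e * w)" for w
    have ge1: "1 \<le> cmod (1 + of_real e * w)" if "w \<in> cstrip" for w
    proof -
      have "1 \<le> Re (1 + of_real e * w)" using that e by (simp add: cstrip_def)
      then show ?thesis using complex_Re_le_cmod order_trans by blast
    qed
    have nz: "1 + of_real e * w \<noteq> 0" if "w \<in> cstrip" for w
      using ge1[OF that] by force
    \<comment> \<open>At height \<open>R\<close> the denominator has modulus at least
      \<open>e * R\<close>, which pushes the crude bound \<open>B\<close> below \<open>M + e\<close>
      on the horizontal sides; the first argument of \<open>max\<close> puts \<open>z\<close> inside
      the rectangle.\<close>
    define R where "R = max (\<bar>Im z\<bar> + 1) (B / (e * (M + e)))"
    define S where "S = {w. 0 \<le> Re w \<and> Re w \<le> 1 \<and> -R \<le> Im w \<and> Im w \<le> R}"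
    have R: "R > 0" "\<bar>Im z\<bar> < R" "B \<le> R * (e * (M + e))"
    proof -
      show "R > 0" "\<bar>Im z\<bar> < R" by (auto simp: R_def)
      have "B / (e * (M + e)) \<le> R" by (simp add: R_def)
      then show "B \<le> R * (e * (M + e))" using e M0
        by (simp add: pos_divide_le_eq add_nonneg_pos)
    qed
    have Sb: "S = cbox (Complex 0 (-R)) (Complex 1 R)"
      by (auto simp: S_def in_cbox_complex_iff)
    have SC: "S \<subseteq> cstrip" by (auto simp: S_def cstrip_def)
    have int: "interior S \<subseteq> strip"
      unfolding Sb interior_cbox by (auto simp: strip_def in_box_complex_iff)
    have zS: "z \<in> S" using z R by (auto simp: S_def cstrip_def)
    have "cmod (h z) \<le> M + e"
    proof (rule maximum_modulus_frontier[where S = S and f = h and \<xi> = z])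
      show "h holomorphic_on interior S"
        unfolding h_def using strip_fun_holomorphic[OF g] int strip_subset_cstrip nz
        by (intro holomorphic_intros) (auto intro: holomorphic_on_subset)
      have "closure S = S" unfolding Sb by simp
      then show "continuous_on (closure S) h"
        unfolding h_def using strip_fun_continuous[OF g] SC nz
        by (auto intro!: continuous_intros intro: continuous_on_subset)
      show "bounded S" unfolding Sb by simp
      show "z \<in> S" by fact
      fix w assume "w \<in> frontier S"
      then have wS: "w \<in> S" and wi: "w \<notin> interior S"
        unfolding Sb frontier_def by auto
      then have wc: "w \<in> cstrip" using SC by auto
      from wS wi consider "Re w = 0" | "Re w = 1" | "\<bar>Im w\<bar> = R"
        unfolding Sb interior_cbox by (fastforce simp: in_box_complex_iff in_cbox_complex_iff)
      then show "cmod (h w) \<le> M + e"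
      proof cases
        case 1
        then have "w = \<i> * of_real (Im w)" by (simp add: complex_eq_iff)
        then have "cmod (g w) \<le> M" using b0 by metis
        then have "cmod (h w) \<le> M / 1" unfolding h_def norm_divide
          using ge1[OF wc] M0 by (intro frac_le) auto
        then show ?thesis using e by simp
      next
        case 2
        then have "w = 1 + \<i> * of_real (Im w)" by (simp add: complex_eq_iff)
        then have "cmod (g w) \<le> M" using b1 by metis
        then have "cmod (h w) \<le> M / 1" unfolding h_def norm_divide
          using ge1[OF wc] M0 by (intro frac_le) auto
        then show ?thesis using e by simp
      next
        case 3
        have "e * R = \<bar>Im (1 + of_real e * w)\<bar>" using 3 e by (simp add: abs_mult)
        then have le: "e * R \<le> cmod (1 + of_real e * w)" using abs_Im_le_cmod by metis
        have "cmod (h w) \<le> B / (e * R)" unfolding h_def norm_divide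
          using le B(2)[OF wc] B(1) e R by (intro frac_le) auto
        also have "\<dots> \<le> M + e" using R e by (simp add: pos_divide_le_eq mult_ac)
        finally show ?thesis .
      qed
    qed
    moreover have "g z = h z * (1 + of_real e * z)" using nz[OF z] by (simp add: h_def)
    ultimately show ?thesis by (simp add: norm_mult mult_right_mono)
  qed
  have "((\<lambda>e::real. (M + e) * cmod (1 + of_real e * z)) \<longlongrightarrow> (M + 0) * cmod (1 + of_real 0 * z)) (at_right 0)"
    by (intro tendsto_intros)
  then have "((\<lambda>e::real. (M + e) * cmod (1 + of_real e * z)) \<longlongrightarrow> M) (at_right 0)" by simp
  then show ?thesis
    by (rule tendsto_lowerbound) (auto simp: eventually_at_right_less intro: eventually_mono[OF eventually_at_right_less] key)
qed

text \<open>Taylor data are kept as formal power series: products of functions become products of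
  series, and prescribing finitely many coefficients becomes an algebraic question.\<close>

definition germ :: "(complex \<Rightarrow> complex) \<Rightarrow> complex fps" where
  "germ g = fps_expansion g (1/2)"

lemma taylor_coeff_germ: "taylor_coeff f j k = fps_nth (germ (\<lambda>z. f z k)) j"
  by (simp add: taylor_coeff_def germ_def fps_expansion_def)

lemma has_fps_expansion_germ:
  assumes "g holomorphic_on strip"
  shows "(\<lambda>x. g (1/2 + x)) has_fps_expansion germ g"
  unfolding germ_def using assms open_strip half_in_strip
  by (intro analytic_at_imp_has_fps_expansion) (auto simp: analytic_at)

lemma germ_eqI:
  assumes "(\<lambda>x. g (1/2 + x)) has_fps_expansion F"
  shows "germ g = F"
proof -
  have "germ g = fps_expansion (\<lambda>x. g (1/2 + x)) 0"
    by (simp add: germ_def fps_expansion_def higher_deriv_shift_0'[of "1/2"] o_def)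
  then show ?thesis using fps_expansion_eqI[OF assms] by simp
qed

lemma germ_const [simp]: "germ (\<lambda>z. c) = fps_const c"
  by (rule germ_eqI) simp

lemma germ_add:
  "strip_fun f \<Longrightarrow> strip_fun g \<Longrightarrow> germ (\<lambda>z. f z + g z) = germ f + germ g"
  by (intro germ_eqI has_fps_expansion_add has_fps_expansion_germ strip_fun_holomorphic)

lemma germ_diff:
  "strip_fun f \<Longrightarrow> strip_fun g \<Longrightarrow> germ (\<lambda>z. f z - g z) = germ f - germ g"
  by (intro germ_eqI has_fps_expansion_diff has_fps_expansion_germ strip_fun_holomorphic)

lemma germ_mult:
  "strip_fun f \<Longrightarrow> strip_fun g \<Longrightarrow> germ (\<lambda>z. f z * g z) = germ f * germ g"
  by (intro germ_eqI has_fps_expansion_mult has_fps_expansion_germ strip_fun_holomorphic)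

lemma germ_sum:
  "(\<And>i. i \<in> A \<Longrightarrow> strip_fun (f i)) \<Longrightarrow> germ (\<lambda>z. \<Sum>i\<in>A. f i z) = (\<Sum>i\<in>A. germ (f i))"
  by (intro germ_eqI has_fps_expansion_sum has_fps_expansion_germ strip_fun_holomorphic)

lemma germ_power:
  "strip_fun f \<Longrightarrow> germ (\<lambda>z. f z ^ n) = germ f ^ n"
  by (intro germ_eqI has_fps_expansion_power has_fps_expansion_germ strip_fun_holomorphic)

lemma germ_nth_0: "fps_nth (germ g) 0 = g (1/2)"
  by (simp add: germ_def fps_expansion_def)

text \<open>Cauchy's inequality on the circle of radius 1/4 about 1/2, whence \<open>4 ^ j\<close>;
  the three lines theorem carries the boundary bound to that circle.\<close>

lemma germ_nth_bound:
  assumes g: "strip_fun g"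
    and b0: "\<And>t. cmod (g (line0 t)) \<le> M"
    and b1: "\<And>t. cmod (g (line1 t)) \<le> M"
  shows "cmod (fps_nth (germ g) j) \<le> 4 ^ j * M"
proof -
  have sub: "cball (1/2) (1/4) \<subseteq> strip"
    using ball_half_subset_strip by (auto simp: subset_iff)
  have "cmod ((deriv ^^ j) g (1/2)) \<le> fact j * M / (1/4) ^ j"
  proof (rule Cauchy_inequality)
    show "g holomorphic_on ball (1/2) (1/4)"
      using strip_fun_holomorphic[OF g] sub by (meson ball_subset_cball holomorphic_on_subset order_trans)
    show "continuous_on (cball (1/2) (1/4)) g"
      using strip_fun_continuous[OF g] sub strip_subset_cstrip by (meson continuous_on_subset order_trans)
    fix x assume "cmod (1/2 - x) = 1/4"
    then have "x \<in> cball (1/2) (1/4)" by (simp add: dist_norm)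
    then have "x \<in> cstrip" using sub strip_subset_cstrip by blast
    then show "cmod (g x) \<le> M" using three_lines[OF g b0 b1] by blast
  qed simp
  then have "cmod ((deriv ^^ j) g (1/2)) / fact j \<le> 4 ^ j * M"
    by (simp add: field_simps power_one_over)
  then show ?thesis
    by (simp add: germ_def fps_expansion_def norm_divide)
qed

text \<open>The singularity at 1/2 is removable, and the quotient stays bounded: near 1/2 by
  compactness, elsewhere because \<open>z - 1/2\<close> has modulus above 1/4. Division shifts the
  Taylor coefficients down by one place.\<close>

lemma strip_fun_divide_zero:
  assumes g: "strip_fun g" and g0: "g (1/2) = 0"
  obtains h where "strip_fun h" "\<And>z. g z = (z - 1/2) * h z" "\<And>j. fps_nth (germ h) j = fps_nth (germ g) (Suc j)"
proof -
  define h where "h z = (if z = 1/2 then deriv g (1/2) else g z / (z - 1/2))" for z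
  have eq: "g z = (z - 1/2) * h z" for z
  proof (cases "z = 1/2")
    case True
    show ?thesis unfolding True using g0 by simp
  next
    case False
    then have "z - 1/2 \<noteq> 0" by simp
    with False show ?thesis unfolding h_def by simp
  qed
  have hol: "h holomorphic_on strip"
    using pole_theorem_open[OF strip_fun_holomorphic[OF g] open_strip eq]
    by (rule holomorphic_transform) (use g0 in \<open>auto simp: h_def\<close>)
  have cont: "continuous_on cstrip h"
  proof -
    have "continuous (at z within cstrip) h" if z: "z \<in> cstrip" for z
    proof (cases "z \<in> strip")
      case True
      then have "isCont h z"
        using hol open_strip continuous_on_eq_continuous_at holomorphic_on_imp_continuous_on by blast
      then show ?thesis using continuous_at_imp_continuous_at_within by blast
    next
      case False
      then have ne: "z \<noteq> 1/2" using half_in_strip by blast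
      have "continuous (at z within cstrip) g"
        using strip_fun_continuous[OF g] z continuous_on_eq_continuous_within by blast
      then have "continuous (at z within cstrip) (\<lambda>z. g z / (z - 1/2))"
        using ne by (intro continuous_intros) auto
      moreover have "h z = g z / (z - 1/2)" unfolding h_def if_not_P[OF ne] ..
      ultimately have lim: "((\<lambda>z. g z / (z - 1/2)) \<longlongrightarrow> h z) (at z within cstrip)"
        by (simp only: continuous_within)
      have ev: "\<forall>\<^sub>F w in at z within cstrip. g w / (w - 1/2) = h w"
        using eventually_neq_at_within[of "1/2" z cstrip] by eventually_elim (auto simp: h_def)
      show ?thesis unfolding continuous_within by (rule Lim_transform_eventually[OF lim ev])
    qed
    then show ?thesis by (simp add: continuous_on_eq_continuous_within)
  qed
  obtain B where B: "B > 0" "\<And>z. z \<in> cstrip \<Longrightarrow> cmod (g z) \<le> B"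
    using g strip_fun_boundedE by blast
  have sub: "cball (1/2) (1/4) \<subseteq> strip"
    using ball_half_subset_strip by (auto simp: subset_iff)
  have "compact (h ` cball (1/2) (1/4))"
    by (intro compact_continuous_image compact_cball continuous_on_subset[OF _ sub]
         holomorphic_on_imp_continuous_on hol)
  then have "bounded (h ` cball (1/2) (1/4))" by (rule compact_imp_bounded)
  then obtain B' where B': "\<And>z. z \<in> cball (1/2) (1/4) \<Longrightarrow> cmod (h z) \<le> B'"
    unfolding bounded_iff ball_simps(9) by blast
  have bdd: "cmod (h z) \<le> max B' (B / (1/4))" if z: "z \<in> cstrip" for z
  proof (cases "z \<in> cball (1/2) (1/4)")
    case True
    show ?thesis using B'[OF True] by linarith
  next
    case False
    then have "\<not> dist (1/2) z \<le> 1/4" by (simp only: mem_cball not_False_eq_True)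
    then have d: "1/4 < cmod (z - 1/2)" by (simp only: dist_norm norm_minus_commute not_le)
    have ne: "z \<noteq> 1/2" using False by (metis centre_in_cball zero_le_divide_1_iff zero_le_numeral)
    have "cmod (h z) \<le> B / (1/4)"
      unfolding h_def if_not_P[OF ne] norm_divide
      by (rule frac_le[OF less_imp_le[OF B(1)] B(2)[OF z] _ less_imp_le[OF d]]) simp
    then show ?thesis by linarith
  qed
  have sh: "strip_fun h" using strip_funI[OF cont hol bdd] .
  have "(\<lambda>x. x * h (1/2 + x)) has_fps_expansion fps_X * germ h"
    by (intro has_fps_expansion_mult has_fps_expansion_fps_X has_fps_expansion_germ hol)
  then have "germ g = fps_X * germ h"
    by (intro germ_eqI) (simp add: eq[of "1/2 + _"])
  then have "fps_nth (germ h) j = fps_nth (germ g) (Suc j)" for j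
    by simp
  with that sh eq show ?thesis by blast
qed

section \<open>The Calderon space\<close>

lemma bounded_seqI: "(\<And>k. cmod (x k) \<le> M) \<Longrightarrow> bounded_seq x"
  by (auto simp: bounded_seq_def)

lemma linf_norm_le: "(\<And>k. cmod (x k) \<le> M) \<Longrightarrow> linf_norm x \<le> M"
  unfolding linf_norm_def by (rule cSUP_least) auto

lemma le_linf_norm: "bounded_seq x \<Longrightarrow> cmod (x k) \<le> linf_norm x"
  unfolding linf_norm_def bounded_seq_def by (intro cSUP_upper) (auto simp: bdd_above_def)

lemma linf_norm_nonneg: "bounded_seq x \<Longrightarrow> 0 \<le> linf_norm x"
  using le_linf_norm[of x 0] norm_ge_zero order_trans by blast

lemma bounded_seq_diff: "bounded_seq x \<Longrightarrow> bounded_seq y \<Longrightarrow> bounded_seq (\<lambda>k. x k - y k)"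
  unfolding bounded_seq_def by (meson add_mono norm_triangle_ineq4 order_trans)

lemma bounded_seq_scale: "bounded_seq x \<Longrightarrow> bounded_seq (\<lambda>k. c * x k)"
  unfolding bounded_seq_def by (metis mult_left_mono norm_ge_zero norm_mult)

lemma l1_partial_sums:
  assumes "\<And>K. (\<Sum>k<K. cmod (x k)) \<le> M"
  shows "in_l1 x" "l1_norm x \<le> M"
proof -
  show *: "in_l1 x" unfolding in_l1_def
    by (rule summableI_nonneg_bounded[where x = M]) (use assms in auto)
  then show "l1_norm x \<le> M" unfolding in_l1_def l1_norm_def
    by (intro suminf_le_const) (use assms in auto)
qed

lemma sum_le_l1_norm: "in_l1 x \<Longrightarrow> finite K \<Longrightarrow> (\<Sum>k\<in>K. cmod (x k)) \<le> l1_norm x"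
  unfolding in_l1_def l1_norm_def by (rule sum_le_suminf) auto

lemma line0_in_cstrip [simp]: "line0 t \<in> cstrip"
  and line1_in_cstrip [simp]: "line1 t \<in> cstrip"
  by (auto simp: cstrip_def)

lemma calderon_bounded:
  assumes "f \<in> calderon"
  obtains B where "B > 0" "\<And>z k. z \<in> cstrip \<Longrightarrow> cmod (f z k) \<le> B"
proof -
  obtain M where M: "\<forall>z\<in>cstrip. bounded_seq (f z) \<and> linf_norm (f z) \<le> M"
    using assms by (auto simp: calderon_def)
  have "cmod (f z k) \<le> max M 1" if "z \<in> cstrip" for z k
    using M that le_linf_norm[of "f z" k] by fastforce
  then show ?thesis using that[of "max M 1"] by auto
qed

lemma calderon_bounded_seq: "f \<in> calderon \<Longrightarrow> z \<in> cstrip \<Longrightarrow> bounded_seq (f z)"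
  by (auto simp: calderon_def)

lemma calderon_equicontinuous:
  assumes "f \<in> calderon" "z \<in> cstrip" "e > 0"
  obtains d where "d > 0" "\<And>w k. w \<in> cstrip \<Longrightarrow> cmod (w - z) < d \<Longrightarrow> cmod (f w k - f z k) \<le> e"
proof -
  obtain d where d: "d > 0" "\<forall>w\<in>cstrip. cmod (w - z) < d \<longrightarrow> linf_norm (\<lambda>k. f w k - f z k) < e"
    using assms unfolding calderon_def by blast
  have "cmod (f w k - f z k) \<le> e" if "w \<in> cstrip" "cmod (w - z) < d" for w k
    using le_linf_norm[OF bounded_seq_diff[OF calderon_bounded_seq[OF assms(1) that(1)]
        calderon_bounded_seq[OF assms(1,2)]], of k] d that
    by force
  then show ?thesis using that d by blast
qed

lemma calderon_differentiable:
  assumes "f \<in> calderon" "z \<in> strip"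
  shows "\<exists>D. bounded_seq D \<and>
    ((\<lambda>w. linf_norm (\<lambda>k. (f w k - f z k) / (w - z) - D k)) \<longlongrightarrow> 0) (at z)"
  using assms unfolding calderon_def mem_Collect_eq by (elim conjE bspec)

lemma calderon_coord_strip_fun:
  assumes f: "f \<in> calderon"
  shows "strip_fun (\<lambda>z. f z k)"
proof -
  obtain B where B: "B > 0" "\<And>z k. z \<in> cstrip \<Longrightarrow> cmod (f z k) \<le> B"
    by (rule calderon_bounded[OF f]) (rule that)
  have cont: "continuous_on cstrip (\<lambda>z. f z k)"
    unfolding continuous_on_iff
  proof (intro ballI allI impI)
    fix z e assume z: "z \<in> cstrip" "e > (0::real)"
    obtain d where d: "d > 0" "\<And>w k. w \<in> cstrip \<Longrightarrow> cmod (w - z) < d \<Longrightarrow> cmod (f w k - f z k) \<le> e/2"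
      by (rule calderon_equicontinuous[OF f z(1) half_gt_zero[OF z(2)]]) blast
    have "dist (f w k) (f z k) < e" if "w \<in> cstrip" "dist w z < d" for w
    proof -
      have "cmod (f w k - f z k) \<le> e/2" using d(2)[of w k] that by (simp only: dist_norm)
      then show ?thesis using z(2) unfolding dist_norm by linarith
    qed
    then show "\<exists>d>0. \<forall>w\<in>cstrip. dist w z < d \<longrightarrow> dist (f w k) (f z k) < e"
      using d(1) by blast
  qed
  have "(\<lambda>z. f z k) field_differentiable at z" if z: "z \<in> strip" for z
  proof -
    obtain D where D: "bounded_seq D"
        "((\<lambda>w. linf_norm (\<lambda>k. (f w k - f z k) / (w - z) - D k)) \<longlongrightarrow> 0) (at z)"
      using calderon_differentiable[OF f z] by (elim exE conjE)
    have "\<forall>\<^sub>F w in at z. w \<in> strip"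
      using open_strip z by (intro eventually_at_in_open') 
    then have "\<forall>\<^sub>F w in at z. cmod ((f w k - f z k) / (w - z) - D k)
                 \<le> linf_norm (\<lambda>k. (f w k - f z k) / (w - z) - D k)"
    proof eventually_elim
      case (elim w)
      \<comment> \<open>\<open>linf_norm\<close> is a supremum of reals and dominates the
        coordinates only for bounded sequences, so boundedness of the difference quotient must be
        known first.\<close>
      have "bounded_seq (\<lambda>k. (1 / (w - z)) * (f w k - f z k))"
        using elim z strip_subset_cstrip
        by (intro bounded_seq_scale bounded_seq_diff calderon_bounded_seq[OF f]) auto
      then have "bounded_seq (\<lambda>k. (f w k - f z k) / (w - z) - D k)"
        by (intro bounded_seq_diff D) simp
      then show ?case by (rule le_linf_norm)
    qed
    then have "((\<lambda>w. (f w k - f z k) / (w - z) - D k) \<longlongrightarrow> 0) (at z)"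
      using D(2) by (rule Lim_null_comparison)
    then have "((\<lambda>w. (f w k - f z k) / (w - z)) \<longlongrightarrow> D k) (at z)"
      by (rule LIM_zero_cancel)
    then have "((\<lambda>z. f z k) has_field_derivative D k) (at z)"
      by (simp only: has_field_derivative_iff)
    then show ?thesis by (auto simp: field_differentiable_def)
  qed
  then have "(\<lambda>z. f z k) holomorphic_on strip"
    unfolding holomorphic_on_def by (simp add: field_differentiable_at_within)
  then show ?thesis by (rule strip_funI[OF cont _ B(2)])
qed

text \<open>First order Taylor formula with the second derivative estimated by Cauchy on discs of
  radius \<open>r/2\<close>. The constant depends on \<open>B\<close> and \<open>r\<close> only, so
  one bound serves all coordinates of a vector-valued function at once.\<close>

lemma deriv_quotient_bound:
  assumes g: "g holomorphic_on strip" and r: "r > 0" "cball z r \<subseteq> strip"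
    and B: "\<And>w. w \<in> strip \<Longrightarrow> cmod (g w) \<le> B"
    and w: "cmod (w - z) \<le> r / 2" "w \<noteq> z"
  shows "cmod ((g w - g z) / (w - z) - deriv g z) \<le> 2 * B / (r/2)^2 * cmod (w - z)"
proof -
  define S where "S = cball z (r/2)"
  have sub: "cball x (r/2) \<subseteq> strip" if "x \<in> S" for x
  proof
    fix y assume "y \<in> cball x (r/2)"
    then have "dist z y \<le> r" using that dist_triangle[of z y x] unfolding S_def by simp
    then show "y \<in> strip" using r by auto
  qed
  have SS: "S \<subseteq> strip" using sub r unfolding S_def by (meson centre_in_cball half_gt_zero less_imp_le subset_iff)
  have "cmod ((deriv ^^ 0) g w - (\<Sum>i\<le>1. (deriv ^^ i) g z * (w - z) ^ i / fact i))
      \<le> 2 * B / (r/2)^2 * cmod (w - z) ^ Suc 1 / fact 1"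
  proof (rule complex_Taylor[where f = "\<lambda>i. (deriv ^^ i) g"])
    show "convex S" "w \<in> S" "z \<in> S" using w r
      by (auto simp: S_def dist_norm norm_minus_commute)
    fix x assume x: "x \<in> S"
    then have xs: "x \<in> strip" using SS by blast
    show "((deriv ^^ i) g has_field_derivative (deriv ^^ Suc i) g x) (at x within S)" for i
      using holomorphic_derivI[OF holomorphic_higher_deriv[OF g open_strip] open_strip xs] by simp
    have "cmod ((deriv ^^ Suc 1) g x) \<le> fact (Suc 1) * B / (r/2) ^ Suc 1"
    proof (rule Cauchy_inequality)
      show "g holomorphic_on ball x (r/2)"
        using g sub[OF x] ball_subset_cball by (meson holomorphic_on_subset order_trans)
      show "continuous_on (cball x (r/2)) g"
        using g sub[OF x] by (meson continuous_on_subset holomorphic_on_imp_continuous_on)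
      show "cmod (g y) \<le> B" if "cmod (x - y) = r/2" for y
        using sub[OF x] that by (intro B) (auto simp: dist_norm subset_iff)
    qed (use r in auto)
    then show "cmod ((deriv ^^ Suc 1) g x) \<le> 2 * B / (r/2)^2"
      by (simp only: numeral_2_eq_2[symmetric] One_nat_def fact_2)
  qed
  then have le: "cmod (g w - g z - deriv g z * (w - z)) \<le> 2 * B / (r/2)^2 * cmod (w - z) * cmod (w - z)"
    by (simp add: power2_eq_square algebra_simps)
  have "(g w - g z) / (w - z) - deriv g z = (g w - g z - deriv g z * (w - z)) / (w - z)"
    using w by (simp add: field_simps)
  then have "cmod ((g w - g z) / (w - z) - deriv g z) = cmod (g w - g z - deriv g z * (w - z)) / cmod (w - z)"
    by (simp add: norm_divide)
  also have "\<dots> \<le> 2 * B / (r/2)^2 * cmod (w - z)"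
    using le w by (subst pos_divide_le_eq) auto
  finally show ?thesis .
qed

text \<open>Holomorphy may be checked coordinatewise: the common bound \<open>B\<close> makes the
  difference quotients converge uniformly in \<open>k\<close>, by
  \<open>deriv_quotient_bound\<close>. Continuity up to the boundary has no such automatic
  uniformity and is assumed uniformly in \<open>k\<close>.\<close>

lemma calderonI:
  assumes hol: "\<And>k. (\<lambda>z. f z k) holomorphic_on strip"
    and bd: "\<And>z k. z \<in> cstrip \<Longrightarrow> cmod (f z k) \<le> B"
    and cont: "\<And>z e. z \<in> cstrip \<Longrightarrow> e > 0 \<Longrightarrow>
        \<exists>d>0. \<forall>w\<in>cstrip. cmod (w - z) < d \<longrightarrow> (\<forall>k. cmod (f w k - f z k) \<le> e)"
    and l1: "\<And>t K. (\<Sum>k<K. cmod (f (line1 t) k)) \<le> M"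
  shows "f \<in> calderon"
proof -
  have 1: "\<exists>M. \<forall>z\<in>cstrip. bounded_seq (f z) \<and> linf_norm (f z) \<le> M"
    using bd by (intro exI[of _ B]) (auto intro: bounded_seqI linf_norm_le)
  have 2: "\<forall>z\<in>cstrip. \<forall>e>0. \<exists>d>0. \<forall>w\<in>cstrip. cmod (w - z) < d \<longrightarrow>
          linf_norm (\<lambda>k. f w k - f z k) < e"
  proof (intro ballI allI impI)
    fix z and e :: real assume "z \<in> cstrip" "e > 0"
    then obtain d where d: "d > 0" "\<forall>w\<in>cstrip. cmod (w - z) < d \<longrightarrow> (\<forall>k. cmod (f w k - f z k) \<le> e/2)"
      using cont[OF _ half_gt_zero] by blast
    have "linf_norm (\<lambda>k. f w k - f z k) < e" if "w \<in> cstrip" "cmod (w - z) < d" for w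
    proof -
      have "linf_norm (\<lambda>k. f w k - f z k) \<le> e/2" using d(2) that by (intro linf_norm_le) blast
      then show ?thesis using \<open>e > 0\<close> by linarith
    qed
    then show "\<exists>d>0. \<forall>w\<in>cstrip. cmod (w - z) < d \<longrightarrow> linf_norm (\<lambda>k. f w k - f z k) < e"
      using d by blast
  qed
  have 3: "\<exists>D. bounded_seq D \<and>
          ((\<lambda>w. linf_norm (\<lambda>k. (f w k - f z k) / (w - z) - D k)) \<longlongrightarrow> 0) (at z)" if z: "z \<in> strip" for z
  proof -
    obtain r where r: "r > 0" "cball z r \<subseteq> strip" using open_strip z open_contains_cball by blast
    define D where "D k = deriv (\<lambda>z. f z k) z" for k
    define C where "C = 2 * B / (r/2)^2"
    have "0 \<le> B" using bd[of z 0] z strip_subset_cstrip norm_ge_zero order_trans by blast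
    have Db: "cmod (D k) \<le> B / r" for k
    proof -
      have "cmod ((deriv ^^ 1) (\<lambda>z. f z k) z) \<le> fact 1 * B / r ^ 1"
      proof (rule Cauchy_inequality)
        show "(\<lambda>z. f z k) holomorphic_on ball z r"
          using hol r ball_subset_cball by (meson holomorphic_on_subset order_trans)
        show "continuous_on (cball z r) (\<lambda>z. f z k)"
          using hol r by (meson continuous_on_subset holomorphic_on_imp_continuous_on)
        show "cmod (f y k) \<le> B" if "cmod (z - y) = r" for y
          using r(2) strip_subset_cstrip that by (intro bd) (auto simp: dist_norm subset_iff)
      qed (use r in auto)
      then show ?thesis by (simp add: D_def)
    qed
    have ev: "\<forall>\<^sub>F w in at z. w \<noteq> z \<and> cmod (w - z) \<le> r/2"
      unfolding eventually_at using r by (intro exI[of _ "r/2"]) (auto simp: dist_norm)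
    have est: "cmod ((f w k - f z k) / (w - z) - D k) \<le> C * cmod (w - z)"
      if "w \<noteq> z" "cmod (w - z) \<le> r/2" for w k
      unfolding C_def D_def
      by (rule deriv_quotient_bound[OF hol r])  (use that bd strip_subset_cstrip in auto)
    have "\<forall>\<^sub>F w in at z. norm (linf_norm (\<lambda>k. (f w k - f z k) / (w - z) - D k)) \<le> C * cmod (w - z)"
      using ev
    proof eventually_elim
      case (elim w)
      then have e: "cmod ((f w k - f z k) / (w - z) - D k) \<le> C * cmod (w - z)" for k
        using est by blast
      show ?case using linf_norm_le[OF e] linf_norm_nonneg[OF bounded_seqI[OF e]] by simp
    qed
    moreover have "((\<lambda>w. C * cmod (w - z)) \<longlongrightarrow> C * cmod (z - z)) (at z)"
      by (intro tendsto_intros)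
    then have "((\<lambda>w. C * cmod (w - z)) \<longlongrightarrow> 0) (at z)" by simp
    ultimately have "((\<lambda>w. linf_norm (\<lambda>k. (f w k - f z k) / (w - z) - D k)) \<longlongrightarrow> 0) (at z)"
      by (rule Lim_null_comparison)
    then show ?thesis by (intro exI[of _ D] conjI bounded_seqI[OF Db])
  qed
  have 4: "in_l1 (f (line1 t))" "l1_norm (f (line1 t)) \<le> M" for t
    using l1_partial_sums[OF l1[where t = t]] by auto
  show ?thesis unfolding calderon_def mem_Collect_eq
    by (intro conjI 1 2 ballI 3 allI 4 exI[of _ M])
qed

lemma calderon_bdd_above:
  assumes f: "f \<in> calderon"
  shows "bdd_above (range (\<lambda>t::real. linf_norm (f (line0 t))))"
    "bdd_above (range (\<lambda>t::real. l1_norm (f (line1 t))))"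
proof -
  obtain M where "\<forall>z\<in>cstrip. bounded_seq (f z) \<and> linf_norm (f z) \<le> M"
    using f by (auto simp: calderon_def)
  then show "bdd_above (range (\<lambda>t::real. linf_norm (f (line0 t))))"
    by (intro bdd_aboveI[where M = M]) auto
  obtain M where "\<forall>t::real. l1_norm (f (line1 t)) \<le> M"
    using f by (auto simp: calderon_def)
  then show "bdd_above (range (\<lambda>t::real. l1_norm (f (line1 t))))"
    by (intro bdd_aboveI[where M = M]) auto
qed

lemma calderon_line0:
  assumes f: "f \<in> calderon"
  shows "cmod (f (line0 t) k) \<le> calderon_norm f"
proof -
  have "cmod (f (line0 t) k) \<le> linf_norm (f (line0 t))"
    by (intro le_linf_norm calderon_bounded_seq f) simp
  also have "\<dots> \<le> (SUP t::real. linf_norm (f (line0 t)))"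
    by (intro cSUP_upper calderon_bdd_above f) simp
  finally show ?thesis unfolding calderon_norm_def by linarith
qed

lemma calderon_line1:
  assumes f: "f \<in> calderon" and K: "finite K"
  shows "(\<Sum>k\<in>K. cmod (f (line1 t) k)) \<le> calderon_norm f"
proof -
  have "in_l1 (f (line1 t))" using f by (auto simp: calderon_def)
  then have "(\<Sum>k\<in>K. cmod (f (line1 t) k)) \<le> l1_norm (f (line1 t))"
    using K by (rule sum_le_l1_norm)
  also have "\<dots> \<le> (SUP t::real. l1_norm (f (line1 t)))"
    by (intro cSUP_upper calderon_bdd_above f) simp
  finally show ?thesis unfolding calderon_norm_def by linarith
qed

lemma calderon_norm_le:
  assumes "\<And>t k. cmod (f (line0 t) k) \<le> M"
    and "\<And>t K. (\<Sum>k<K. cmod (f (line1 t) k)) \<le> M"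
  shows "calderon_norm f \<le> M"
  unfolding calderon_norm_def
  using assms by (intro max.boundedI cSUP_least linf_norm_le l1_partial_sums) auto

lemma calderon_norm_nonneg: "f \<in> calderon \<Longrightarrow> 0 \<le> calderon_norm f"
  using calderon_line0[of f 0 0] norm_ge_zero order_trans by blast

lemma calderon_coord_le:
  assumes f: "f \<in> calderon" and z: "z \<in> cstrip"
  shows "cmod (f z k) \<le> calderon_norm f"
  using calderon_line1[OF f, of "{k}"]
  by (intro three_lines[OF calderon_coord_strip_fun[OF f] _ _ z]) (auto intro: calderon_line0[OF f])

lemma calderon_add:
  assumes f: "f \<in> calderon" and g: "g \<in> calderon"
  shows "(\<lambda>z k. f z k + g z k) \<in> calderon"
    "calderon_norm (\<lambda>z k. f z k + g z k) \<le> calderon_norm f + calderon_norm g"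
proof -
  have l1: "(\<Sum>k<K. cmod (f (line1 t) k + g (line1 t) k))
       \<le> calderon_norm f + calderon_norm g" for t K
  proof -
    have "(\<Sum>k<K. cmod (f (line1 t) k + g (line1 t) k))
        \<le> (\<Sum>k<K. cmod (f (line1 t) k)) + (\<Sum>k<K. cmod (g (line1 t) k))"
      unfolding sum.distrib[symmetric] by (intro sum_mono norm_triangle_ineq)
    then show ?thesis using calderon_line1[OF f, of "{..<K}" t] calderon_line1[OF g, of "{..<K}" t] by simp
  qed
  show "(\<lambda>z k. f z k + g z k) \<in> calderon"
  proof (rule calderonI[where B = "calderon_norm f + calderon_norm g" and M = "calderon_norm f + calderon_norm g"])
    show "(\<lambda>z. f z k + g z k) holomorphic_on strip" for k
      by (intro holomorphic_intros strip_fun_holomorphic calderon_coord_strip_fun f g)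
    show "cmod (f z k + g z k) \<le> calderon_norm f + calderon_norm g" if "z \<in> cstrip" for z k
      by (intro norm_triangle_mono calderon_coord_le f g that)
    fix z and e :: real assume z: "z \<in> cstrip" "e > 0"
    then have e: "e/2 > 0" by simp
    obtain d1 where d1: "d1 > 0" "\<And>w k. w \<in> cstrip \<Longrightarrow> cmod (w - z) < d1 \<Longrightarrow> cmod (f w k - f z k) \<le> e/2"
      using calderon_equicontinuous[OF f z(1) e] by blast
    obtain d2 where d2: "d2 > 0" "\<And>w k. w \<in> cstrip \<Longrightarrow> cmod (w - z) < d2 \<Longrightarrow> cmod (g w k - g z k) \<le> e/2"
      using calderon_equicontinuous[OF g z(1) e] by blast
    have "cmod (f w k + g w k - (f z k + g z k)) \<le> e" if "w \<in> cstrip" "cmod (w - z) < min d1 d2" for w k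
    proof -
      have "cmod ((f w k - f z k) + (g w k - g z k)) \<le> e/2 + e/2"
        using d1(2)[of w k] d2(2)[of w k] that by (intro norm_triangle_mono) auto
      then show ?thesis by (simp add: algebra_simps)
    qed
    then show "\<exists>d>0. \<forall>w\<in>cstrip. cmod (w - z) < d \<longrightarrow> (\<forall>k. cmod (f w k + g w k - (f z k + g z k)) \<le> e)"
      using d1 d2 by (intro exI[of _ "min d1 d2"]) auto
  qed (rule l1)
  show "calderon_norm (\<lambda>z k. f z k + g z k) \<le> calderon_norm f + calderon_norm g"
    by (rule calderon_norm_le) (intro l1 norm_triangle_mono calderon_line0 f g)+
qed

text \<open>Multiplication by a bounded sequence acts with the same bound on both endpoint spaces.
  Scalar multiples and coordinate projections are special cases.\<close>

lemma calderon_coord_scale: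
  assumes f: "f \<in> calderon" and c: "\<And>k. cmod (c k) \<le> C"
  shows "(\<lambda>z k. c k * f z k) \<in> calderon"
    "calderon_norm (\<lambda>z k. c k * f z k) \<le> C * calderon_norm f"
proof -
  have C: "0 \<le> C" using c[of 0] norm_ge_zero order_trans by blast
  have sum: "(\<Sum>k<K. cmod (c k * f (line1 t) k)) \<le> C * calderon_norm f" for t K
  proof -
    have "(\<Sum>k<K. cmod (c k * f (line1 t) k)) \<le> C * (\<Sum>k<K. cmod (f (line1 t) k))"
      unfolding sum_distrib_left norm_mult by (intro sum_mono mult_right_mono c) auto
    also have "\<dots> \<le> C * calderon_norm f"
      by (intro mult_left_mono calderon_line1 f C) auto
    finally show ?thesis .
  qed
  show "(\<lambda>z k. c k * f z k) \<in> calderon"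
  proof (rule calderonI[where B = "C * calderon_norm f" and M = "C * calderon_norm f"])
    show "(\<lambda>z. c k * f z k) holomorphic_on strip" for k
      by (intro holomorphic_intros strip_fun_holomorphic calderon_coord_strip_fun f)
    show "cmod (c k * f z k) \<le> C * calderon_norm f" if "z \<in> cstrip" for z k
      unfolding norm_mult by (intro mult_mono c calderon_coord_le f that C) auto
    fix z and e :: real assume z: "z \<in> cstrip" "e > 0"
    then have e: "e / (C + 1) > 0" using C by simp
    obtain d where d: "d > 0" "\<And>w k. w \<in> cstrip \<Longrightarrow> cmod (w - z) < d \<Longrightarrow> cmod (f w k - f z k) \<le> e / (C + 1)"
      using calderon_equicontinuous[OF f z(1) e] by blast
    have "cmod (c k * f w k - c k * f z k) \<le> e" if "w \<in> cstrip" "cmod (w - z) < d" for w k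
    proof -
      have "cmod (c k * f w k - c k * f z k) = cmod (c k) * cmod (f w k - f z k)"
        by (simp add: norm_mult flip: right_diff_distrib)
      also have "\<dots> \<le> (C + 1) * (e / (C + 1))"
        using c[of k] C by (intro mult_mono d(2) that) auto
      finally show ?thesis using C by simp
    qed
    then show "\<exists>d>0. \<forall>w\<in>cstrip. cmod (w - z) < d \<longrightarrow> (\<forall>k. cmod (c k * f w k - c k * f z k) \<le> e)"
      using d by blast
  qed (rule sum)
  show "calderon_norm (\<lambda>z k. c k * f z k) \<le> C * calderon_norm f"
  proof (rule calderon_norm_le)
    show "cmod (c k * f (line0 t) k) \<le> C * calderon_norm f" for t k
      unfolding norm_mult by (intro mult_mono c C calderon_line0 f) auto
  qed (rule sum)
qed

text \<open>With finitely many nonzero coordinates all uniformity in \<open>k\<close> is automatic.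
  Every explicit representative built later is of this kind, which is why blocks are kept
  finite.\<close>

lemma calderon_finite:
  assumes s: "\<And>k. strip_fun (\<lambda>z. f z k)" and A: "finite A" "\<And>z k. k \<notin> A \<Longrightarrow> f z k = 0"
  shows "f \<in> calderon"
proof -
  have "\<exists>B. \<forall>z\<in>cstrip. cmod (f z k) \<le> B" for k using s[of k] strip_fun_boundedE by metis
  then obtain b where b: "\<And>k z. z \<in> cstrip \<Longrightarrow> cmod (f z k) \<le> b k" by metis
  have b0: "0 \<le> b k" for k using b[of "\<i> * of_real 0" k] norm_ge_zero order_trans line0_in_cstrip by blast
  define B where "B = sum b A"
  have sumA: "(\<Sum>k<K. cmod (f z k)) \<le> B" if z: "z \<in> cstrip" for z K
  proof -
    have "(\<Sum>k<K. cmod (f z k)) = (\<Sum>k\<in>{..<K} \<inter> A. cmod (f z k))"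
      by (intro sum.mono_neutral_right) (use A in auto)
    also have "\<dots> \<le> (\<Sum>k\<in>A. cmod (f z k))" by (intro sum_mono2) (use A in auto)
    also have "\<dots> \<le> B" unfolding B_def by (intro sum_mono b z)
    finally show ?thesis .
  qed
  show ?thesis
  proof (rule calderonI[where B = B and M = B])
    show "(\<lambda>z. f z k) holomorphic_on strip" for k using s by (rule strip_fun_holomorphic)
    show "cmod (f z k) \<le> B" if "z \<in> cstrip" for z k
    proof -
      have "cmod (f z k) \<le> (\<Sum>k<Suc k. cmod (f z k))" by (simp add: sum_nonneg)
      then show ?thesis using sumA[OF that] order_trans by blast
    qed
    show "(\<Sum>k<K. cmod (f (line1 t) k)) \<le> B" for t K by (rule sumA) simp
    fix z and e :: real assume z: "z \<in> cstrip" "e > 0"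
    have "\<exists>d>0. \<forall>w\<in>cstrip. cmod (w - z) < d \<longrightarrow> cmod (f w k - f z k) \<le> e" for k
      using strip_fun_continuous[OF s[of k], unfolded continuous_on_iff dist_norm, rule_format, OF z] less_imp_le by blast
    then obtain d where d: "\<And>k. d k > 0" "\<And>k w. w\<in>cstrip \<Longrightarrow> cmod (w - z) < d k \<Longrightarrow> cmod (f w k - f z k) \<le> e"
      by metis
    define D where "D = Min (insert 1 (d ` A))"
    have D: "D > 0" "\<And>k. k \<in> A \<Longrightarrow> D \<le> d k"
      unfolding D_def using d(1) A(1) by auto
    have "cmod (f w k - f z k) \<le> e" if "w \<in> cstrip" "cmod (w - z) < D" for w k
    proof (cases "k \<in> A")
      case True then show ?thesis using D(2)[OF True] that by (intro d(2)) auto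
    next
      case False then show ?thesis using A z by simp
    qed
    then show "\<exists>d>0. \<forall>w\<in>cstrip. cmod (w - z) < d \<longrightarrow> (\<forall>k. cmod (f w k - f z k) \<le> e)"
      using D by blast
  qed
qed

lemma calderon_norm_le_finite:
  assumes A: "finite A" "\<And>z k. k \<notin> A \<Longrightarrow> f z k = 0"
    and "\<And>t k. k \<in> A \<Longrightarrow> cmod (f (line0 t) k) \<le> M"
    and l1: "\<And>t. (\<Sum>k\<in>A. cmod (f (line1 t) k)) \<le> M"
  shows "calderon_norm f \<le> M"
proof (rule calderon_norm_le)
  have "0 \<le> M" by (rule order_trans[OF sum_nonneg l1[of 0]]) simp
  then show "cmod (f (line0 t) k) \<le> M" for t k using assms by (cases "k \<in> A") auto
  fix t K
  have "(\<Sum>k<K. cmod (f (line1 t) k)) = (\<Sum>k\<in>{..<K} \<inter> A. cmod (f (line1 t) k))"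
    by (intro sum.mono_neutral_right) (use A in auto)
  also have "\<dots> \<le> (\<Sum>k\<in>A. cmod (f (line1 t) k))" by (intro sum_mono2) (use A in auto)
  also have "\<dots> \<le> M" by (rule l1)
  finally show "(\<Sum>k<K. cmod (f (line1 t) k)) \<le> M" .
qed

section \<open>The Rochberg norm\<close>

type_synonym array = "nat \<Rightarrow> nat \<Rightarrow> complex"

lemma vadd_eq_plus: "vadd x y = x + y"
  and vsub_eq_minus: "vsub x y = x - y"
  by (auto simp: vadd_def vsub_def fun_eq_iff)

lemma scal_apply [simp]: "scal c x j k = c * x j k"
  by (simp add: scal_def)

lemma scal_left_distrib: "scal (c + d) x = scal c x + scal d x"
  and scal_one: "scal 1 x = x"
  and scal_zero_left: "scal 0 x = 0"
  and scal_right_diff: "scal c (x - y) = scal c x - scal c y"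
  and scal_minus_one: "scal (-1) x = - x"
  by (auto simp: fun_eq_iff algebra_simps)

lemma sum_array_apply: "(\<Sum>i\<in>I. u i) j k = (\<Sum>i\<in>I. (u i :: array) j k)"
  by (induction I rule: infinite_finite_induct) auto

text \<open>Entries of index at least \<open>m\<close> are left free, so an array of order
  \<open>n\<close> can be measured by \<open>rnorm m\<close> for every \<open>m \<le> n\<close>
  without truncating it. As \<open>rnorm\<close> is an infimum, it is only meaningful under this
  condition.\<close>

definition representable :: "nat \<Rightarrow> array \<Rightarrow> bool" where
  "representable m x \<longleftrightarrow> (\<exists>f. represents m f x)"

definition taylor_array :: "nat \<Rightarrow> (complex \<Rightarrow> nat \<Rightarrow> complex) \<Rightarrow> array" where
  "taylor_array n f = (\<lambda>j. if j < n then taylor_coeff f j else (\<lambda>k. 0))"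

lemma representsI: "f \<in> calderon \<Longrightarrow> (\<And>j k. j < m \<Longrightarrow> x j k = taylor_coeff f j k) \<Longrightarrow> represents m f x"
  by (auto simp: represents_def)

lemma representsD:
  assumes "represents m f x"
  shows "f \<in> calderon" "\<And>j k. j < m \<Longrightarrow> taylor_coeff f j k = x j k"
  using assms by (auto simp: represents_def)

lemma representableI: "represents m f x \<Longrightarrow> representable m x"
  by (auto simp: representable_def)

lemma taylor_coeff_bound:
  "f \<in> calderon \<Longrightarrow> cmod (taylor_coeff f j k) \<le> 4 ^ j * calderon_norm f"
  unfolding taylor_coeff_germ
  by (intro germ_nth_bound calderon_coord_strip_fun calderon_coord_le) auto

lemma taylor_coeff_add:
  "f \<in> calderon \<Longrightarrow> g \<in> calderon \<Longrightarrow>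
    taylor_coeff (\<lambda>z k. f z k + g z k) j k = taylor_coeff f j k + taylor_coeff g j k"
  by (simp add: taylor_coeff_germ germ_add calderon_coord_strip_fun)

lemma taylor_coeff_coord_scale:
  "f \<in> calderon \<Longrightarrow> taylor_coeff (\<lambda>z k. c k * f z k) j k = c k * taylor_coeff f j k"
  by (simp add: taylor_coeff_germ germ_mult calderon_coord_strip_fun)

lemma rochberg_representable:
  assumes "x \<in> rochberg n" "m \<le> n"
  shows "representable m x"
  using assms unfolding rochberg_def representable_def represents_def by fastforce

lemma rochberg_iff: "x \<in> rochberg n \<longleftrightarrow> representable n x \<and> (\<forall>j\<ge>n. \<forall>k. x j k = 0)"
proof
  assume "x \<in> rochberg n"
  then show "representable n x \<and> (\<forall>j\<ge>n. \<forall>k. x j k = 0)"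
    unfolding rochberg_def representable_def by auto
next
  assume x: "representable n x \<and> (\<forall>j\<ge>n. \<forall>k. x j k = 0)"
  then obtain f where f: "represents n f x" by (auto simp: representable_def)
  have "bounded_seq (x j)" if "j < n" for j
    using taylor_coeff_bound[OF representsD(1)[OF f], of j] representsD(2)[OF f that]
    by (intro bounded_seqI[where M = "4 ^ j * calderon_norm f"]) simp
  then show "x \<in> rochberg n" using f x unfolding rochberg_def by auto
qed

lemma taylor_array_represents: "f \<in> calderon \<Longrightarrow> represents n f (taylor_array n f)"
  by (intro representsI) (auto simp: taylor_array_def)

lemma taylor_array_rochberg: "f \<in> calderon \<Longrightarrow> taylor_array n f \<in> rochberg n"
  unfolding rochberg_iff
  using representableI[OF taylor_array_represents] by (auto simp: taylor_array_def)

lemma represents_add: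
  "represents m f x \<Longrightarrow> represents m g y \<Longrightarrow> represents m (\<lambda>z k. f z k + g z k) (x + y)"
  by (intro representsI) (simp_all add: representsD taylor_coeff_add calderon_add)

lemma represents_coord_scale:
  "represents m f x \<Longrightarrow> (\<And>k. cmod (c k) \<le> C) \<Longrightarrow>
    represents m (\<lambda>z k. c k * f z k) (\<lambda>j k. c k * x j k)"
  by (intro representsI calderon_coord_scale(1)[where C = C])
     (simp_all add: representsD taylor_coeff_coord_scale)

lemma rnorm_bdd_below: "bdd_below {calderon_norm f | f. represents m f x}"
  by (rule bdd_belowI[where m = 0]) (auto simp: represents_def calderon_norm_nonneg)

lemma rnorm_le: "represents m f x \<Longrightarrow> rnorm m x \<le> calderon_norm f"
  unfolding rnorm_def by (intro cInf_lower rnorm_bdd_below) auto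

lemma rnorm_obtain:
  assumes "representable m x" "rnorm m x < M"
  obtains f where "represents m f x" "calderon_norm f < M"
proof -
  have "{calderon_norm f | f. represents m f x} \<noteq> {}" using assms by (auto simp: representable_def)
  then have "\<exists>r\<in>{calderon_norm f | f. represents m f x}. r < M"
    using assms(2) unfolding rnorm_def using cInf_less_iff[OF _ rnorm_bdd_below] by blast
  then show ?thesis using that by auto
qed

lemma rnorm_leI:
  assumes "representable m x" "\<And>f. represents m f x \<Longrightarrow> K \<le> calderon_norm f"
  shows "K \<le> rnorm m x"
  unfolding rnorm_def using assms by (intro cInf_greatest) (auto simp: representable_def)

lemma rnorm_nonneg: "representable m x \<Longrightarrow> 0 \<le> rnorm m x"
  by (rule rnorm_leI) (auto simp: represents_def calderon_norm_nonneg)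

lemma representable_add: "representable m x \<Longrightarrow> representable m y \<Longrightarrow> representable m (x + y)"
  unfolding representable_def using represents_add by blast

lemma rnorm_triangle:
  assumes x: "representable m x" and y: "representable m y"
  shows "rnorm m (x + y) \<le> rnorm m x + rnorm m y"
proof (rule field_le_epsilon)
  fix e :: real assume "e > 0"
  then have e: "rnorm m x < rnorm m x + e/2" "rnorm m y < rnorm m y + e/2" by auto
  obtain f where f: "represents m f x" "calderon_norm f < rnorm m x + e/2"
    by (rule rnorm_obtain[OF x e(1)]) (rule that)
  obtain g where g: "represents m g y" "calderon_norm g < rnorm m y + e/2"
    by (rule rnorm_obtain[OF y e(2)]) (rule that)
  have "rnorm m (x + y) \<le> calderon_norm (\<lambda>z k. f z k + g z k)"
    by (intro rnorm_le represents_add f g)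
  also have "\<dots> \<le> calderon_norm f + calderon_norm g"
    by (intro calderon_add representsD(1)[OF f(1)] representsD(1)[OF g(1)])
  finally show "rnorm m (x + y) \<le> rnorm m x + rnorm m y + e" using f g by simp
qed

lemma
  assumes x: "representable m x" and c: "\<And>k. cmod (c k) \<le> C"
  shows representable_coord_scale: "representable m (\<lambda>j k. c k * x j k)"
    and rnorm_coord_scale: "rnorm m (\<lambda>j k. c k * x j k) \<le> C * rnorm m x"
proof -
  show "representable m (\<lambda>j k. c k * x j k)"
    using x represents_coord_scale[of m _ x c, OF _ c] unfolding representable_def by blast
  have C: "0 \<le> C" using c[of 0] norm_ge_zero order_trans by blast
  show "rnorm m (\<lambda>j k. c k * x j k) \<le> C * rnorm m x"
  proof (rule field_le_epsilon)
    fix e :: real assume "e > 0"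
    then have e: "rnorm m x < rnorm m x + e / (C + 1)" using C by simp
    obtain f where f: "represents m f x" "calderon_norm f < rnorm m x + e / (C + 1)"
      by (rule rnorm_obtain[OF x e(1)]) (rule that)
    have "rnorm m (\<lambda>j k. c k * x j k) \<le> calderon_norm (\<lambda>z k. c k * f z k)"
      by (intro rnorm_le represents_coord_scale[OF _ c] f)
    also have "\<dots> \<le> C * calderon_norm f"
      by (intro calderon_coord_scale representsD(1)[OF f(1)] c)
    also have "\<dots> \<le> C * (rnorm m x + e / (C + 1))" using f C by (intro mult_left_mono) auto
    also have "\<dots> \<le> C * rnorm m x + e"
    proof -
      have "C * (e / (C + 1)) \<le> (C + 1) * (e / (C + 1))" using C \<open>e > 0\<close> by (intro mult_right_mono) auto
      then show ?thesis using C by (simp add: distrib_left)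
    qed
    finally show "rnorm m (\<lambda>j k. c k * x j k) \<le> C * rnorm m x + e" .
  qed
qed

lemma representable_scal: "representable m x \<Longrightarrow> representable m (scal c x)"
  unfolding scal_def by (rule representable_coord_scale[where C = "cmod c"]) auto

lemma rnorm_scal_le: "representable m x \<Longrightarrow> rnorm m (scal c x) \<le> cmod c * rnorm m x"
  unfolding scal_def by (rule rnorm_coord_scale) auto

lemma representable_zero: "representable m 0"
  and rnorm_zero: "rnorm m 0 = 0"
proof -
  have z: "(\<lambda>z k. 0) \<in> calderon" by (rule calderon_finite[where A = "{}"]) auto
  have r: "represents m (\<lambda>z k. 0) 0" by (intro representsI z) (simp add: taylor_coeff_germ)
  then show "representable m 0" by (rule representableI)
  have "calderon_norm (\<lambda>z k. 0) \<le> 0" by (rule calderon_norm_le) auto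
  then show "rnorm m 0 = 0"
    using rnorm_le[OF r] rnorm_nonneg[OF representableI[OF r]] by linarith
qed

text \<open>At order 0 no coefficient is prescribed, so all arrays have the same representatives as
  0. The assumption of being null at level 0 is therefore void.\<close>

lemma rnorm_order_0: "rnorm 0 x = 0"
proof -
  have "represents 0 f x \<longleftrightarrow> represents 0 f 0" for f by (simp add: represents_def)
  then have "rnorm 0 x = rnorm 0 0" unfolding rnorm_def by simp
  then show ?thesis by (simp add: rnorm_zero)
qed

lemma representable_uminus: "representable m x \<Longrightarrow> representable m (- x)"
  using representable_scal[of m x "-1"] by (simp add: scal_minus_one)

lemma rnorm_uminus: "representable m x \<Longrightarrow> rnorm m (- x) = rnorm m x"
  using rnorm_scal_le[of m x "-1"] rnorm_scal_le[of m "-x" "-1"] representable_uminus[of m x]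
  by (simp add: scal_minus_one)

lemma representable_diff: "representable m x \<Longrightarrow> representable m y \<Longrightarrow> representable m (x - y)"
  using representable_add[of m x "-y"] representable_uminus[of m y] by simp

lemma rnorm_triangle_diff:
  "representable m x \<Longrightarrow> representable m y \<Longrightarrow> rnorm m (x - y) \<le> rnorm m x + rnorm m y"
  using rnorm_triangle[of m x "-y"] rnorm_uminus[of m y] representable_uminus[of m y] by simp

lemma rnorm_triangle_sub:
  assumes "representable m x" "representable m y"
  shows "rnorm m x \<le> rnorm m y + rnorm m (x - y)"
  using rnorm_triangle[OF assms(2) representable_diff[OF assms]] by simp

lemma rnorm_diff_commute:
  assumes "representable m x" "representable m y"
  shows "rnorm m (x - y) = rnorm m (y - x)"
  using rnorm_uminus[OF representable_diff[OF assms]] by simp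

lemma representable_sum:
  "(\<And>i. i \<in> I \<Longrightarrow> representable m (u i)) \<Longrightarrow> representable m (\<Sum>i\<in>I. u i)"
  by (induction I rule: infinite_finite_induct) (auto intro: representable_add representable_zero)

lemma rnorm_sum:
  "(\<And>i. i \<in> I \<Longrightarrow> representable m (u i)) \<Longrightarrow> rnorm m (\<Sum>i\<in>I. u i) \<le> (\<Sum>i\<in>I. rnorm m (u i))"
proof (induction I rule: infinite_finite_induct)
  case (insert i I)
  then have "rnorm m (u i + (\<Sum>i\<in>I. u i)) \<le> rnorm m (u i) + rnorm m (\<Sum>i\<in>I. u i)"
    by (intro rnorm_triangle representable_sum) auto
  also have "\<dots> \<le> rnorm m (u i) + (\<Sum>i\<in>I. rnorm m (u i))"
    using insert by (intro add_left_mono insert.IH) auto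
  finally show ?case unfolding sum.insert[OF insert.hyps] .
qed (auto simp: rnorm_zero)

lemma representable_mono: "representable n x \<Longrightarrow> m \<le> n \<Longrightarrow> representable m x"
  unfolding representable_def represents_def by (meson less_le_trans)

lemma rnorm_mono:
  assumes "representable n x" "m \<le> n"
  shows "rnorm m x \<le> rnorm n x"
proof (rule rnorm_leI[OF assms(1)])
  fix f assume "represents n f x"
  then have "represents m f x" using assms(2) by (auto simp: represents_def)
  then show "rnorm m x \<le> calderon_norm f" by (rule rnorm_le)
qed

lemma coord_le_rnorm:
  assumes "representable m x" "j < m"
  shows "cmod (x j k) \<le> 4 ^ j * rnorm m x"
proof -
  have "cmod (x j k) / 4 ^ j \<le> rnorm m x"
  proof (rule rnorm_leI[OF assms(1)])
    fix f assume f: "represents m f x"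
    then have "cmod (x j k) \<le> 4 ^ j * calderon_norm f"
      using taylor_coeff_bound[OF representsD(1)[OF f], of j k] representsD(2)[OF f assms(2)] by simp
    then show "cmod (x j k) / 4 ^ j \<le> calderon_norm f" by (simp add: field_simps)
  qed
  then show ?thesis by (simp add: field_simps)
qed

section \<open>Coordinate projections and the array space itself\<close>

definition coord_proj :: "nat set \<Rightarrow> array \<Rightarrow> array" where
  "coord_proj A x = (\<lambda>j k. if k \<in> A then x j k else 0)"

definition supported_in :: "nat set \<Rightarrow> array \<Rightarrow> bool" where
  "supported_in A x \<longleftrightarrow> (\<forall>j k. k \<notin> A \<longrightarrow> x j k = 0)"

lemma coord_proj_supported: "supported_in A (coord_proj A x)"
  by (simp add: supported_in_def coord_proj_def)

lemma coord_proj_conv_scale: "coord_proj A x = (\<lambda>j k. (if k \<in> A then 1 else 0) * x j k)"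
  by (auto simp: coord_proj_def fun_eq_iff)

lemma
  assumes "representable m x"
  shows representable_coord_proj: "representable m (coord_proj A x)"
    and rnorm_coord_proj: "rnorm m (coord_proj A x) \<le> rnorm m x"
  unfolding coord_proj_conv_scale
  using representable_coord_scale[OF assms, of "\<lambda>k. if k \<in> A then 1 else 0" 1]
        rnorm_coord_scale[OF assms, of "\<lambda>k. if k \<in> A then 1 else 0" 1] by auto

lemma rochberg_coord_proj: "x \<in> rochberg n \<Longrightarrow> coord_proj A x \<in> rochberg n"
  unfolding rochberg_iff using representable_coord_proj[of n x A] by (simp add: coord_proj_def)

text \<open>Projecting a near-optimal representative onto \<open>A\<close> changes neither the array
  it represents nor, upwards, its norm.\<close>

lemma rnorm_obtain_supported:
  assumes "representable m x" "rnorm m x < M" "supported_in A x"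
  obtains f where "represents m f x" "calderon_norm f < M" "\<And>z k. k \<notin> A \<Longrightarrow> f z k = 0"
proof -
  obtain f where f: "represents m f x" "calderon_norm f < M"
    by (rule rnorm_obtain[OF assms(1,2)]) (rule that)
  define g where "g = (\<lambda>z k. (if k \<in> A then 1 else 0) * f z k)"
  have "(\<lambda>j k. (if k \<in> A then 1 else 0) * x j k) = x"
    using assms(3) by (auto simp: supported_in_def fun_eq_iff)
  then have "represents m g x"
    using represents_coord_scale[OF f(1), of "\<lambda>k. if k \<in> A then 1 else 0" 1] by (auto simp: g_def)
  moreover have "calderon_norm g \<le> 1 * calderon_norm f"
    unfolding g_def by (rule calderon_coord_scale[OF representsD(1)[OF f(1)]]) auto
  ultimately show ?thesis using f by (intro that[of g]) (auto simp: g_def)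
qed

lemma rochberg_add: "x \<in> rochberg n \<Longrightarrow> y \<in> rochberg n \<Longrightarrow> x + y \<in> rochberg n"
  and rochberg_diff: "x \<in> rochberg n \<Longrightarrow> y \<in> rochberg n \<Longrightarrow> x - y \<in> rochberg n"
  and rochberg_scal: "x \<in> rochberg n \<Longrightarrow> scal c x \<in> rochberg n"
  and rochberg_zero: "0 \<in> rochberg n"
  by (auto simp: rochberg_iff intro: representable_add representable_diff representable_scal representable_zero)

lemma rochberg_sum: "(\<And>i. i \<in> I \<Longrightarrow> u i \<in> rochberg n) \<Longrightarrow> (\<Sum>i\<in>I. u i) \<in> rochberg n"
  by (induction I rule: infinite_finite_induct) (auto intro: rochberg_add rochberg_zero)

lemma rochberg_rep: "x \<in> rochberg n \<Longrightarrow> representable n x"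
  by (simp add: rochberg_iff)

section \<open>Explicit functions on the strip and the norm bounds they give\<close>

lemma strip_fun_exp:
  "strip_fun (\<lambda>z. exp (of_real a * z))"
proof (rule strip_funI[where B = "exp \<bar>a\<bar>"])
  fix z assume z: "z \<in> cstrip"
  have "a * Re z \<le> \<bar>a\<bar> * 1"
    using z by (metis abs_ge_self abs_ge_zero abs_mult abs_of_nonneg cstrip_def mem_Collect_eq mult_left_mono order_trans)
  then show "cmod (exp (of_real a * z)) \<le> exp \<bar>a\<bar>" by simp
qed (auto intro!: continuous_intros holomorphic_intros)

lemma strip_fun_reflect:
  assumes "strip_fun g"
  shows "strip_fun (\<lambda>z. g (1 - z))"
proof -
  obtain B where B: "B > 0" "\<And>z. z \<in> cstrip \<Longrightarrow> cmod (g z) \<le> B"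
    by (rule strip_fun_boundedE[OF assms]) (rule that)
  have im: "(\<lambda>z. 1 - z) ` cstrip \<subseteq> cstrip" "(\<lambda>z. 1 - z) ` strip \<subseteq> strip"
    by (auto simp: cstrip_def strip_def)
  show ?thesis
  proof (rule strip_funI[where B = B])
    show "continuous_on cstrip (\<lambda>z. g (1 - z))"
      by (rule continuous_on_compose2[OF strip_fun_continuous[OF assms] _ im(1)]) (intro continuous_intros)
    show "(\<lambda>z. g (1 - z)) holomorphic_on strip"
      using holomorphic_on_compose_gen[OF holomorphic_on_diff[OF holomorphic_on_const holomorphic_on_ident]
          strip_fun_holomorphic[OF assms] im(2)]
      by (simp only: o_def)
    show "cmod (g (1 - z)) \<le> B" if "z \<in> cstrip" for z
      using im(1) that by (intro B(2)) auto
  qed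
qed

text \<open>The extremal function of complex interpolation between \<open>\<ell>\<^sub>\<infinity>\<close> and \<open>\<ell>\<^sub>1\<close> at \<open>1/2\<close>.\<close>

lemma extremal_l2:
  assumes A: "finite A" and s: "s > 0" "(\<Sum>k\<in>A. (cmod (v k))\<^sup>2) = s\<^sup>2"
  obtains Y where "\<And>k. strip_fun (Y k)" "\<And>k. Y k (1/2) = v k"
    "\<And>k t. cmod (Y k (line0 t)) \<le> s"
    "\<And>t. (\<Sum>k\<in>A. cmod (Y k (line1 t))) \<le> s"
proof -
  \<comment> \<open>For nonzero \<open>v k\<close> the modulus at real part \<open>x\<close> is
    \<open>s * (cmod (v k) / s)\<close> raised in its second factor to the power
    \<open>2 * x\<close>: it equals \<open>s\<close> on the left line, \<open>cmod (v k)\<close> at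
    1/2, and the square of \<open>cmod (v k)\<close> divided by \<open>s\<close> on the right line.
    Zero entries are separated because of the logarithm.\<close>
  define Y where "Y k z = (if v k = 0 then 0 else
      of_real s * sgn (v k) * exp (of_real (2 * ln (cmod (v k) / s)) * z))" for k z
  show ?thesis
  proof
    show "strip_fun (Y k)" for k
      unfolding Y_def by (cases "v k = 0") (auto intro!: strip_fun_mult strip_fun_exp simp del: of_real_mult)
    show "Y k (1/2) = v k" for k
    proof (cases "v k = 0")
      case False
      have "exp (of_real (2 * ln (cmod (v k) / s)) * (1/2)) = exp (of_real (ln (cmod (v k) / s)) :: complex)"
        by simp
      also have "\<dots> = of_real (cmod (v k) / s)"
        unfolding exp_of_real using False s by (subst exp_ln) auto
      finally show ?thesis using False s by (simp add: Y_def sgn_eq)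
    qed (simp add: Y_def)
    show "cmod (Y k (line0 t)) \<le> s" for k t
      using s by (auto simp: Y_def norm_mult norm_sgn)
    have n1: "cmod (Y k (line1 t)) = (cmod (v k))\<^sup>2 / s" for k t
    proof (cases "v k = 0")
      case False
      have "cmod (Y k (line1 t)) = s * exp (2 * ln (cmod (v k) / s))"
        using False s by (simp add: Y_def norm_mult norm_sgn)
      also have "exp (2 * ln (cmod (v k) / s)) = (cmod (v k) / s)\<^sup>2"
        using False s by (simp add: exp_double)
      finally show ?thesis using s by (simp add: field_simps power2_eq_square)
    qed (simp add: Y_def)
    show "(\<Sum>k\<in>A. cmod (Y k (line1 t))) \<le> s" for t
      using s unfolding n1 sum_divide_distrib[symmetric] s(2) by (simp add: power2_eq_square)
  qed
qed

text \<open>The reflection of \<open>z\<close> to \<open>1 - z\<close> exchanges the boundary lines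
  and so turns an extremal function for the pair into one for the dual pair. The conjugate makes the
  pairing with \<open>v\<close> over \<open>A\<close> equal to the square of \<open>s\<close> at
  1/2.\<close>

lemma extremal_l2_dual:
  assumes A: "finite A" and s: "s > 0" "(\<Sum>k\<in>A. (cmod (v k))\<^sup>2) = s\<^sup>2"
  obtains Y where "\<And>k. strip_fun (Y k)" "\<And>k. Y k (1/2) = cnj (v k)"
    "\<And>t. (\<Sum>k\<in>A. cmod (Y k (line0 t))) \<le> s"
    "\<And>k t. cmod (Y k (line1 t)) \<le> s"
proof -
  have s': "(\<Sum>k\<in>A. (cmod (cnj (v k)))\<^sup>2) = s\<^sup>2" using s by simp
  obtain Y where Y: "\<And>k. strip_fun (Y k)" "\<And>k. Y k (1/2) = cnj (v k)"
    "\<And>k t. cmod (Y k (line0 t)) \<le> s"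
    "\<And>t. (\<Sum>k\<in>A. cmod (Y k (line1 t))) \<le> s"
    by (rule extremal_l2[OF A s(1) s']) (rule that)
  show ?thesis
  proof
    show "strip_fun (\<lambda>z. Y k (1 - z))" for k by (intro strip_fun_reflect Y)
    show "Y k (1 - 1/2) = cnj (v k)" for k using Y(2)[of k] by simp
    show "(\<Sum>k\<in>A. cmod (Y k (1 - line0 t))) \<le> s" for t
      using Y(4)[of "-t"] by simp
    show "cmod (Y k (1 - (line1 t))) \<le> s" for k t
      using Y(3)[of k "-t"] by simp
  qed
qed

text \<open>A power of \<open>z - 1/2\<close> has the right germ but is unbounded on the strip. The
  factor \<open>th\<close> decays like a Gaussian in the imaginary direction and equals 1 at 1/2, so
  \<open>mu\<close> is bounded; the sum over \<open>s\<close> in \<open>e\<close> then removes the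
  effect of \<open>th ^ j\<close> on all coefficients below \<open>n\<close>.\<close>

lemma strip_fun_monomial:
  obtains e where "strip_fun e" "\<And>i. i < n \<Longrightarrow> fps_nth (germ e) i = (if i = j then 1 else 0)"
proof -
  define th where "th z = exp ((z - 1/2)\<^sup>2)" for z :: complex
  define mu where "mu z = (z - 1/2) * th z" for z
  have est: "cmod (th z) \<le> exp (1/2) * exp (- (cmod (z - 1/2))\<^sup>2)" if z: "z \<in> cstrip" for z
  proof -
    have x: "(Re z - 1/2)\<^sup>2 \<le> (1/2)\<^sup>2"
    proof (rule power2_le_iff_abs_le[THEN iffD2])
      have "0 \<le> Re z" "Re z \<le> 1" using z by (auto simp: cstrip_def)
      then show "\<bar>Re z - 1/2\<bar> \<le> 1/2" by linarith
    qed simp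
    have "cmod (th z) = exp ((Re z - 1/2)\<^sup>2 - (Im z)\<^sup>2)"
      by (simp add: th_def power2_eq_square)
    also have "\<dots> \<le> exp (1/2 + - ((Re z - 1/2)\<^sup>2 + (Im z)\<^sup>2))"
      using x by (simp add: power2_eq_square)
    also have "(Re z - 1/2)\<^sup>2 + (Im z)\<^sup>2 = (cmod (z - 1/2))\<^sup>2"
      by (simp add: cmod_power2)
    finally show ?thesis by (simp only: exp_add)
  qed
  have th: "strip_fun th"
  proof (rule strip_funI[where B = "exp (1/2)"])
    fix z assume "z \<in> cstrip"
    then have "cmod (th z) \<le> exp (1/2) * exp (- (cmod (z - 1/2))\<^sup>2)" by (rule est)
    also have "\<dots> \<le> exp (1/2) * 1" by (intro mult_left_mono) auto
    finally show "cmod (th z) \<le> exp (1/2)" by simp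
  qed (unfold th_def, intro continuous_intros, intro holomorphic_intros)
  have mu: "strip_fun mu"
  proof (rule strip_funI[where B = "exp (1/2)"])
    fix z assume z: "z \<in> cstrip"
    define u where "u = (cmod (z - 1/2))\<^sup>2"
    have "0 \<le> (cmod (z - 1/2) - 1)\<^sup>2" by simp
    then have "2 * cmod (z - 1/2) \<le> 1 + u" unfolding power2_diff u_def by simp
    moreover have "0 \<le> cmod (z - 1/2)" by simp
    ultimately have "cmod (z - 1/2) \<le> 1 + u" by linarith
    also have "\<dots> \<le> exp u" by (rule exp_ge_add_one_self)
    finally have "cmod (mu z) \<le> exp u * (exp (1/2) * exp (- u))"
      unfolding mu_def norm_mult using est[OF z] unfolding u_def by (intro mult_mono) auto
    then show "cmod (mu z) \<le> exp (1/2)" by (simp add: exp_minus field_simps)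
  qed (unfold mu_def th_def, intro continuous_intros, intro holomorphic_intros)
  define e where "e z = mu z ^ j * (\<Sum>s<n. (1 - th z ^ j) ^ s)" for z
  have e: "strip_fun e"
    unfolding e_def
    by (intro strip_fun_mult strip_fun_power strip_fun_sum strip_fun_diff strip_fun_const th mu)
  have eq: "e z = (z - 1/2) ^ j * (1 - (1 - th z ^ j) ^ n)" for z
  proof -
    have "1 - (1 - th z ^ j) ^ n = th z ^ j * (\<Sum>s<n. (1 - th z ^ j) ^ s)"
      using one_diff_power_eq[of "1 - th z ^ j" n] by (simp only: diff_diff_eq2 add_diff_cancel_left')
    then show ?thesis by (simp only: e_def mu_def power_mult_distrib mult.assoc)
  qed
  define P where "P = (1 - germ th ^ j) ^ n"
  have P: "fps_nth P i = 0" if "i < n" for i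
    unfolding P_def
    using startsby_zero_power_prefix[of "1 - germ th ^ j" n] that
    by (simp add: fps_power_zeroth germ_nth_0 th_def)
  have "(\<lambda>x. x ^ j * (1 - (1 - th (1/2 + x) ^ j) ^ n)) has_fps_expansion fps_X ^ j * (1 - P)"
    unfolding P_def
    by (intro has_fps_expansion_mult has_fps_expansion_fps_X_power has_fps_expansion_diff
        has_fps_expansion_power has_fps_expansion_1 has_fps_expansion_germ strip_fun_holomorphic th)
  then have "germ e = fps_X ^ j * (1 - P)"
    by (intro germ_eqI) (simp add: eq)
  then have "fps_nth (germ e) i = (if i = j then 1 else 0)" if "i < n" for i
    using that P[of "i - j"] by (auto simp: fps_X_power_mult_nth)
  with e that show ?thesis by blast
qed

text \<open>A crude bound by the sum of all entries, from one monomial substitute per position.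
  \<open>C\<close> depends on \<open>n\<close> alone; this is what makes finitely many coordinates
  of a coordinatewise null sequence negligible in norm.\<close>

lemma rnorm_finite_support:
  obtains C where "C > 0"
    "\<And>A x. finite A \<Longrightarrow> supported_in A x \<Longrightarrow>
        representable n x \<and> rnorm n x \<le> C * (\<Sum>k\<in>A. \<Sum>j<n. cmod (x j k))"
proof -
  have "\<exists>e. strip_fun e \<and> (\<forall>i<n. fps_nth (germ e) i = (if i = j then 1 else 0))" for j
    by (rule strip_fun_monomial[of n j]) blast
  then obtain e where e: "\<And>j. strip_fun (e j)"
      "\<And>i j. i < n \<Longrightarrow> fps_nth (germ (e j)) i = (if i = j then 1 else 0)" by metis
  have "\<exists>B>0. \<forall>z\<in>cstrip. cmod (e j z) \<le> B" for j
    by (rule strip_fun_boundedE[OF e(1)[of j]]) blast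
  then obtain b where b: "\<And>j. b j > 0" "\<And>j z. z \<in> cstrip \<Longrightarrow> cmod (e j z) \<le> b j" by metis
  define C where "C = 1 + (\<Sum>j<n. b j)"
  have C: "C > 0" unfolding C_def using b(1) by (intro add_pos_nonneg sum_nonneg) (auto intro: less_imp_le)
  have bC: "b j \<le> C" if "j < n" for j
    using member_le_sum[of j "{..<n}" b] b(1) that unfolding C_def by (force intro: less_imp_le)
  show ?thesis
  proof (rule that[OF C])
    fix A x assume A: "finite A" "supported_in A x"
    define f where "f z k = (\<Sum>j<n. x j k * e j z)" for z k
    have s: "strip_fun (\<lambda>z. f z k)" for k unfolding f_def by (intro strip_fun_sum strip_fun_mult e) auto
    have z: "f z k = 0" if "k \<notin> A" for z k using A that by (simp add: f_def supported_in_def)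
    have fc: "f \<in> calderon" using calderon_finite[OF s A(1) z] .
    have rep: "represents n f x"
    proof (rule representsI[OF fc])
      fix j k assume j: "j < n"
      have "taylor_coeff f j k = (\<Sum>i<n. x i k * (if j = i then 1 else 0))"
        unfolding taylor_coeff_germ f_def using e j
        by (subst germ_sum) (auto simp: fps_sum_nth germ_mult)
      then show "x j k = taylor_coeff f j k" using j by (simp add: if_distrib cong: if_cong)
    qed
    have fb: "cmod (f z k) \<le> C * (\<Sum>j<n. cmod (x j k))" if "z \<in> cstrip" for z k
    proof -
      have "cmod (f z k) \<le> (\<Sum>j<n. cmod (x j k) * cmod (e j z))"
        unfolding f_def by (rule order_trans[OF norm_sum]) (simp add: norm_mult)
      also have "\<dots> \<le> (\<Sum>j<n. cmod (x j k) * C)"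
        using b(2)[OF that] bC by (intro sum_mono mult_left_mono) (auto intro: order_trans)
      finally show ?thesis by (simp add: sum_distrib_left mult.commute)
    qed
    have "rnorm n x \<le> calderon_norm f" by (rule rnorm_le[OF rep])
    also have "\<dots> \<le> C * (\<Sum>k\<in>A. \<Sum>j<n. cmod (x j k))"
    proof (rule calderon_norm_le_finite[OF A(1) z])
      fix t k assume k: "k \<in> A"
      have "cmod (f (line0 t) k) \<le> C * (\<Sum>j<n. cmod (x j k))" by (rule fb) simp
      also have "\<dots> \<le> C * (\<Sum>k\<in>A. \<Sum>j<n. cmod (x j k))"
        using C k A(1) member_le_sum[of k A "\<lambda>k. \<Sum>j<n. cmod (x j k)"]
        by (intro mult_left_mono) (auto simp: sum_nonneg)
      finally show "cmod (f (line0 t) k) \<le> C * (\<Sum>k\<in>A. \<Sum>j<n. cmod (x j k))" .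
    next
      fix t
      show "(\<Sum>k\<in>A. cmod (f (line1 t) k)) \<le> C * (\<Sum>k\<in>A. \<Sum>j<n. cmod (x j k))"
        unfolding sum_distrib_left[of C] by (intro sum_mono fb[unfolded sum_distrib_left]) simp
    qed
    finally show "representable n x \<and> rnorm n x \<le> C * (\<Sum>k\<in>A. \<Sum>j<n. cmod (x j k))"
      using representableI[OF rep] by simp
  qed
qed

definition vanishes_below :: "nat \<Rightarrow> array \<Rightarrow> bool" where
  "vanishes_below l x \<longleftrightarrow> (\<forall>j<l. \<forall>k. x j k = 0)"

text \<open>Only the entry \<open>x l\<close> is visible, and interpolation of the pair at 1/2
  measures it by its \<open>l2\<close> norm: a degree \<open>l\<close> monomial substitute times the
  extremal function is a representative. Used in reverse, to bound the \<open>l2\<close> norm of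
  \<open>x l\<close> from below.\<close>

lemma rnorm_Suc_le_l2:
  obtains C where "C > 0"
    "\<And>A x s. finite A \<Longrightarrow> supported_in A x \<Longrightarrow> vanishes_below l x \<Longrightarrow> s > 0 \<Longrightarrow>
       (\<Sum>k\<in>A. (cmod (x l k))\<^sup>2) = s\<^sup>2 \<Longrightarrow> rnorm (Suc l) x \<le> C * s"
proof -
  obtain e where e: "strip_fun e" "\<And>i. i < Suc l \<Longrightarrow> fps_nth (germ e) i = (if i = l then 1 else 0)"
    by (rule strip_fun_monomial[of "Suc l" l]) (rule that)
  obtain C where C: "C > 0" "\<And>z. z \<in> cstrip \<Longrightarrow> cmod (e z) \<le> C"
    by (rule strip_fun_boundedE[OF e(1)]) (rule that)
  show ?thesis
  proof (rule that[OF C(1)])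
    fix A x s
    assume A: "finite A" "supported_in A x" "vanishes_below l x"
      and s: "s > 0" "(\<Sum>k\<in>A. (cmod (x l k))\<^sup>2) = s\<^sup>2"
    obtain Y where Y: "\<And>k. strip_fun (Y k)" "\<And>k. Y k (1/2) = x l k"
      "\<And>k t. cmod (Y k (line0 t)) \<le> s"
      "\<And>t. (\<Sum>k\<in>A. cmod (Y k (line1 t))) \<le> s"
      by (rule extremal_l2[OF A(1) s]) (rule that)
    define f where "f z k = (if k \<in> A then e z * Y k z else 0)" for z k
    have sf: "strip_fun (\<lambda>z. f z k)" for k
      by (cases "k \<in> A") (auto simp: f_def intro!: strip_fun_mult e Y)
    have z: "f z k = 0" if "k \<notin> A" for z k using that by (simp add: f_def)
    have fc: "f \<in> calderon" using calderon_finite[OF sf A(1) z] .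
    have rep: "represents (Suc l) f x"
    proof (rule representsI[OF fc])
      fix j k assume j: "j < Suc l"
      show "x j k = taylor_coeff f j k"
      proof (cases "k \<in> A")
        case True
        have "taylor_coeff f j k = (\<Sum>i=0..j. fps_nth (germ e) i * fps_nth (germ (Y k)) (j - i))"
          using True by (simp add: taylor_coeff_germ f_def germ_mult e Y fps_mult_nth)
        also have "\<dots> = (\<Sum>i=0..j. (if i = l then fps_nth (germ (Y k)) (j - i) else 0))"
          using j by (intro sum.cong) (auto simp: e(2))
        also have "\<dots> = (if j = l then x l k else 0)"
          using j by (auto simp: germ_nth_0 Y(2))
        finally show ?thesis using j A(3) by (auto simp: vanishes_below_def)
      next
        case False
        then show ?thesis using A by (simp add: supported_in_def taylor_coeff_germ f_def)
      qed
    qed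
    have "rnorm (Suc l) x \<le> calderon_norm f" by (rule rnorm_le[OF rep])
    also have "\<dots> \<le> C * s"
    proof (rule calderon_norm_le_finite[OF A(1) z])
      show "cmod (f (line0 t) k) \<le> C * s" if "k \<in> A" for t k
        using that C Y(3)[of k t] by (auto simp: f_def norm_mult intro!: mult_mono)
      fix t
      have "(\<Sum>k\<in>A. cmod (f (line1 t) k))
          \<le> (\<Sum>k\<in>A. C * cmod (Y k (line1 t)))"
        using C by (intro sum_mono) (auto simp: f_def norm_mult intro!: mult_mono)
      also have "\<dots> \<le> C * s"
        using C Y(4)[of t] by (simp flip: sum_distrib_left)
      finally show "(\<Sum>k\<in>A. cmod (f (line1 t) k)) \<le> C * s" .
    qed
    finally show "rnorm (Suc l) x \<le> C * s" .
  qed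
qed

section \<open>Block estimates\<close>

lemma rnorm_cong: "(\<And>j. j < m \<Longrightarrow> x j = y j) \<Longrightarrow> rnorm m x = rnorm m y"
  unfolding rnorm_def represents_def by simp

definition base_array :: "nat \<Rightarrow> (nat \<Rightarrow> complex) \<Rightarrow> array" where
  "base_array N a = (\<lambda>j k. if j = 0 \<and> k < N then a k else 0)"

lemma base_array_representable: "representable m (base_array N a)"
proof -
  obtain C where C: "C > 0" "\<And>A x. finite A \<Longrightarrow> supported_in A x \<Longrightarrow>
        representable m x \<and> rnorm m x \<le> C * (\<Sum>k\<in>A. \<Sum>j<m. cmod (x j k))"
    by (rule rnorm_finite_support[of m]) (rule that)
  show ?thesis using C(2)[of "{..<N}" "base_array N a"] by (simp add: supported_in_def base_array_def)
qed

lemma coeff_le_rnorm_base_array: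
  assumes "m > 0" "i < N"
  shows "cmod (a i) \<le> rnorm m (base_array N a)"
  using coord_le_rnorm[OF base_array_representable assms(1), of N a i] assms by (simp add: base_array_def)

lemma line_dist_half:
  "1/2 \<le> cmod (line0 t - 1/2)" "1/2 \<le> cmod (line1 t - 1/2)"
  using abs_Re_le_cmod[of "line0 t - 1/2"] abs_Re_le_cmod[of "line1 t - 1/2"]
  by auto

text \<open>Divide a representative by \<open>z - 1/2\<close>. On both boundary lines this has
  modulus at least 1/2, which gives the factor 2. The quotients arise one coordinate at a time, and
  finiteness of \<open>A\<close> allows them to be reassembled.\<close>

lemma rnorm_shift_one:
  assumes w: "representable (Suc m) w" and A: "finite A" "supported_in A w" and v: "\<And>k. w 0 k = 0"
  shows "representable m (\<lambda>s. w (Suc s)) \<and> rnorm m (\<lambda>s. w (Suc s)) \<le> 2 * rnorm (Suc m) w"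
proof -
  have key: "\<exists>h. represents m h (\<lambda>s. w (Suc s)) \<and> calderon_norm h \<le> 2 * calderon_norm f"
    if f: "represents (Suc m) f w" for f
  proof -
    note fc = representsD(1)[OF f]
    have "\<exists>h. strip_fun h \<and> (\<forall>z. f z k = (z - 1/2) * h z) \<and>
        (\<forall>j. fps_nth (germ h) j = fps_nth (germ (\<lambda>z. f z k)) (Suc j))" for k
    proof -
      have "f (1/2) k = 0"
        using representsD(2)[OF f, of 0 k] v by (simp add: taylor_coeff_germ germ_nth_0)
      then show ?thesis
        by (rule strip_fun_divide_zero[OF calderon_coord_strip_fun[OF fc]]) blast
    qed
    then obtain h where h: "\<And>k. strip_fun (h k)" "\<And>k z. f z k = (z - 1/2) * h k z"
      "\<And>k j. fps_nth (germ (h k)) j = fps_nth (germ (\<lambda>z. f z k)) (Suc j)" by metis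
    define g where "g z k = (if k \<in> A then h k z else 0)" for z k
    have sg: "strip_fun (\<lambda>z. g z k)" for k unfolding g_def using h(1) by (cases "k \<in> A") auto
    have z: "g z k = 0" if "k \<notin> A" for z k using that by (simp add: g_def)
    have gc: "g \<in> calderon" using calderon_finite[OF sg A(1) z] .
    have gf: "cmod (g z k) \<le> 2 * cmod (f z k)" if "1/2 \<le> cmod (z - 1/2)" for z k
    proof (cases "k \<in> A")
      case True
      have "1/2 * cmod (h k z) \<le> cmod (z - 1/2) * cmod (h k z)"
        using that by (intro mult_right_mono) auto
      also have "\<dots> = cmod (f z k)" by (simp only: h(2) norm_mult)
      finally show ?thesis using True by (simp add: g_def)
    qed (simp add: g_def)
    have "represents m g (\<lambda>s. w (Suc s))"
    proof (rule representsI[OF gc])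
      fix j k assume j: "j < m"
      show "w (Suc j) k = taylor_coeff g j k"
      proof (cases "k \<in> A")
        case True
        then show ?thesis using h(3)[of k j] representsD(2)[OF f, of "Suc j" k] j
          by (simp add: g_def taylor_coeff_germ)
      next
        case False
        then show ?thesis using A by (simp add: g_def taylor_coeff_germ supported_in_def)
      qed
    qed
    moreover have "calderon_norm g \<le> 2 * calderon_norm f"
    proof (rule calderon_norm_le_finite[OF A(1) z])
      show "cmod (g (line0 t) k) \<le> 2 * calderon_norm f" for t k
        using gf[OF line_dist_half(1)[of t], of k] calderon_line0[OF fc, of t k] by linarith
      fix t
      have "(\<Sum>k\<in>A. cmod (g (line1 t) k)) \<le> (\<Sum>k\<in>A. 2 * cmod (f (line1 t) k))"
        by (intro sum_mono gf line_dist_half)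
      also have "\<dots> \<le> 2 * calderon_norm f"
        using calderon_line1[OF fc A(1), of t] by (simp flip: sum_distrib_left)
      finally show "(\<Sum>k\<in>A. cmod (g (line1 t) k)) \<le> 2 * calderon_norm f" .
    qed
    ultimately show ?thesis by (intro exI[of _ g] conjI)
  qed
  obtain f where "represents (Suc m) f w" using w by (auto simp: representable_def)
  then have rep: "representable m (\<lambda>s. w (Suc s))" using key representableI by blast
  have "rnorm m (\<lambda>s. w (Suc s)) / 2 \<le> rnorm (Suc m) w"
  proof (rule rnorm_leI[OF w])
    fix f assume "represents (Suc m) f w"
    then obtain h where "represents m h (\<lambda>s. w (Suc s))" "calderon_norm h \<le> 2 * calderon_norm f"
      using key by blast
    then show "rnorm m (\<lambda>s. w (Suc s)) / 2 \<le> calderon_norm f"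
      using rnorm_le by fastforce
  qed
  with rep show ?thesis by simp
qed

lemma rnorm_shift:
  assumes "representable n w" "finite A" "supported_in A w" "vanishes_below l w" "l \<le> n"
  shows "representable (n - l) (\<lambda>s. w (s + l)) \<and> rnorm (n - l) (\<lambda>s. w (s + l)) \<le> 2 ^ l * rnorm n w"
  using assms
proof (induction l arbitrary: n w)
  case 0
  then show ?case by simp
next
  case (Suc l)
  then obtain m where n: "n = Suc m" by (cases n) auto
  have 1: "representable m (\<lambda>s. w (Suc s)) \<and> rnorm m (\<lambda>s. w (Suc s)) \<le> 2 * rnorm n w"
    using Suc.prems unfolding n by (intro rnorm_shift_one[where A = A]) (auto simp: vanishes_below_def)
  have 2: "representable (m - l) (\<lambda>s. w (Suc (s + l))) \<and>
      rnorm (m - l) (\<lambda>s. w (Suc (s + l))) \<le> 2 ^ l * rnorm m (\<lambda>s. w (Suc s))"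
    using Suc.prems n 1 by (intro Suc.IH) (auto simp: supported_in_def vanishes_below_def)
  have "2 ^ l * rnorm m (\<lambda>s. w (Suc s)) \<le> 2 ^ l * (2 * rnorm n w)"
    using 1 by (intro mult_left_mono) auto
  then have "rnorm (m - l) (\<lambda>s. w (Suc (s + l))) \<le> 2 ^ l * (2 * rnorm n w)"
    using 2 by linarith
  then have "rnorm (m - l) (\<lambda>s. w (Suc (s + l))) \<le> 2 ^ Suc l * rnorm n w"
    by (simp only: power_Suc mult_ac)
  with 2 show ?case unfolding n by simp
qed

lemma sum_single_block:
  fixes g :: "nat \<Rightarrow> real"
  assumes disj: "\<And>i j. i < N \<Longrightarrow> j < N \<Longrightarrow> i \<noteq> j \<Longrightarrow> A i \<inter> A j = {}"
    and z: "\<And>i. i < N \<Longrightarrow> k \<notin> A i \<Longrightarrow> g i = 0"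
    and b: "\<And>i. i < N \<Longrightarrow> g i \<le> B" and "0 \<le> B"
  shows "(\<Sum>i<N. g i) \<le> B"
proof (cases "\<exists>i<N. k \<in> A i")
  case True
  then obtain i where i: "i < N" "k \<in> A i" by auto
  have "g j = 0" if "j < N" "j \<noteq> i" for j
    using disj[of i j] i that by (intro z) auto
  then have "(\<Sum>i<N. g i) = g i"
    using i by (subst sum.remove[of _ i]) (auto intro!: sum.neutral)
  then show ?thesis using b i by simp
next
  case False
  then have "(\<Sum>i<N. g i) = 0" using z by (intro sum.neutral) auto
  then show ?thesis using assms by simp
qed

abbreviation lincomb :: "nat \<Rightarrow> (nat \<Rightarrow> complex) \<Rightarrow> (nat \<Rightarrow> array) \<Rightarrow> array" where
  "lincomb N a w \<equiv> \<Sum>i<N. scal (a i) (w i)"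

definition block_system :: "nat \<Rightarrow> nat \<Rightarrow> (nat \<Rightarrow> nat set) \<Rightarrow> (nat \<Rightarrow> array) \<Rightarrow> bool" where
  "block_system n l A w \<longleftrightarrow> (\<forall>i j. i \<noteq> j \<longrightarrow> A i \<inter> A j = {}) \<and>
     (\<forall>i. finite (A i) \<and> supported_in (A i) (w i) \<and> w i \<in> rochberg n \<and> vanishes_below l (w i))"

lemma block_systemD:
  assumes "block_system n l A w"
  shows "i \<noteq> j \<Longrightarrow> A i \<inter> A j = {}" "finite (A i)" "supported_in (A i) (w i)" "w i \<in> rochberg n"
    "representable n (w i)" "vanishes_below l (w i)"
  using assms by (auto simp: block_system_def rochberg_rep)

text \<open>If \<open>g\<close> represents the model sum and \<open>f i\<close> the block
  \<open>w i\<close>, the sum of the products \<open>g z i * f i z k\<close> represents the block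
  sum. On the left line disjointness leaves one term per coordinate; on the right line the
  \<open>l1\<close> norms of the blocks are weighted by the coordinates of \<open>g\<close>.\<close>

lemma rnorm_blocks_upper:
  assumes bs: "block_system n l A w"
    and nrm: "\<And>i. rnorm n (w i) < M" and M: "0 < M"
    and l: "l \<le> n"
  shows "rnorm n (lincomb N a w) \<le> M * rnorm (n - l) (base_array N a)"
proof -
  note disj = block_systemD(1)[OF bs] and fin = block_systemD(2)[OF bs]
    and supp = block_systemD(3)[OF bs] and rep = block_systemD(5)[OF bs] and van = block_systemD(6)[OF bs]
  have "\<exists>f. represents n f (w i) \<and> calderon_norm f < M \<and> (\<forall>z k. k \<notin> A i \<longrightarrow> f z k = 0)" if "i < N" for i
    by (rule rnorm_obtain_supported[OF rep nrm supp]) blast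
  then obtain f where f: "\<And>i. i < N \<Longrightarrow> represents n (f i) (w i)" "\<And>i. i < N \<Longrightarrow> calderon_norm (f i) < M"
     "\<And>i z k. i < N \<Longrightarrow> k \<notin> A i \<Longrightarrow> f i z k = 0" by metis
  have fc: "f i \<in> calderon" if "i < N" for i using representsD(1)[OF f(1)[OF that]] .
  have "rnorm n (lincomb N a w) / M \<le> rnorm (n - l) (base_array N a)"
  proof (rule rnorm_leI[OF base_array_representable])
    fix g assume g: "represents (n - l) g (base_array N a)"
    note gc = representsD(1)[OF g]
    define R where "R = calderon_norm g"
    have R: "0 \<le> R" unfolding R_def by (rule calderon_norm_nonneg[OF gc])
    define G where "G z k = (\<Sum>i<N. g z i * f i z k)" for z k
    define U where "U = (\<Union>i<N. A i)"
    have U: "finite U" unfolding U_def using fin by auto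
    have sG: "strip_fun (\<lambda>z. G z k)" for k
      unfolding G_def by (intro strip_fun_sum strip_fun_mult calderon_coord_strip_fun gc fc) auto
    have z: "G z k = 0" if "k \<notin> U" for z k
      using that f(3) by (auto simp: G_def U_def intro!: sum.neutral)
    have Gc: "G \<in> calderon" using calderon_finite[OF sG U z] .
    have "represents n G (lincomb N a w)"
    proof (rule representsI[OF Gc])
      fix j k assume j: "j < n"
      have "fps_nth (germ (\<lambda>z. g z i * f i z k)) j = a i * w i j k" if i: "i < N" for i
      proof -
        have "fps_nth (germ (\<lambda>z. g z i * f i z k)) j
            = (\<Sum>s=0..j. taylor_coeff g s i * taylor_coeff (f i) (j - s) k)"
          using gc fc[OF i] by (simp add: germ_mult calderon_coord_strip_fun fps_mult_nth taylor_coeff_germ)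
        also have "\<dots> = (\<Sum>s=0..j. if s = 0 then a i * w i j k else 0)"
        proof (rule sum.cong[OF refl])
          fix s assume s: "s \<in> {0..j}"
          have t: "taylor_coeff (f i) (j - s) k = w i (j - s) k"
            using j by (intro representsD(2)[OF f(1)[OF i]]) auto
          show "taylor_coeff g s i * taylor_coeff (f i) (j - s) k = (if s = 0 then a i * w i j k else 0)"
          proof (cases "s < n - l")
            case True
            then have "taylor_coeff g s i = base_array N a s i" by (rule representsD(2)[OF g])
            then show ?thesis using i t by (simp add: base_array_def)
          next
            case False
            \<comment> \<open>Coefficients of \<open>g\<close> of order \<open>n - l\<close> and
              beyond are unknown, but in the product formula they only meet entries of
              \<open>w i\<close> below \<open>l\<close>, which vanish. Hence order
              \<open>n - l\<close> suffices for \<open>g\<close>.\<close>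
            then have "j - s < l" using j l s by auto
            then have "w i (j - s) k = 0" using van[of i] by (simp add: vanishes_below_def)
            then show ?thesis using t by auto
          qed
        qed
        finally show ?thesis by simp
      qed
      then show "(lincomb N a w) j k = taylor_coeff G j k"
        unfolding taylor_coeff_germ G_def sum_array_apply
        by (subst germ_sum)
           (auto simp: fps_sum_nth intro: strip_fun_mult[OF calderon_coord_strip_fun[OF gc] calderon_coord_strip_fun[OF fc]])
    qed
    then have "rnorm n (lincomb N a w) \<le> calderon_norm G" by (rule rnorm_le)
    also have "\<dots> \<le> R * M"
    proof (rule calderon_norm_le_finite[OF U z])
      fix t k
      have "cmod (G (line0 t) k)
          \<le> (\<Sum>i<N. cmod (g (line0 t) i * f i (line0 t) k))"
        unfolding G_def by (rule norm_sum)
      also have "\<dots> \<le> R * M"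
      proof (rule sum_single_block[OF disj])
        fix i assume i: "i < N"
        show "cmod (g (line0 t) i * f i (line0 t) k) = 0" if "k \<notin> A i"
          using f(3)[OF i that] by simp
        show "cmod (g (line0 t) i * f i (line0 t) k) \<le> R * M"
          unfolding norm_mult R_def
          using calderon_line0[OF gc, of t i] calderon_line0[OF fc[OF i], of t k] f(2)[OF i] R
          by (intro mult_mono) (auto simp: R_def)
      qed (use R M in auto)
      finally show "cmod (G (line0 t) k) \<le> R * M" .
    next
      fix t
      have "(\<Sum>k\<in>U. cmod (G (line1 t) k))
         \<le> (\<Sum>k\<in>U. \<Sum>i<N. cmod (g (line1 t) i) * cmod (f i (line1 t) k))"
        unfolding G_def norm_mult[symmetric] by (intro sum_mono norm_sum)
      also have "\<dots> = (\<Sum>i<N. cmod (g (line1 t) i) * (\<Sum>k\<in>U. cmod (f i (line1 t) k)))"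
        by (subst sum.swap) (simp add: sum_distrib_left)
      also have "\<dots> \<le> (\<Sum>i<N. cmod (g (line1 t) i) * M)"
        using order_trans[OF calderon_line1[OF fc U, of _ t] less_imp_le[OF f(2)]]
        by (intro sum_mono mult_left_mono) auto
      also have "\<dots> \<le> R * M"
        unfolding sum_distrib_right[symmetric] R_def
        using M by (intro mult_right_mono calderon_line1 gc) auto
      finally show "(\<Sum>k\<in>U. cmod (G (line1 t) k)) \<le> R * M" .
    qed
    finally show "rnorm n (lincomb N a w) / M \<le> calderon_norm g"
      using M by (simp add: pos_divide_le_eq R_def)
  qed
  then show ?thesis using M by (simp add: pos_divide_le_eq mult.commute)
qed

text \<open>The functions \<open>h i\<close> below pair a representative of \<open>w i\<close> with the extremal function of
  the dual interpolation pair; since \<open>h i (1/2) = 1\<close>, the finite geometric series in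
  \<open>1 - h i\<close> inverts the germ of \<open>h i\<close> up to order \<open>m\<close>.\<close>

lemma rnorm_blocks_lower_0:
  assumes disj: "\<And>i j. i < N \<Longrightarrow> j < N \<Longrightarrow> i \<noteq> j \<Longrightarrow> A i \<inter> A j = {}"
    and fin: "\<And>i. i < N \<Longrightarrow> finite (A i)"
    and supp: "\<And>i. i < N \<Longrightarrow> supported_in (A i) (w i)"
    and rep: "\<And>i. i < N \<Longrightarrow> representable m (w i)"
    and nrm: "\<And>i. i < N \<Longrightarrow> rnorm m (w i) < M" and M: "0 < M"
    and m: "0 < m" and d: "0 < d" "\<And>i. i < N \<Longrightarrow> d \<le> s i"
    and l2: "\<And>i. i < N \<Longrightarrow> (\<Sum>k\<in>A i. (cmod (w i 0 k))\<^sup>2) = (s i)\<^sup>2"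
  shows "rnorm m (base_array N a)
    \<le> (1 / d * (\<Sum>r<m. (1 + M / d) ^ r)) * rnorm m (lincomb N a w)"
proof -
  \<comment> \<open>A bound for the correctors \<open>q i\<close> on the boundary lines, where
    \<open>h i\<close> has modulus at most \<open>M / d\<close>.\<close>
  define K where "K = (\<Sum>r<m. (1 + M / d) ^ r)"
  have K0: "0 \<le> K" unfolding K_def using M d by (intro sum_nonneg zero_le_power) auto
  have spos: "s i > 0" if "i < N" for i using d that by (meson less_le_trans)
  have "\<exists>f. represents m f (w i) \<and> calderon_norm f < M \<and> (\<forall>z k. k \<notin> A i \<longrightarrow> f z k = 0)" if "i < N" for i
    by (rule rnorm_obtain_supported[OF rep[OF that] nrm[OF that] supp[OF that]]) blast
  then obtain f where f: "\<And>i. i < N \<Longrightarrow> represents m (f i) (w i)" "\<And>i. i < N \<Longrightarrow> calderon_norm (f i) < M"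
    by metis
  have fc: "f i \<in> calderon" if "i < N" for i using representsD(1)[OF f(1)[OF that]] .
  have "\<exists>H. (\<forall>k. strip_fun (H k)) \<and> (\<forall>k. H k (1/2) = cnj (w i 0 k) / of_real ((s i)\<^sup>2)) \<and>
      (\<forall>t. (\<Sum>k\<in>A i. cmod (H k (line0 t))) \<le> 1 / d) \<and>
      (\<forall>k t. cmod (H k (line1 t)) \<le> 1 / d)" if i: "i < N" for i
  proof -
    obtain Y where Y: "\<And>k. strip_fun (Y k)" "\<And>k. Y k (1/2) = cnj (w i 0 k)"
      "\<And>t. (\<Sum>k\<in>A i. cmod (Y k (line0 t))) \<le> s i"
      "\<And>k t. cmod (Y k (line1 t)) \<le> s i"
      by (rule extremal_l2_dual[OF fin[OF i] spos[OF i] l2[OF i]]) (rule that)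
    \<comment> \<open>Normalises the pairing with \<open>w i\<close> to 1 at 1/2. The extremal bound
      \<open>s i\<close> becomes \<open>1 / s i\<close>, which is at most
      \<open>1 / d\<close>.\<close>
    define c where "c = 1 / (s i)\<^sup>2"
    have c: "c \<ge> 0" "c * s i \<le> 1 / d"
      using spos[OF i] d(1) d(2)[OF i] by (auto simp: c_def power2_eq_square field_simps)
    show ?thesis
    proof (intro exI[of _ "\<lambda>k z. of_real c * Y k z"] conjI allI)
      show "strip_fun (\<lambda>z. of_real c * Y k z)" for k by (intro strip_fun_mult strip_fun_const Y)
      show "of_real c * Y k (1/2) = cnj (w i 0 k) / of_real ((s i)\<^sup>2)" for k by (simp add: Y(2) c_def)
      show "(\<Sum>k\<in>A i. cmod (of_real c * Y k (line0 t))) \<le> 1 / d" for t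
      proof -
        have "(\<Sum>k\<in>A i. cmod (of_real c * Y k (line0 t))) = c * (\<Sum>k\<in>A i. cmod (Y k (line0 t)))"
          using c by (simp add: norm_mult sum_distrib_left)
        also have "\<dots> \<le> c * s i" using c Y(3) by (intro mult_left_mono) auto
        finally show ?thesis using c by simp
      qed
      show "cmod (of_real c * Y k (line1 t)) \<le> 1 / d" for k t
      proof -
        have "cmod (of_real c * Y k (line1 t)) \<le> c * s i"
          unfolding norm_mult using c Y(4)[of k t] by (intro mult_mono) auto
        then show ?thesis using c by simp
      qed
    qed
  qed
  then obtain H where H: "\<And>i k. i < N \<Longrightarrow> strip_fun (H i k)"
      "\<And>i k. i < N \<Longrightarrow> H i k (1/2) = cnj (w i 0 k) / of_real ((s i)\<^sup>2)"
      "\<And>i t. i < N \<Longrightarrow> (\<Sum>k\<in>A i. cmod (H i k (line0 t))) \<le> 1 / d"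
      "\<And>i k t. i < N \<Longrightarrow> cmod (H i k (line1 t)) \<le> 1 / d" by metis
  \<comment> \<open>The two factors are estimated in dual norms on each line: \<open>F\<close> in
    the supremum norm and \<open>H\<close> in the \<open>l1\<close> norm on the left, the other way
    round on the right.\<close>
  define pair where "pair F i z = (\<Sum>k\<in>A i. F z k * H i k z)" for F i z
  have pair_sf: "strip_fun (pair F i)" if "F \<in> calderon" "i < N" for F i
    unfolding pair_def by (intro strip_fun_sum strip_fun_mult calderon_coord_strip_fun H that)
  have pair0: "cmod (pair F i (line0 t)) \<le> calderon_norm F * (1 / d)"
    if F: "F \<in> calderon" and i: "i < N" for F i t
  proof -
    have "cmod (pair F i (line0 t)) \<le> (\<Sum>k\<in>A i. calderon_norm F * cmod (H i k (line0 t)))"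
      unfolding pair_def by (rule sum_norm_le) (auto simp: norm_mult intro!: mult_right_mono calderon_line0 F)
    also have "\<dots> \<le> calderon_norm F * (1 / d)"
      unfolding sum_distrib_left[symmetric] by (intro mult_left_mono H i calderon_norm_nonneg F)
    finally show ?thesis .
  qed
  have pair1: "cmod (pair F i (line1 t)) \<le> (\<Sum>k\<in>A i. cmod (F (line1 t) k)) * (1 / d)"
    if i: "i < N" for F i t
    unfolding pair_def sum_distrib_right
    by (rule sum_norm_le) (simp only: norm_mult, intro mult_left_mono H(4) i norm_ge_zero)
  define h where "h i = pair (f i) i" for i
  have h_sf: "strip_fun (h i)" if "i < N" for i unfolding h_def by (intro pair_sf fc that)
  have h_half: "h i (1/2) = 1" if i: "i < N" for i
  proof -
    have "f i (1/2) k = w i 0 k" for k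
      using representsD(2)[OF f(1)[OF i], of 0 k] m by (simp add: taylor_coeff_germ germ_nth_0)
    then have "h i (1/2) = (\<Sum>k\<in>A i. of_real ((cmod (w i 0 k))\<^sup>2)) / of_real ((s i)\<^sup>2)"
      unfolding h_def pair_def H(2)[OF i] sum_divide_distrib
      by (intro sum.cong refl) (simp add: complex_norm_square flip: of_real_power)
    then show ?thesis using spos[OF i] unfolding of_real_sum[symmetric] l2[OF i] by simp
  qed
  have h_bound: "cmod (1 - h i z) \<le> 1 + M / d"
    if i: "i < N" and z: "z = line0 t \<or> z = line1 t" for i z t
  proof -
    have "cmod (h i z) \<le> calderon_norm (f i) * (1 / d)"
    proof (cases "z = line0 t")
      case True
      then show ?thesis unfolding h_def using pair0[OF fc[OF i] i, of t] by simp
    next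
      case False
      then have z1: "z = line1 t" using z by simp
      have "cmod (h i z) \<le> (\<Sum>k\<in>A i. cmod (f i (line1 t) k)) * (1 / d)"
        unfolding h_def z1 by (rule pair1[OF i])
      also have "\<dots> \<le> calderon_norm (f i) * (1 / d)"
        using d by (intro mult_right_mono calderon_line1 fc i fin) auto
      finally show ?thesis .
    qed
    also have "\<dots> \<le> M / d" using f(2)[OF i] d by (simp add: divide_right_mono)
    finally have hb: "cmod (h i z) \<le> M / d" .
    show ?thesis using norm_triangle_ineq4[of 1 "h i z"] hb by simp
  qed
  define q where "q i z = (\<Sum>r<m. (1 - h i z) ^ r)" for i z
  have q_sf: "strip_fun (q i)" if "i < N" for i
    unfolding q_def by (intro strip_fun_sum strip_fun_power strip_fun_diff strip_fun_const h_sf that)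
  have q_bound: "cmod (q i z) \<le> K"
    if "i < N" "z = line0 t \<or> z = line1 t" for i z t
    unfolding q_def K_def
    by (rule sum_norm_le) (auto simp: norm_power intro!: power_mono h_bound[OF that])
  have hq: "fps_nth (germ (h i) * germ (q i)) j = (if j = 0 then 1 else 0)" if i: "i < N" and j: "j < m" for i j
  proof -
    have g: "germ (q i) = (\<Sum>r<m. (1 - germ (h i)) ^ r)"
      unfolding q_def using h_sf[OF i]
      by (subst germ_sum) (auto simp: germ_power germ_diff strip_fun_diff strip_fun_power)
    have "1 - (1 - germ (h i)) ^ m = germ (h i) * germ (q i)"
      using one_diff_power_eq[of "1 - germ (h i)" m] unfolding g by (simp only: diff_diff_eq2 add_diff_cancel_left')
    moreover have "fps_nth ((1 - germ (h i)) ^ m) j = 0"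
      using startsby_zero_power_prefix[of "1 - germ (h i)" m] j by (simp add: germ_nth_0 h_half[OF i])
    ultimately show ?thesis by (metis diff_zero fps_one_nth fps_sub_nth)
  qed
  have repx: "representable m (lincomb N a w)"
    by (intro representable_sum representable_scal rep) auto
  have wz: "(lincomb N a w) j k = a i * w i j k" if i: "i < N" and k: "k \<in> A i" for i j k
  proof -
    have "w i' j k = 0" if "i' < N" "i' \<noteq> i" for i'
      using disj[of i i'] supp[OF that(1)] that i k by (auto simp: supported_in_def)
    then show ?thesis unfolding sum_array_apply
      using i by (subst sum.remove[of _ i]) (auto intro!: sum.neutral)
  qed
  have main: "rnorm m (base_array N a) \<le> 1 / d * K * calderon_norm F"
    if F: "represents m F (lincomb N a w)" for F
  proof -
    note Fc = representsD(1)[OF F]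
    \<comment> \<open>On block \<open>i\<close> a representative \<open>F\<close> of the block sum
      has the same relevant coefficients as \<open>a i\<close> times \<open>f i\<close>, so its
      pairing has the germ of \<open>a i * h i\<close> up to order \<open>m\<close>; multiplying by
      \<open>q i\<close> leaves \<open>a i\<close> in position 0 and zeros above.\<close>
    define G where "G z i = (if i < N then pair F i z * q i z else 0)" for z i
    have sG: "strip_fun (\<lambda>z. G z i)" for i
      unfolding G_def by (cases "i < N") (auto intro!: strip_fun_mult pair_sf Fc q_sf)
    have z: "G z i = 0" if "i \<notin> {..<N}" for z i using that by (simp add: G_def)
    have Gc: "G \<in> calderon" using calderon_finite[OF sG finite_lessThan z] .
    have "represents m G (base_array N a)"
    proof (rule representsI[OF Gc])
      fix j i assume j: "j < m"
      show "base_array N a j i = taylor_coeff G j i"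
      proof (cases "i < N")
        case i: True
        have pf: "fps_nth (germ (pair F i)) r = a i * fps_nth (germ (h i)) r" if r: "r \<le> j" for r
        proof -
          have pg: "fps_nth (germ (pair F' i)) r = (\<Sum>k\<in>A i. \<Sum>u=0..r. taylor_coeff F' u k * fps_nth (germ (H i k)) (r - u))"
            if "F' \<in> calderon" for F'
            unfolding pair_def taylor_coeff_germ
            using that by (subst germ_sum)
             (auto simp: fps_sum_nth germ_mult H(1)[OF i] calderon_coord_strip_fun fps_mult_nth
               intro: strip_fun_mult[OF calderon_coord_strip_fun H(1)[OF i]])
          have "taylor_coeff F u k = a i * taylor_coeff (f i) u k" if "k \<in> A i" "u \<le> r" for u k
            using representsD(2)[OF F, of u k] representsD(2)[OF f(1)[OF i], of u k] wz[OF i that(1)] that r j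
            by simp
          then show ?thesis
            unfolding h_def pg[OF Fc] pg[OF fc[OF i]] sum_distrib_left
            by (intro sum.cong refl) (simp add: mult.assoc)
        qed
        have "taylor_coeff G j i = fps_nth (germ (pair F i) * germ (q i)) j"
          unfolding taylor_coeff_germ G_def using i by (simp add: germ_mult[OF pair_sf[OF Fc i] q_sf[OF i]])
        also have "\<dots> = a i * fps_nth (germ (h i) * germ (q i)) j"
          unfolding fps_mult_nth sum_distrib_left by (intro sum.cong refl) (simp add: pf)
        also have "\<dots> = base_array N a j i" using i by (simp add: hq[OF i j] base_array_def)
        finally show ?thesis ..
      next
        case False
        then show ?thesis by (simp add: base_array_def G_def taylor_coeff_germ)
      qed
    qed
    then have "rnorm m (base_array N a) \<le> calderon_norm G" by (rule rnorm_le)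
    also have "\<dots> \<le> calderon_norm F * (1 / d) * K"
    proof (rule calderon_norm_le_finite[OF finite_lessThan z])
      fix t i assume "i \<in> {..<N}"
      then have i: "i < N" by simp
      have "cmod (pair F i (line0 t) * q i (line0 t)) \<le> calderon_norm F * (1 / d) * K"
        unfolding norm_mult using calderon_norm_nonneg[OF Fc] d(1)
        by (intro mult_mono pair0[OF Fc i] q_bound[OF i, where t = t] disjI1 refl) auto
      then show "cmod (G (line0 t) i) \<le> calderon_norm F * (1 / d) * K"
        using i by (simp add: G_def)
    next
      fix t
      have "(\<Sum>i<N. cmod (G (line1 t) i))
          \<le> (\<Sum>i<N. (\<Sum>k\<in>A i. cmod (F (line1 t) k)) * (1 / d) * K)"
      proof (rule sum_mono)
        fix i assume "i \<in> {..<N}"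
        then have i: "i < N" by simp
        have "cmod (pair F i (line1 t) * q i (line1 t))
          \<le> (\<Sum>k\<in>A i. cmod (F (line1 t) k)) * (1 / d) * K"
          unfolding norm_mult using d(1)
          by (intro mult_mono pair1[OF i] q_bound[OF i, where t = t] disjI2 refl mult_nonneg_nonneg sum_nonneg) auto
        then show "cmod (G (line1 t) i)
          \<le> (\<Sum>k\<in>A i. cmod (F (line1 t) k)) * (1 / d) * K"
          using i by (simp add: G_def)
      qed
      \<comment> \<open>Disjointness merges the \<open>l1\<close> norms over the blocks into a
        single \<open>l1\<close> norm of \<open>F\<close>.\<close>
      also have "\<dots> = (\<Sum>k\<in>(\<Union>i<N. A i). cmod (F (line1 t) k)) * (1 / d) * K"
        unfolding sum_distrib_right[symmetric] using fin disj
        by (subst sum.UNION_disjoint) auto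
      also have "\<dots> \<le> calderon_norm F * (1 / d) * K"
        using d(1) K0 fin by (intro mult_right_mono calderon_line1 Fc) auto
      finally show "(\<Sum>i<N. cmod (G (line1 t) i)) \<le> calderon_norm F * (1 / d) * K" .
    qed
    finally show ?thesis by (simp add: mult_ac)
  qed
  have K1: "K > 0"
  proof -
    have "(1 + M / d) ^ 0 \<le> K" unfolding K_def using m M d by (intro member_le_sum) auto
    then show ?thesis by simp
  qed
  have dK: "1 / d * K > 0" using d K1 by simp
  have "rnorm m (base_array N a) / (1 / d * K) \<le> rnorm m (lincomb N a w)"
  proof (rule rnorm_leI[OF repx])
    fix F assume "represents m F (lincomb N a w)"
    then show "rnorm m (base_array N a) / (1 / d * K) \<le> calderon_norm F"
      using main[of F] pos_divide_le_eq[OF dK] by (simp only: mult.commute)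
  qed
  then show ?thesis unfolding K_def[symmetric] pos_divide_le_eq[OF dK] by (simp only: mult.commute)
qed

text \<open>Shifting down by \<open>l\<close> positions reduces this to
  \<open>rnorm_blocks_lower_0\<close>: the bound \<open>M\<close> grows to \<open>2 ^ l * M\<close>,
  and \<open>d / C\<close> bounds the \<open>l2\<close> norms of the leading entries from below by
  \<open>rnorm_Suc_le_l2\<close>. The constant must be fixed before the blocks are known, since
  later perturbations are chosen in terms of it; hence the quantifiers inside
  \<open>obtains\<close>.\<close>

lemma rnorm_blocks_lower:
  assumes l: "l < n" and M: "0 < M" and d: "0 < d"
  obtains c where "0 < c"
    "\<forall>A w N a. block_system n l A w \<and> (\<forall>i. rnorm n (w i) < M \<and> d \<le> rnorm (Suc l) (w i)) \<longrightarrow>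
       c * rnorm (n - l) (base_array N a) \<le> rnorm n (lincomb N a w)"
proof -
  obtain C where C: "C > 0"
    "\<And>A x s. finite A \<Longrightarrow> supported_in A x \<Longrightarrow> vanishes_below l x \<Longrightarrow> s > 0 \<Longrightarrow>
       (\<Sum>k\<in>A. (cmod (x l k))\<^sup>2) = s\<^sup>2 \<Longrightarrow> rnorm (Suc l) x \<le> C * s"
    by (rule rnorm_Suc_le_l2[of l]) (rule that)
  define e where "e = d / C"
  define M' where "M' = 2 ^ l * M"
  define B where "B = 1 / e * (\<Sum>r<n-l. (1 + M' / e) ^ r)"
  have e: "e > 0" and M': "M' > 0" using C(1) d M by (auto simp: e_def M'_def)
  have "0 < (\<Sum>r<n-l. (1 + M' / e) ^ r)"
    using l e M' by (intro sum_pos zero_less_power) (auto intro: add_pos_pos simp: lessThan_empty_iff)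
  then have B: "B > 0" using e by (simp add: B_def)
  define c where "c = 1 / (B * 2 ^ l)"
  have c: "c > 0" using B by (simp add: c_def)
  show ?thesis
  proof (rule that[OF c], intro allI impI, elim conjE)
    fix A :: "nat \<Rightarrow> nat set" and w :: "nat \<Rightarrow> array" and N :: nat and a :: "nat \<Rightarrow> complex"
    assume bs: "block_system n l A w" and wb: "\<forall>i. rnorm n (w i) < M \<and> d \<le> rnorm (Suc l) (w i)"
    note disj = block_systemD(1)[OF bs] and fin = block_systemD(2)[OF bs]
      and supp = block_systemD(3)[OF bs] and rep = block_systemD(5)[OF bs] and van = block_systemD(6)[OF bs]
    have nrm: "rnorm n (w i) < M" and low: "d \<le> rnorm (Suc l) (w i)" for i using wb by auto
    define s where "s i = sqrt (\<Sum>k\<in>A i. (cmod (w i l k))\<^sup>2)" for i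
    have s2: "(\<Sum>k\<in>A i. (cmod (w i l k))\<^sup>2) = (s i)\<^sup>2" for i
      by (simp add: s_def sum_nonneg)
    have es: "e \<le> s i" if i: "i < N" for i
    proof -
      have "s i > 0"
      proof (rule ccontr)
        assume "\<not> s i > 0"
        then have "s i = 0" unfolding s_def by (simp add: sum_nonneg order_antisym)
        then have "(\<Sum>k\<in>A i. (cmod (w i l k))\<^sup>2) = 0" using s2[of i] by simp
        then have "\<forall>k\<in>A i. w i l k = 0" using fin[of i] by (subst (asm) sum_nonneg_eq_0_iff) auto
        then have "w i j k = 0" if "j < Suc l" for j k
          using that van[of i] supp[of i] by (cases "j = l"; cases "k \<in> A i") (auto simp: vanishes_below_def supported_in_def)
        then have "rnorm (Suc l) (w i) = rnorm (Suc l) 0" by (intro rnorm_cong) (auto simp: fun_eq_iff)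
        then show False using low[of i] d by (simp add: rnorm_zero)
      qed
      then have "d \<le> C * s i" using C(2)[OF fin supp van _ s2[of i]] low[of i] by linarith
      then show ?thesis using C(1) by (simp add: e_def field_simps)
    qed
    define v where "v i = (\<lambda>r. w i (r + l))" for i
    have shv: "representable (n - l) (v i)" "rnorm (n - l) (v i) \<le> 2 ^ l * rnorm n (w i)" if i: "i < N" for i
      using rnorm_shift[OF rep[of i] fin[of i] supp[of i] van[of i]] l unfolding v_def by auto
    define U where "U = (\<Union>i<N. A i)"
    have U: "finite U" unfolding U_def using fin by auto
    define x where "x = (lincomb N a w)"
    have xr: "representable n x" unfolding x_def by (intro representable_sum representable_scal rep)
    have xs: "supported_in U x"
      unfolding supported_in_def
    proof (intro allI impI)
      fix j k assume k: "k \<notin> U"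
      have "w i j k = 0" if "i < N" for i using supp k that by (auto simp: U_def supported_in_def)
      then show "x j k = 0" by (simp add: x_def sum_array_apply)
    qed
    have xv: "vanishes_below l x"
      unfolding vanishes_below_def
    proof (intro allI impI)
      fix j k assume "j < l"
      then have "w i j k = 0" if "i < N" for i using van by (auto simp: vanishes_below_def)
      then show "x j k = 0" by (simp add: x_def sum_array_apply)
    qed
    have eqx: "(\<lambda>r. x (r + l)) = (lincomb N a v)"
      by (intro ext) (simp add: x_def v_def sum_array_apply)
    have "rnorm (n - l) (base_array N a)
       \<le> B * rnorm (n - l) (lincomb N a v)"
      unfolding B_def
    proof (rule rnorm_blocks_lower_0[where A = A and s = s, OF disj fin _ _ _ M' _ e es])
      show "supported_in (A i) (v i)" if "i < N" for i
        using supp by (simp add: supported_in_def v_def)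
      show "rnorm (n - l) (v i) < M'" if "i < N" for i
      proof -
        have "2 ^ l * rnorm n (w i) < M'" unfolding M'_def using nrm by simp
        then show ?thesis using shv(2)[OF that] by linarith
      qed
      show "(\<Sum>k\<in>A i. (cmod (v i 0 k))\<^sup>2) = (s i)\<^sup>2" for i using s2[of i] by (simp add: v_def)
    qed (use l shv in auto)
    also have "\<dots> \<le> B * (2 ^ l * rnorm n x)"
      using rnorm_shift[OF xr U xs xv] l B unfolding eqx by (intro mult_left_mono) auto
    finally show "c * rnorm (n - l) (base_array N a) \<le> rnorm n (lincomb N a w)"
      using B unfolding c_def x_def[symmetric] by (simp add: field_simps)
  qed
qed

text \<open>Apply the three lines theorem to the sum of the first \<open>N\<close> coordinates times
  \<open>N\<close> to the power \<open>z - 1\<close>. That factor has modulus \<open>1 / N\<close>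
  on the left, where the sum is at most \<open>N\<close> times the norm, and 1 on the right, where
  the \<open>l1\<close> bound applies; at 1/2 the product is \<open>sqrt N\<close>.\<close>

lemma sqrt_le_rnorm_base_array:
  assumes m: "m > 0"
  shows "sqrt (real N) \<le> rnorm m (base_array N (\<lambda>i. 1))"
proof (cases "N = 0")
  case True
  then show ?thesis using rnorm_nonneg[OF base_array_representable] by simp
next
  case N: False
  show ?thesis
  proof (rule rnorm_leI[OF base_array_representable])
    fix f assume f: "represents m f (base_array N (\<lambda>i. 1))"
    note fc = representsD(1)[OF f]
    define L where "L = ln (real N)"
    have eL: "exp L = real N" using N by (simp add: L_def)
    define h where "h z = (\<Sum>i<N. f z i) * (exp (of_real L * z) * of_real (exp (- L)))" for z
    have h: "strip_fun h"
      unfolding h_def by (intro strip_fun_mult strip_fun_sum calderon_coord_strip_fun fc strip_fun_exp strip_fun_const)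
    have "cmod (h (1/2)) \<le> calderon_norm f"
    proof (rule three_lines[OF h])
      fix t
      have "cmod (h (line0 t)) = cmod (\<Sum>i<N. f (line0 t) i) * exp (- L)"
        by (simp add: h_def norm_mult)
      also have "\<dots> \<le> (real N * calderon_norm f) * exp (- L)"
        using sum_norm_bound[of "{..<N}" "\<lambda>i. f (line0 t) i" "calderon_norm f"] calderon_line0[OF fc]
        by (intro mult_right_mono) auto
      also have "\<dots> = calderon_norm f" using N by (simp add: exp_minus eL)
      finally show "cmod (h (line0 t)) \<le> calderon_norm f" .
      have "cmod (h (line1 t)) = cmod (\<Sum>i<N. f (line1 t) i)"
        by (simp add: h_def norm_mult flip: exp_add)
      also have "\<dots> \<le> calderon_norm f" by (rule order_trans[OF norm_sum calderon_line1[OF fc finite_lessThan]])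
      finally show "cmod (h (line1 t)) \<le> calderon_norm f" .
    qed (use half_in_strip strip_subset_cstrip in blast)
    moreover have "h (1/2) = of_real (sqrt (real N))"
    proof -
      have "f (1/2) i = 1" if "i < N" for i
        using representsD(2)[OF f m, of i] that by (simp add: taylor_coeff_germ germ_nth_0 base_array_def)
      then have s: "(\<Sum>i<N. f (1/2) i) = of_real (real N)" by simp
      have x: "exp (L / 2) = sqrt (real N)"
        using N by (simp add: L_def flip: ln_sqrt)
      have "exp (of_real L * (1/2)) = (of_real (exp (L/2)) :: complex)"
        by (simp flip: exp_of_real)
      then have "h (1/2) = of_real (real N * (sqrt (real N) * exp (- L)))"
        unfolding h_def s x by simp
      also have "real N * (sqrt (real N) * exp (- L)) = sqrt (real N)"
        using N by (simp add: exp_minus eL)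
      finally show ?thesis .
    qed
    ultimately show "sqrt (real N) \<le> calderon_norm f" by simp
  qed
qed

text \<open>A scalar function \<open>q\<close> whose germ is 1 below order \<open>m\<close>, and
  which is at most \<open>e\<close> on the right line at the price of a large bound \<open>K\<close>
  on the left, represents the model sum when multiplied by the coefficients. The \<open>l1\<close>
  side then costs \<open>e\<close> per coordinate and the supremum side only
  \<open>K\<close>.\<close>

lemma rnorm_base_array_sublinear:
  fixes e :: real
  assumes e: "e > 0"
  obtains K where "\<forall>N a. (\<forall>i<N. cmod (a i) \<le> 1) \<longrightarrow> rnorm m (base_array N a) \<le> K + e * real N"
proof -
  \<comment> \<open>On the right line \<open>th\<close> has modulus \<open>r \<le> 1\<close>, so
    each power of \<open>1 - th\<close> is at most a power of 2 and \<open>q\<close> is at most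
    \<open>r * S\<close>. The summand 1 keeps \<open>S\<close> positive also for
    \<open>m = 0\<close>.\<close>
  define S where "S = 1 + (\<Sum>r<m. (2::real) ^ r)"
  have S: "S > 0" unfolding S_def by (intro add_pos_nonneg sum_nonneg) auto
  define r where "r = min 1 (e / S)"
  have r: "0 < r" "r \<le> 1" "r * S \<le> e"
  proof -
    show "0 < r" "r \<le> 1" using e S by (auto simp: r_def)
    have "r \<le> e / S" by (simp add: r_def)
    then show "r * S \<le> e" using S by (simp add: pos_le_divide_eq)
  qed
  \<comment> \<open>Then \<open>th\<close> is \<open>r\<close> to the power
    \<open>2 * z - 1\<close>: equal to 1 at 1/2, of modulus \<open>r\<close> on the right and
    \<open>1 / r\<close> on the left.\<close>
  define L where "L = 2 * ln r"
  define th where "th z = exp (of_real L * z) * of_real (1 / r)" for z :: complex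
  have th: "strip_fun th" unfolding th_def by (intro strip_fun_mult strip_fun_exp strip_fun_const)
  have eL: "exp L = r\<^sup>2" using r by (simp add: L_def exp_double)
  have th1: "cmod (th (line1 t)) = r" for t
    using r by (simp add: th_def norm_mult eL power2_eq_square norm_divide)
  have th_half: "th (1/2) = 1"
  proof -
    have "exp (of_real L * (1/2)) = (of_real (exp (ln r)) :: complex)"
      by (simp add: L_def exp_of_real)
    then show ?thesis using r by (simp add: th_def)
  qed
  define q where "q z = th z * (\<Sum>s<m. (1 - th z) ^ s)" for z
  have q: "strip_fun q"
    unfolding q_def by (intro strip_fun_mult strip_fun_sum strip_fun_power strip_fun_diff strip_fun_const th)
  have gq: "fps_nth (germ q) j = (if j = 0 then 1 else 0)" if j: "j < m" for j
  proof -
    have "q z = 1 - (1 - th z) ^ m" for z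
      using one_diff_power_eq[of "1 - th z" m] unfolding q_def by (simp only: diff_diff_eq2 add_diff_cancel_left')
    then have "germ q = germ (\<lambda>z. 1 - (1 - th z) ^ m)" by presburger
    also have "\<dots> = 1 - (1 - germ th) ^ m"
      using th by (subst germ_diff) (auto simp: germ_power germ_diff strip_fun_diff strip_fun_power)
    finally have "germ q = 1 - (1 - germ th) ^ m" .
    moreover have "fps_nth ((1 - germ th) ^ m) j = 0"
      using startsby_zero_power_prefix[of "1 - germ th" m] j by (simp add: germ_nth_0 th_half)
    ultimately show ?thesis by simp
  qed
  obtain K where K: "K > 0" "\<And>z. z \<in> cstrip \<Longrightarrow> cmod (q z) \<le> K"
    by (rule strip_fun_boundedE[OF q]) (rule that)
  have q1: "cmod (q (line1 t)) \<le> e" for t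
  proof -
    have "cmod (1 - th (line1 t)) \<le> 2"
      using norm_triangle_ineq4[of 1 "th (line1 t)"] r unfolding th1 by simp
    then have "cmod (\<Sum>s<m. (1 - th (line1 t)) ^ s) \<le> (\<Sum>s<m. 2 ^ s)"
      by (intro sum_norm_le) (auto simp: norm_power intro: power_mono)
    then have "cmod (q (line1 t)) \<le> r * S"
      unfolding q_def norm_mult th1 S_def using r by (intro mult_left_mono) auto
    then show ?thesis using r by simp
  qed
  show ?thesis
  proof (rule that[of K], intro allI impI)
    fix N :: nat and a :: "nat \<Rightarrow> complex" assume a': "\<forall>i<N. cmod (a i) \<le> 1"
    have a: "cmod (a i) \<le> 1" if "i < N" for i using a' that by blast
    define f where "f z k = (if k < N then a k * q z else 0)" for z k
    have sf: "strip_fun (\<lambda>z. f z k)" for k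
      unfolding f_def by (cases "k < N") (auto intro!: strip_fun_mult q)
    have z: "f z k = 0" if "k \<notin> {..<N}" for z k using that by (simp add: f_def)
    have fc: "f \<in> calderon" using calderon_finite[OF sf finite_lessThan z] .
    have "represents m f (base_array N a)"
    proof (rule representsI[OF fc])
      fix j k assume j: "j < m"
      show "base_array N a j k = taylor_coeff f j k"
        unfolding base_array_def f_def taylor_coeff_germ
        using gq[OF j] q by (cases "k < N"; cases "j = 0") (simp_all add: germ_mult)
    qed
    then have "rnorm m (base_array N a) \<le> calderon_norm f" by (rule rnorm_le)
    also have "\<dots> \<le> K + e * real N"
    proof (rule calderon_norm_le_finite[OF finite_lessThan z])
      fix t k assume "k \<in> {..<N}"
      then have "cmod (f (line0 t) k) \<le> 1 * K"
        using mult_mono[OF a[of k] K(2)[OF line0_in_cstrip[of t]]] by (simp add: f_def norm_mult)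
      also have "\<dots> \<le> K + e * real N" using e by simp
      finally show "cmod (f (line0 t) k) \<le> K + e * real N" .
    next
      fix t
      have "(\<Sum>k<N. cmod (f (line1 t) k)) \<le> (\<Sum>k<N. 1 * e)"
      proof (rule sum_mono)
        fix k assume "k \<in> {..<N}"
        then show "cmod (f (line1 t) k) \<le> 1 * e"
          using mult_mono[OF a[of k] q1[of t]] by (simp add: f_def norm_mult)
      qed
      then show "(\<Sum>k<N. cmod (f (line1 t) k)) \<le> K + e * real N" using K by (simp add: mult.commute)
    qed
    finally show "rnorm m (base_array N a) \<le> K + e * real N" .
  qed
qed

section \<open>Completeness and coordinate projections\<close>

lemma represents_sum:
  fixes N :: nat
  assumes "\<And>i. i < N \<Longrightarrow> represents m (f i) (x i)"
  shows "represents m (\<lambda>z k. \<Sum>i<N. f i z k) (\<Sum>i<N. x i)"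
  using assms
proof (induction N)
  case 0
  have "(\<lambda>z k. 0) \<in> calderon" by (rule calderon_finite[where A = "{}"]) auto
  then show ?case by (intro representsI) (auto simp: taylor_coeff_germ)
next
  case (Suc N)
  have "represents m (\<lambda>z k. (\<Sum>i<N. f i z k) + f N z k) ((\<Sum>i<N. x i) + x N)"
    by (intro represents_add Suc) auto
  then show ?case by (simp only: sum.lessThan_Suc)
qed

lemma geometric_tail: "(\<lambda>i. (1/2::real) ^ (i + m)) sums (2 * (1/2) ^ m)"
  using sums_mult2[OF power_half_series, of "2 * (1/2) ^ m"] by (simp add: power_add mult_ac)

text \<open>Near-optimal representatives are summed in the Calderon space itself, and the Taylor
  array of the limit is the sum. The bound is the geometric tail.\<close>

lemma rochberg_series:
  assumes x: "\<And>i. x i \<in> rochberg n" and nrm: "\<And>i. rnorm n (x i) < (1/2) ^ i"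
  obtains y where "y \<in> rochberg n" "\<And>m. rnorm n ((\<Sum>i<m. x i) - y) \<le> 2 * (1/2) ^ m"
proof -
  have "\<exists>f. represents n f (x i) \<and> calderon_norm f < (1/2) ^ i" for i
    by (rule rnorm_obtain[OF rochberg_rep[OF x] nrm[of i]]) blast
  then obtain f where f: "\<And>i. represents n (f i) (x i)" "\<And>i. calderon_norm (f i) < (1/2) ^ i" by metis
  have fc: "f i \<in> calderon" for i using representsD(1)[OF f(1)] .
  have fb: "cmod (f i z k) \<le> (1/2) ^ i" if "z \<in> cstrip" for i z k
    using calderon_coord_le[OF fc that, of i k] f(2)[of i] by linarith
  define F where "F z k = (\<Sum>i. f i z k)" for z k
  define P where "P m z k = (\<Sum>i<m. f i z k)" for m z k
  have Prep: "represents n (P m) (\<Sum>i<m. x i)" for m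
    unfolding P_def by (rule represents_sum) (rule f)
  have Pc: "P m \<in> calderon" for m using representsD(1)[OF Prep] .
  have sm: "summable (\<lambda>i. cmod (f (i + m) z k))" if "z \<in> cstrip" for z k m
    by (rule summable_comparison_test'[OF sums_summable[OF geometric_tail[of m]], of 0]) (use fb[OF that] in auto)
  have tail: "F z k - P m z k = (\<Sum>i. f (i + m) z k)" if "z \<in> cstrip" for z k m
    using suminf_minus_initial_segment[OF summable_norm_cancel[OF sm[OF that, of 0 k, simplified]], of m]
    by (simp add: F_def P_def)
  have tail_sum: "(\<Sum>k<K. cmod (F z k - P m z k)) \<le> 2 * (1/2) ^ m"
    if z: "z \<in> cstrip" and b: "\<And>i. (\<Sum>k<K. cmod (f i z k)) \<le> (1/2) ^ i" for z K m
  proof -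
    have "(\<Sum>k<K. cmod (F z k - P m z k)) \<le> (\<Sum>k<K. \<Sum>i. cmod (f (i + m) z k))"
      unfolding tail[OF z] by (intro sum_mono summable_norm sm z)
    also have "\<dots> = (\<Sum>i. \<Sum>k<K. cmod (f (i + m) z k))"
      by (rule suminf_sum[symmetric]) (rule sm[OF z])
    also have "\<dots> \<le> (\<Sum>i. (1/2) ^ (i + m))"
      by (intro suminf_le b summable_sum sm z sums_summable[OF geometric_tail[of m]])
    also have "\<dots> = 2 * (1/2) ^ m" using geometric_tail[of m] by (rule sums_unique[symmetric])
    finally show ?thesis .
  qed
  have tail_coord: "cmod (F z k - P m z k) \<le> 2 * (1/2) ^ m" if z: "z \<in> cstrip" for z k m
  proof -
    have "cmod (F z k - P m z k) \<le> (\<Sum>i. cmod (f (i + m) z k))"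
      unfolding tail[OF z] by (intro summable_norm sm z)
    also have "\<dots> \<le> (\<Sum>i. (1/2) ^ (i + m))"
      by (intro suminf_le fb sm z sums_summable[OF geometric_tail[of m]])
    also have "\<dots> = 2 * (1/2) ^ m" using geometric_tail[of m] by (rule sums_unique[symmetric])
    finally show ?thesis .
  qed
  have l1: "(\<Sum>k<K. cmod (F (line1 t) k - P m (line1 t) k)) \<le> 2 * (1/2) ^ m" for K t m
    using order_trans[OF calderon_line1[OF fc finite_lessThan] less_imp_le[OF f(2)]]
    by (intro tail_sum) auto
  have P0: "P 0 z k = 0" for z k by (simp add: P_def)
  have Fc: "F \<in> calderon"
  proof (rule calderonI[where B = 2 and M = 2])
    show "cmod (F z k) \<le> 2" if "z \<in> cstrip" for z k using tail_coord[OF that, of k 0] by (simp add: P0)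
    show "(\<Sum>k<K. cmod (F (line1 t) k)) \<le> 2" for t K using l1[where K = K and t = t and m = 0] by (simp add: P0)
    show "(\<lambda>z. F z k) holomorphic_on strip" for k
    proof (rule holomorphic_uniform_sequence[OF open_strip])
      show "(\<lambda>z. P m z k) holomorphic_on strip" for m
        by (intro strip_fun_holomorphic calderon_coord_strip_fun Pc)
      fix z assume "z \<in> strip"
      then obtain d where d: "d > 0" "cball z d \<subseteq> strip" using open_strip open_contains_cball by blast
      have "uniform_limit cstrip (\<lambda>m z. \<Sum>i<m. f i z k) (\<lambda>z. \<Sum>i. f i z k) sequentially"
        using sums_summable[OF geometric_tail[of 0]]
        by (intro Weierstrass_m_test[where M = "\<lambda>i. (1/2) ^ i"] fb) auto
      then have "uniform_limit (cball z d) (\<lambda>m z. P m z k) (\<lambda>z. F z k) sequentially"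
        unfolding P_def F_def by (rule uniform_limit_on_subset) (use d strip_subset_cstrip in blast)
      then show "\<exists>d>0. cball z d \<subseteq> strip \<and> uniform_limit (cball z d) (\<lambda>m z. P m z k) (\<lambda>z. F z k) sequentially"
        using d by blast
    qed
    fix z and e :: real assume z: "z \<in> cstrip" "e > 0"
    \<comment> \<open>Each of the two tails is at most \<open>2 * (1/2) ^ m\<close>, hence below
      \<open>e / 3\<close>.\<close>
    obtain m where m: "(1/2::real) ^ m < e / 6" using real_arch_pow_inv[of "e/6" "1/2"] z by auto
    have e3: "e / 3 > 0" using z by simp
    obtain d where d: "d > 0" "\<And>w k. w \<in> cstrip \<Longrightarrow> cmod (w - z) < d \<Longrightarrow> cmod (P m w k - P m z k) \<le> e / 3"
      by (rule calderon_equicontinuous[OF Pc z(1) e3]) (rule that)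
    have "cmod (F w k - F z k) \<le> e" if w: "w \<in> cstrip" "cmod (w - z) < d" for w k
    proof -
      have "F w k - F z k = (F w k - P m w k) + (P m w k - P m z k) - (F z k - P m z k)" by simp
      then have "cmod (F w k - F z k) \<le> cmod (F w k - P m w k) + cmod (P m w k - P m z k) + cmod (F z k - P m z k)"
        by (metis norm_triangle_ineq norm_triangle_ineq4 add_right_mono order_trans)
      then show ?thesis using tail_coord[OF w(1), of k m] tail_coord[OF z(1), of k m] d(2)[OF w, of k] m by linarith
    qed
    then show "\<exists>d>0. \<forall>w\<in>cstrip. cmod (w - z) < d \<longrightarrow> (\<forall>k. cmod (F w k - F z k) \<le> e)"
      using d(1) by blast
  qed
  define y where "y = taylor_array n F"
  show ?thesis
  proof (rule that)
    show "y \<in> rochberg n" unfolding y_def by (rule taylor_array_rochberg[OF Fc])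
    fix m
    have "represents n (\<lambda>z k. P m z k + (-1) * F z k) ((\<Sum>i<m. x i) + (\<lambda>j k. (-1) * y j k))"
      unfolding y_def
      by (intro represents_add Prep represents_coord_scale[where C = 1] taylor_array_represents Fc) auto
    moreover have "(\<lambda>j k. (-1) * y j k) = - y" by (auto simp: fun_eq_iff)
    ultimately have rep: "represents n (\<lambda>z k. P m z k - F z k) ((\<Sum>i<m. x i) - y)" by simp
    have "rnorm n ((\<Sum>i<m. x i) - y) \<le> calderon_norm (\<lambda>z k. P m z k - F z k)" by (rule rnorm_le[OF rep])
    also have "\<dots> \<le> 2 * (1/2) ^ m"
      by (rule calderon_norm_le)
         (use tail_coord l1 in \<open>simp_all only: norm_minus_commute[of "P _ _ _"] line0_in_cstrip\<close>)
    finally show "rnorm n ((\<Sum>i<m. x i) - y) \<le> 2 * (1/2) ^ m" .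
  qed
qed

theorem rochberg_complete:
  assumes x: "\<And>i. x i \<in> rochberg n"
    and cau: "\<And>e. e > 0 \<Longrightarrow> \<exists>N. \<forall>p\<ge>N. \<forall>q\<ge>N. rnorm n (x p - x q) < e"
  obtains y where "y \<in> rochberg n" "(\<lambda>i. rnorm n (x i - y)) \<longlonglongrightarrow> 0"
proof -
  have "\<exists>N. \<forall>p\<ge>N. \<forall>q\<ge>N. rnorm n (x p - x q) < (1/2) ^ i" for i by (rule cau) simp
  then obtain N where N: "\<And>i p q. p \<ge> N i \<Longrightarrow> q \<ge> N i \<Longrightarrow> rnorm n (x p - x q) < (1/2) ^ i" by metis
  \<comment> \<open>Summation makes \<open>r\<close> increasing, so both \<open>r i\<close> and
    \<open>r (Suc i)\<close> lie beyond \<open>N i\<close>.\<close>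
  define r where "r i = (\<Sum>l\<le>i. N l)" for i
  have r: "r i \<ge> N i" "r (Suc i) \<ge> N i" for i
  proof -
    show "r i \<ge> N i" unfolding r_def by (intro member_le_sum) auto
    then show "r (Suc i) \<ge> N i" by (simp add: r_def)
  qed
  have zr: "x (r (Suc i)) - x (r i) \<in> rochberg n" for i by (intro rochberg_diff x)
  have zn: "rnorm n (x (r (Suc i)) - x (r i)) < (1/2) ^ i" for i by (intro N r)
  obtain y where y: "y \<in> rochberg n"
    "\<And>m. rnorm n ((\<Sum>i<m. x (r (Suc i)) - x (r i)) - y) \<le> 2 * (1/2) ^ m"
    by (rule rochberg_series[OF zr zn]) (rule that)
  define L where "L = y + x (r 0)"
  have L: "L \<in> rochberg n" unfolding L_def by (intro rochberg_add y x)
  have xL: "rnorm n (x (r m) - L) \<le> 2 * (1/2) ^ m" for m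
  proof -
    have "x (r m) - L = (\<Sum>i<m. x (r (Suc i)) - x (r i)) - y"
      unfolding sum_lessThan_telescope[of "\<lambda>i. x (r i)" m] L_def by (simp add: algebra_simps)
    then show ?thesis using y(2)[of m] by (simp only:)
  qed
  have "(\<lambda>i. rnorm n (x i - L)) \<longlonglongrightarrow> 0"
    unfolding LIMSEQ_def
  proof (intro allI impI)
    fix e :: real assume "e > 0"
    then obtain m where m: "(1/2::real) ^ m < e / 3" using real_arch_pow_inv[of "e/3" "1/2"] by auto
    have "rnorm n (x i - L) < e" if i: "i \<ge> N m" for i
    proof -
      have "rnorm n ((x i - x (r m)) + (x (r m) - L)) \<le> rnorm n (x i - x (r m)) + rnorm n (x (r m) - L)"
        by (intro rnorm_triangle rochberg_rep rochberg_diff x L)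
      moreover have "(x i - x (r m)) + (x (r m) - L) = x i - L" by (simp add: algebra_simps)
      ultimately have "rnorm n (x i - L) \<le> rnorm n (x i - x (r m)) + rnorm n (x (r m) - L)" by (simp only:)
      then show ?thesis using N[OF i r(1)] xL[of m] m by linarith
    qed
    moreover have "rnorm n (x i - L) \<ge> 0" for i by (intro rnorm_nonneg rochberg_rep rochberg_diff x L)
    ultimately show "\<exists>M. \<forall>i\<ge>M. dist (rnorm n (x i - L)) 0 < e" by auto
  qed
  with L that show ?thesis by blast
qed

section \<open>Subsequences, levels and perturbation of blocks\<close>

lemma subsequence_choice:
  assumes "\<And>m N. \<exists>i\<ge>N. P m i"
  obtains r :: "nat \<Rightarrow> nat" where "strict_mono r" "\<And>m. P m (r m)"
proof -
  have "\<exists>r. \<forall>m. P m (r m) \<and> r m < r (Suc m)"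
  proof (rule dependent_nat_choice)
    show "\<exists>i. P 0 i" using assms[of 0 0] by auto
    show "\<exists>j. P (Suc m) j \<and> i < j" for i m using assms[where m = "Suc m" and N = "Suc i"] Suc_le_lessD by blast
  qed
  then show ?thesis using that by (auto simp: strict_mono_Suc_iff)
qed

text \<open>Locates the level at which a subsequence stops being null. Descend from
  \<open>k\<close>: either the norm of order \<open>Suc k\<close> stays away from zero along a tail
  and the search continues below, or it tends to zero along a subsequence and the level is found. At
  the bottom \<open>rnorm 0\<close> is zero.\<close>

lemma level_subsequence:
  assumes "\<And>i. representable n (x i)" "k < n" "d > 0" "\<And>i. d \<le> rnorm (Suc k) (x i)"
  shows "\<exists>j r d'. j \<le> k \<and> strict_mono (r :: nat \<Rightarrow> nat) \<and> d' > 0 \<and>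
    (\<lambda>i. rnorm j (x (r i))) \<longlonglongrightarrow> 0 \<and> (\<forall>i. d' \<le> rnorm (Suc j) (x (r i)))"
  using assms
proof (induction k arbitrary: x d)
  case 0
  then show ?case
    by (intro exI[of _ 0] exI[of _ id] exI[of _ d]) (auto simp: rnorm_order_0 strict_mono_def)
next
  case (Suc k)
  show ?case
  proof (cases "\<exists>e>0. \<exists>i0. \<forall>i\<ge>i0. e \<le> rnorm (Suc k) (x i)")
    case True
    then obtain e i0 where e: "e > 0" "\<And>i. i \<ge> i0 \<Longrightarrow> e \<le> rnorm (Suc k) (x i)" by auto
    have "\<exists>j r d'. j \<le> k \<and> strict_mono (r :: nat \<Rightarrow> nat) \<and> d' > 0 \<and>
      (\<lambda>i. rnorm j (x (r i + i0))) \<longlonglongrightarrow> 0 \<and> (\<forall>i. d' \<le> rnorm (Suc j) (x (r i + i0)))"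
      by (rule Suc.IH[of "\<lambda>i. x (i + i0)" e]) (use Suc.prems e in auto)
    then obtain j r d' where r: "j \<le> k" "strict_mono r" "d' > 0"
      "(\<lambda>i. rnorm j (x (r i + i0))) \<longlonglongrightarrow> 0" "\<forall>i. d' \<le> rnorm (Suc j) (x (r i + i0))"
      by (elim exE conjE) (rule that)
    show ?thesis
      by (intro exI[of _ j] exI[of _ "\<lambda>i. r i + i0"] exI[of _ d']) (use r in \<open>auto simp: strict_mono_def\<close>)
  next
    case False
    have "\<exists>i\<ge>N. rnorm (Suc k) (x i) < (1/2) ^ m" for m N
    proof -
      have "(1/2::real) ^ m > 0" by simp
      then show ?thesis using False not_less by blast
    qed
    then obtain r where r: "strict_mono r" "\<And>m. rnorm (Suc k) (x (r m)) < (1/2) ^ m"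
      by (rule subsequence_choice) (rule that)
    have "representable (Suc k) (x i)" for i
      using Suc.prems by (intro representable_mono[OF Suc.prems(1)]) auto
    then have nn: "0 \<le> rnorm (Suc k) (x i)" for i by (rule rnorm_nonneg)
    have "(\<lambda>i. rnorm (Suc k) (x (r i))) \<longlonglongrightarrow> 0"
      by (rule tendsto_sandwich[OF _ _ tendsto_const LIMSEQ_power_zero[of "1/2::real"]])
         (use nn r(2) in \<open>auto intro!: always_eventually less_imp_le\<close>)
    then show ?thesis
      by (intro exI[of _ "Suc k"] exI[of _ r] exI[of _ d]) (use r Suc.prems in auto)
  qed
qed

text \<open>A small function representing only the first \<open>l\<close> entries still defines a
  full array of order \<open>n\<close> with the same small norm; subtracting that array kills those
  entries and keeps the support.\<close>

lemma perturb_to_vanishing: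
  assumes w: "w \<in> rochberg n" "supported_in A w" and e: "rnorm l w < e" and l: "l \<le> n"
  obtains w' where "w' \<in> rochberg n" "supported_in A w'" "vanishes_below l w'" "rnorm n (w - w') < e"
proof -
  obtain f where f: "represents l f w" "calderon_norm f < e" "\<And>z k. k \<notin> A \<Longrightarrow> f z k = 0"
    by (rule rnorm_obtain_supported[OF rochberg_representable[OF w(1) l] e w(2)]) (rule that)
  note fc = representsD(1)[OF f(1)]
  define w' where "w' = w - taylor_array n f"
  show ?thesis
  proof
    show "w' \<in> rochberg n" unfolding w'_def by (intro rochberg_diff w taylor_array_rochberg fc)
    show "supported_in A w'" using w(2) f(3)
      by (auto simp: supported_in_def w'_def taylor_array_def taylor_coeff_germ)
    show "vanishes_below l w'"
      using representsD(2)[OF f(1)] l by (auto simp: vanishes_below_def w'_def taylor_array_def)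
    have "w - w' = taylor_array n f" by (simp add: w'_def)
    then show "rnorm n (w - w') < e"
      using rnorm_le[OF taylor_array_represents[OF fc, of n]] f(2) by (simp only:)
  qed
qed

text \<open>Every coefficient is at most the norm of the whole model sum, so errors of geometric
  size add up to a multiple of that norm; 2 is the sum of the geometric series.\<close>

lemma rnorm_perturbation_sum:
  assumes m: "m > 0" and rep: "\<And>i. representable n (p i)" and b: "\<And>i. rnorm n (p i) \<le> h * (1/2) ^ i"
  shows "rnorm n (lincomb N a p) \<le> 2 * h * rnorm m (base_array N a)"
proof -
  define R where "R = rnorm m (base_array N a)"
  have R: "0 \<le> R" unfolding R_def by (rule rnorm_nonneg[OF base_array_representable])
  have h: "0 \<le> h" using order_trans[OF rnorm_nonneg[OF rep[of 0]] b[of 0]] by simp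
  have "rnorm n (lincomb N a p) \<le> (\<Sum>i<N. rnorm n (scal (a i) (p i)))"
    by (rule rnorm_sum) (intro representable_scal rep)
  also have "\<dots> \<le> (\<Sum>i<N. R * (h * (1/2) ^ i))"
  proof (rule sum_mono)
    fix i assume "i \<in> {..<N}"
    then have "cmod (a i) \<le> R" unfolding R_def using m by (intro coeff_le_rnorm_base_array) auto
    then have "cmod (a i) * rnorm n (p i) \<le> R * (h * (1/2) ^ i)"
      using b R rnorm_nonneg[OF rep] by (intro mult_mono) auto
    then show "rnorm n (scal (a i) (p i)) \<le> R * (h * (1/2) ^ i)"
      using rnorm_scal_le[OF rep[of i], of "a i"] by linarith
  qed
  also have "\<dots> = R * h * (\<Sum>i<N. (1/2) ^ i)" by (simp add: sum_distrib_left mult.assoc)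
  also have "\<dots> \<le> R * h * 2"
  proof (rule mult_left_mono)
    have "(\<lambda>i. (1/2::real) ^ i) sums 2" using geometric_tail[of 0] by simp
    then show "(\<Sum>i<N. (1/2::real) ^ i) \<le> 2"
      using sum_le_suminf[OF sums_summable, of _ _ "{..<N}"] sums_unique by fastforce
  qed (use R h in simp)
  finally show ?thesis by (simp add: R_def mult_ac)
qed

lemma scal_sum_diff:
  "lincomb N a y = (lincomb N a w) + (lincomb N a (\<lambda>i. y i - w i))"
  by (simp add: scal_right_diff sum_subtractf)

lemma rnorm_near_blocks_upper:
  assumes bs: "block_system n l A w" and y: "\<And>i. y i \<in> rochberg n"
    and nrm: "\<And>i. rnorm n (w i) < M" and M: "0 < M" and l: "l < n"
    and near: "\<And>i. rnorm n (y i - w i) \<le> h * (1/2) ^ i"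
  shows "rnorm n (lincomb N a y) \<le> (M + 2 * h) * rnorm (n - l) (base_array N a)"
proof -
  note w = block_systemD(4)[OF bs]
  have "rnorm n (lincomb N a w) \<le> M * rnorm (n - l) (base_array N a)"
    by (rule rnorm_blocks_upper[OF bs nrm M less_imp_le[OF l]])
  moreover have "rnorm n (lincomb N a (\<lambda>i. y i - w i)) \<le> 2 * h * rnorm (n - l) (base_array N a)"
    using l near by (intro rnorm_perturbation_sum rochberg_rep rochberg_diff w y) auto
  moreover have "rnorm n (lincomb N a y) \<le> rnorm n (lincomb N a w) + rnorm n (lincomb N a (\<lambda>i. y i - w i))"
    unfolding scal_sum_diff[of a y N w]
    by (intro rnorm_triangle rochberg_rep rochberg_sum rochberg_scal rochberg_diff w y)
  ultimately show ?thesis by (simp add: distrib_right)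
qed

lemma rnorm_near_blocks_lower:
  assumes l: "l < n" and M: "0 < M" and d: "0 < d"
  obtains c h where "0 < c" "0 < h"
    "\<forall>A w y N a. block_system n l A w \<and> (\<forall>i. y i \<in> rochberg n) \<and>
       (\<forall>i. rnorm n (w i) < M \<and> d \<le> rnorm (Suc l) (w i)) \<and>
       (\<forall>i. rnorm n (y i - w i) \<le> h * (1/2) ^ i) \<longrightarrow>
       c * rnorm (n - l) (base_array N a) \<le> rnorm n (lincomb N a y)"
proof -
  obtain c where c: "0 < c"
    "\<forall>A w N a. block_system n l A w \<and> (\<forall>i. rnorm n (w i) < M \<and> d \<le> rnorm (Suc l) (w i)) \<longrightarrow>
       c * rnorm (n - l) (base_array N a) \<le> rnorm n (lincomb N a w)"
    by (rule rnorm_blocks_lower[OF l M d]) (rule that)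
  show ?thesis
  \<comment> \<open>The perturbation costs \<open>2 * (c/4)\<close> times the norm of the model sum,
    which leaves \<open>c/2\<close>.\<close>
  proof (rule that[of "c/2" "c/4"], use c in simp, use c in simp, intro allI impI, elim conjE)
    fix A :: "nat \<Rightarrow> nat set" and w y :: "nat \<Rightarrow> array" and N :: nat and a :: "nat \<Rightarrow> complex"
    assume bs: "block_system n l A w" and y: "\<forall>i. y i \<in> rochberg n"
       and wb: "\<forall>i. rnorm n (w i) < M \<and> d \<le> rnorm (Suc l) (w i)"
       and near: "\<forall>i. rnorm n (y i - w i) \<le> c / 4 * (1/2) ^ i"
    note h = block_systemD(4)[OF bs] y[rule_format]
    have 1: "c * rnorm (n - l) (base_array N a) \<le> rnorm n (lincomb N a w)"
      using c(2) bs wb by blast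
    have 2: "rnorm n (lincomb N a (\<lambda>i. y i - w i)) \<le> 2 * (c/4) * rnorm (n - l) (base_array N a)"
      using l near by (intro rnorm_perturbation_sum rochberg_rep rochberg_diff h) auto
    have eq: "(lincomb N a y) - (lincomb N a (\<lambda>i. y i - w i)) = (lincomb N a w)"
      unfolding scal_sum_diff[of a y N w] by simp
    have "rnorm n ((lincomb N a y) - (lincomb N a (\<lambda>i. y i - w i)))
        \<le> rnorm n (lincomb N a y) + rnorm n (lincomb N a (\<lambda>i. y i - w i))"
      by (intro rnorm_triangle_diff rochberg_rep rochberg_sum rochberg_scal rochberg_diff h)
    then show "c / 2 * rnorm (n - l) (base_array N a) \<le> rnorm n (lincomb N a y)"
      using 1 2 unfolding eq by simp
  qed
qed

lemma coord_proj_block_sum: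
  fixes N :: nat
  assumes "\<And>i j. i \<noteq> j \<Longrightarrow> A i \<inter> A j = {}"
  shows "(\<Sum>i<N. coord_proj (A i) u) = coord_proj (\<Union>i<N. A i) u"
proof (intro ext)
  fix j k
  show "(\<Sum>i<N. coord_proj (A i) u) j k = coord_proj (\<Union>i<N. A i) u j k"
  proof (induction N)
    case (Suc N)
    have "A N \<inter> (\<Union>i<N. A i) = {}" using assms by (auto simp: set_eq_iff) (metis nat_neq_iff disjoint_iff)
    then show ?case using Suc by (auto simp: sum_array_apply coord_proj_def lessThan_Suc)
  qed (simp add: coord_proj_def)
qed

lemma mono_intervals_disjoint:
  fixes p :: "nat \<Rightarrow> nat"
  assumes "mono p" "i \<noteq> j"
  shows "{p i..<p (Suc i)} \<inter> {p j..<p (Suc j)} = {}"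
proof -
  have *: "{p i..<p (Suc i)} \<inter> {p j..<p (Suc j)} = {}" if "i < j" for i j
    using monoD[OF assms(1), of "Suc i" j] that by auto
  show ?thesis using *[of i j] *[of j i] assms(2) by (cases "i < j") auto
qed

text \<open>Blocks of \<open>u\<close> with norms bounded away from zero would have sums growing like the square root of
  their number, although all these sums are coordinate projections of \<open>u\<close>.\<close>

lemma rochberg_tail_blocks:
  assumes u: "u \<in> rochberg n" and d: "d > 0"
  shows "\<exists>N. \<forall>N'\<ge>N. rnorm n (coord_proj {N..<N'} u) < d"
proof (rule ccontr)
  assume "\<not> ?thesis"
  then have "\<forall>N. \<exists>N'\<ge>N. d \<le> rnorm n (coord_proj {N..<N'} u)" by (meson not_less)
  then obtain F where F: "\<And>N. F N \<ge> N" "\<And>N. d \<le> rnorm n (coord_proj {N..<F N} u)" by metis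
  define p where "p i = (F ^^ i) 0" for i
  have pS: "p (Suc i) = F (p i)" for i by (simp add: p_def)
  have mono: "mono p" unfolding mono_iff_le_Suc pS using F(1) by blast
  define A where "A i = {p i..<p (Suc i)}" for i
  have disj: "A i \<inter> A j = {}" if "i \<noteq> j" for i j unfolding A_def by (rule mono_intervals_disjoint[OF mono that])
  define w where "w i = coord_proj (A i) u" for i
  have w: "w i \<in> rochberg n" for i unfolding w_def by (rule rochberg_coord_proj[OF u])
  have wd: "d \<le> rnorm n (w i)" for i unfolding w_def A_def pS by (rule F)
  have n: "n > 0" using wd[of 0] d by (cases n) (auto simp: rnorm_order_0)
  define U where "U = rnorm n u"
  have U: "0 \<le> U" unfolding U_def by (rule rnorm_nonneg[OF rochberg_rep[OF u]])
  have "\<exists>j r d'. j \<le> n - 1 \<and> strict_mono (r :: nat \<Rightarrow> nat) \<and> d' > 0 \<and>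
    (\<lambda>i. rnorm j (w (r i))) \<longlonglongrightarrow> 0 \<and> (\<forall>i. d' \<le> rnorm (Suc j) (w (r i)))"
    by (rule level_subsequence[where n = n and d = d]) (use rochberg_rep[OF w] n d wd in auto)
  then obtain j r d' where r: "j \<le> n - 1" "strict_mono r" "d' > 0"
     "(\<lambda>i. rnorm j (w (r i))) \<longlonglongrightarrow> 0" "\<forall>i. d' \<le> rnorm (Suc j) (w (r i))"
    by (elim exE conjE) (rule that)
  have jn: "j < n" using r n by simp
  have M: "0 < U + d' + 1" and d2: "0 < d' / 2" using U r by auto
  obtain c h where ch: "0 < c" "0 < h"
    "\<forall>A w y N a. block_system n j A w \<and> (\<forall>i. y i \<in> rochberg n) \<and>
       (\<forall>i. rnorm n (w i) < U + d' + 1 \<and> d' / 2 \<le> rnorm (Suc j) (w i)) \<and>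
       (\<forall>i. rnorm n (y i - w i) \<le> h * (1/2) ^ i) \<longrightarrow>
       c * rnorm (n - j) (base_array N a) \<le> rnorm n (lincomb N a y)"
    by (rule rnorm_near_blocks_lower[OF jn M d2]) (rule that)
  \<comment> \<open>Perturbing by less than \<open>g\<close> must both satisfy the tolerance
    \<open>h\<close> of the lower estimate and keep the norm of order \<open>Suc j\<close> above
    \<open>d' / 2\<close>.\<close>
  define g where "g = min h (d' / 2)"
  have g: "0 < g" "g \<le> h" "g \<le> d' / 2" using ch r by (auto simp: g_def)
  have ex: "\<exists>i\<ge>N. rnorm j (w (r i)) < g * (1/2) ^ m" for m N
  proof -
    have "g * (1/2) ^ m > 0" using g by simp
    then have "\<forall>\<^sub>F i in sequentially. rnorm j (w (r i)) < g * (1/2) ^ m"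
      using r(4) by (rule order_tendstoD(2)[rotated])
    then obtain K where "\<And>i. i \<ge> K \<Longrightarrow> rnorm j (w (r i)) < g * (1/2) ^ m"
      unfolding eventually_sequentially by blast
    then show ?thesis by (intro exI[of _ "max N K"]) auto
  qed
  obtain r2 where r2: "strict_mono r2" "\<And>m. rnorm j (w (r (r2 m))) < g * (1/2) ^ m"
    using ex by (rule subsequence_choice) (rule that)
  define q where "q m = r (r2 m)" for m
  have q: "strict_mono q" unfolding q_def using r(2) r2(1) by (auto simp: strict_mono_def)
  have ws: "supported_in (A i) (w i)" for i unfolding w_def by (rule coord_proj_supported)
  have "\<exists>w'. w' \<in> rochberg n \<and> supported_in (A (q m)) w' \<and> vanishes_below j w' \<and>
     rnorm n (w (q m) - w') < g * (1/2) ^ m" for m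
    by (rule perturb_to_vanishing[OF w ws r2(2)[folded q_def] less_imp_le[OF jn]]) blast
  then obtain v where v: "\<And>m. v m \<in> rochberg n" "\<And>m. supported_in (A (q m)) (v m)" "\<And>m. vanishes_below j (v m)"
     "\<And>m. rnorm n (w (q m) - v m) < g * (1/2) ^ m" by metis
  have v4: "rnorm n (w (q m) - v m) < g" for m
  proof -
    have "g * (1/2) ^ m \<le> g * 1" using g by (intro mult_left_mono power_le_one) auto
    then show ?thesis using v(4)[of m] by simp
  qed
  have wU: "rnorm n (w i) \<le> U" for i unfolding w_def U_def by (rule rnorm_coord_proj[OF rochberg_rep[OF u]])
  have low: "c * sqrt (real N) \<le> U" for N
  proof -
    have "c * rnorm (n - j) (base_array N (\<lambda>i. 1)) \<le> rnorm n (\<Sum>i<N. scal 1 (w (q i)))"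
    proof (rule ch(3)[rule_format, of "\<lambda>m. A (q m)" v], intro conjI allI)
      show "block_system n j (\<lambda>m. A (q m)) v"
        unfolding block_system_def
      proof (intro conjI allI impI v)
        show "A (q i) \<inter> A (q i') = {}" if "i \<noteq> i'" for i i'
          using q that by (intro disj) (auto simp: strict_mono_eq)
      qed (simp add: A_def)
      show "rnorm n (v i) < U + d' + 1" for i
      proof -
        have "rnorm n (v i) \<le> rnorm n (w (q i)) + rnorm n (v i - w (q i))"
          by (intro rnorm_triangle_sub rochberg_rep v w)
        then show ?thesis
          using wU[of "q i"] v4[of i] g rnorm_diff_commute[OF rochberg_rep[OF v(1)[of i]] rochberg_rep[OF w[of "q i"]]] r
          by linarith
      qed
      show "d' / 2 \<le> rnorm (Suc j) (v i)" for i
      proof -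
        have rr: "representable (Suc j) (v i)" "representable (Suc j) (w (q i))"
          using jn by (auto intro!: rochberg_representable v w)
        have "rnorm (Suc j) (w (q i)) \<le> rnorm (Suc j) (v i) + rnorm (Suc j) (w (q i) - v i)"
          by (rule rnorm_triangle_sub[OF rr(2,1)])
        moreover have "rnorm (Suc j) (w (q i) - v i) \<le> rnorm n (w (q i) - v i)"
          using jn by (intro rnorm_mono rochberg_rep rochberg_diff v w) auto
        ultimately show ?thesis using r(5) v4[of i] g unfolding q_def by (smt (verit) field_sum_of_halves)
      qed
      show "rnorm n (w (q i) - v i) \<le> h * (1/2) ^ i" for i
      proof -
        have "g * (1/2) ^ i \<le> h * (1/2) ^ i" using g by (intro mult_right_mono) auto
        then show ?thesis using v(4)[of i] by linarith
      qed
    qed (rule w)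
    also have "(\<Sum>i<N. scal 1 (w (q i))) = coord_proj (\<Union>i<N. A (q i)) u"
      unfolding scal_one w_def using q by (intro coord_proj_block_sum disj) (auto simp: strict_mono_eq)
    also have "rnorm n \<dots> \<le> U" unfolding U_def by (rule rnorm_coord_proj[OF rochberg_rep[OF u]])
    finally have "c * rnorm (n - j) (base_array N (\<lambda>i. 1)) \<le> U" .
    moreover have "c * sqrt (real N) \<le> c * rnorm (n - j) (base_array N (\<lambda>i. 1))"
      using ch jn by (intro mult_left_mono sqrt_le_rnorm_base_array) auto
    ultimately show ?thesis by linarith
  qed
  obtain N :: nat where "real N > (U / c)\<^sup>2" using reals_Archimedean2 by blast
  then have "sqrt (real N) > U / c" using U ch by (intro real_less_rsqrt)
  then have "c * sqrt (real N) > U" using ch by (simp add: pos_divide_less_eq mult.commute)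
  with low[of N] show False by simp
qed

text \<open>The tail estimate makes the truncations a Cauchy sequence; completeness gives a limit,
  and bounded coordinates identify it with \<open>u\<close>.\<close>

theorem rochberg_coord_proj_tendsto:
  assumes u: "u \<in> rochberg n"
  shows "(\<lambda>N. rnorm n (u - coord_proj {..<N} u)) \<longlonglongrightarrow> 0"
proof -
  define x where "x N = coord_proj {..<N} u" for N
  have x: "x N \<in> rochberg n" for N unfolding x_def by (rule rochberg_coord_proj[OF u])
  have diff: "x q - x p = coord_proj {p..<q} u" if "p \<le> q" for p q
    using that by (auto simp: fun_eq_iff x_def coord_proj_def)
  obtain L where L: "L \<in> rochberg n" "(\<lambda>N. rnorm n (x N - L)) \<longlonglongrightarrow> 0"
  proof (rule rochberg_complete[OF x])
    fix e :: real assume "e > 0"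
    then obtain N where N: "\<forall>N'\<ge>N. rnorm n (coord_proj {N..<N'} u) < e / 2"
      using rochberg_tail_blocks[OF u half_gt_zero] by blast
    have "rnorm n (x p - x q) < e" if "p \<ge> N" "q \<ge> N" for p q
    proof -
      have "x p - x q = (x p - x N) - (x q - x N)" by simp
      then have "rnorm n (x p - x q) = rnorm n ((x p - x N) - (x q - x N))" by (simp only:)
      also have "\<dots> \<le> rnorm n (x p - x N) + rnorm n (x q - x N)"
        by (intro rnorm_triangle_diff rochberg_rep rochberg_diff x)
      finally show ?thesis using N that diff[of N p] diff[of N q] by (smt (verit) field_sum_of_halves)
    qed
    then show "\<exists>N. \<forall>p\<ge>N. \<forall>q\<ge>N. rnorm n (x p - x q) < e" by blast
  qed (rule that)
  have "L j k = u j k" for j k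
  proof (cases "j < n")
    case True
    have "(\<lambda>N. 4 ^ j * rnorm n (x N - L)) \<longlonglongrightarrow> 0" using tendsto_mult_left[OF L(2), of "4 ^ j"] by simp
    moreover have "\<forall>\<^sub>F N in sequentially. norm (u j k - L j k) \<le> 4 ^ j * rnorm n (x N - L)"
    proof (rule eventually_sequentiallyI[of "Suc k"])
      fix N assume "Suc k \<le> N"
      then have "x N j k = u j k" by (simp add: x_def coord_proj_def)
      then show "norm (u j k - L j k) \<le> 4 ^ j * rnorm n (x N - L)"
        using coord_le_rnorm[OF rochberg_rep[OF rochberg_diff[OF x[of N] L(1)]] True, of k] by simp
    qed
    ultimately have "norm (u j k - L j k) \<le> 0" by (intro tendsto_lowerbound) auto
    then show ?thesis by simp
  next
    case False
    then show ?thesis using u L(1) by (auto simp: rochberg_iff)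
  qed
  then have "L = u" by (intro ext)
  moreover have "rnorm n (x N - u) = rnorm n (u - x N)" for N
    by (intro rnorm_diff_commute rochberg_rep x u)
  ultimately show ?thesis using L(2) unfolding x_def by (simp only:)
qed

section \<open>Coordinatewise null sequences\<close>

definition near_block :: "nat \<Rightarrow> nat \<Rightarrow> real \<Rightarrow> nat \<Rightarrow> nat \<Rightarrow> array \<Rightarrow> bool" where
  "near_block n l e N N' y \<longleftrightarrow> (\<exists>w. w \<in> rochberg n \<and> supported_in {N..<N'} w \<and> vanishes_below l w \<and>
     rnorm n (y - w) < e)"

text \<open>The substitute for weak nullity: it is reached by diagonal extraction, and bounded
  operators preserve it along bounded sequences.\<close>

definition coord_null :: "(nat \<Rightarrow> array) \<Rightarrow> bool" where
  "coord_null y \<longleftrightarrow> (\<forall>j k. (\<lambda>i. y i j k) \<longlonglongrightarrow> 0)"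

lemma coord_null_subseq: "coord_null y \<Longrightarrow> strict_mono r \<Longrightarrow> coord_null (\<lambda>i. y (r i))"
  unfolding coord_null_def using LIMSEQ_subseq_LIMSEQ by (fastforce simp: o_def)

text \<open>Three errors of size \<open>e / 3\<close>: the coordinates before \<open>N\<close> are
  small by coordinatewise nullity, those from \<open>N'\<close> on by convergence of truncations,
  and the entries below \<open>l\<close> by the level assumption. As \<open>N'\<close> depends on
  \<open>i\<close>, the quantifiers are nested.\<close>

lemma eventually_near_block:
  assumes y: "\<And>i. y i \<in> rochberg n" and null: "coord_null y"
    and lev: "(\<lambda>i. rnorm l (y i)) \<longlonglongrightarrow> 0" and l: "l \<le> n" and e: "e > 0"
  shows "\<forall>\<^sub>F i in sequentially. \<forall>\<^sub>F N' in sequentially. near_block n l e N N' (y i)"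
proof -
  obtain C where C: "C > 0" "\<And>A x. finite A \<Longrightarrow> supported_in A x \<Longrightarrow>
        representable n x \<and> rnorm n x \<le> C * (\<Sum>k\<in>A. \<Sum>j<n. cmod (x j k))"
    by (rule rnorm_finite_support[of n]) (rule that)
  have e3: "e / 3 > 0" using e by simp
  have "(\<lambda>i. C * (\<Sum>k<N. \<Sum>j<n. cmod (y i j k))) \<longlonglongrightarrow> C * (\<Sum>k<N. \<Sum>j<n. 0)"
    using null unfolding coord_null_def
    by (intro tendsto_intros tendsto_norm_zero) auto
  then have "(\<lambda>i. C * (\<Sum>k<N. \<Sum>j<n. cmod (y i j k))) \<longlonglongrightarrow> 0" by simp
  then have "\<forall>\<^sub>F i in sequentially. C * (\<Sum>k<N. \<Sum>j<n. cmod (y i j k)) < e / 3"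
    by (rule order_tendstoD(2)[OF _ e3])
  moreover have "\<forall>\<^sub>F i in sequentially. rnorm l (y i) < e / 3"
    by (rule order_tendstoD(2)[OF lev e3])
  ultimately show ?thesis
  proof eventually_elim
    case (elim i)
    have head: "rnorm n (coord_proj {..<N} (y i)) < e / 3"
    proof -
      have "rnorm n (coord_proj {..<N} (y i)) \<le> C * (\<Sum>k<N. \<Sum>j<n. cmod (coord_proj {..<N} (y i) j k))"
        using C(2)[of "{..<N}", OF _ coord_proj_supported[of _ "y i"]] by simp
      also have "\<dots> = C * (\<Sum>k<N. \<Sum>j<n. cmod (y i j k))" by (simp add: coord_proj_def)
      finally show ?thesis using elim by linarith
    qed
    have "\<forall>\<^sub>F N' in sequentially. rnorm n (y i - coord_proj {..<N'} (y i)) < e / 3"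
      by (rule order_tendstoD(2)[OF rochberg_coord_proj_tendsto[OF y] e3])
    then show ?case
      using eventually_ge_at_top[of N]
    proof eventually_elim
      case (elim N')
      define b where "b = coord_proj {N..<N'} (y i)"
      have b: "b \<in> rochberg n" "supported_in {N..<N'} b"
        unfolding b_def by (rule rochberg_coord_proj[OF y], rule coord_proj_supported)
      have "rnorm l b \<le> rnorm l (y i)"
        unfolding b_def by (rule rnorm_coord_proj[OF rochberg_representable[OF y l]])
      then have bl: "rnorm l b < e / 3" using \<open>rnorm l (y i) < e / 3\<close> by linarith
      obtain w where w: "w \<in> rochberg n" "supported_in {N..<N'} w" "vanishes_below l w" "rnorm n (b - w) < e / 3"
        by (rule perturb_to_vanishing[OF b bl l]) (rule that)
      have "y i - w = (coord_proj {..<N} (y i) + (y i - coord_proj {..<N'} (y i))) + (b - w)"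
        using elim by (auto simp: fun_eq_iff b_def coord_proj_def)
      then have "rnorm n (y i - w) = rnorm n ((coord_proj {..<N} (y i) + (y i - coord_proj {..<N'} (y i))) + (b - w))"
        by (rule arg_cong)
      also have "\<dots> \<le> rnorm n (coord_proj {..<N} (y i) + (y i - coord_proj {..<N'} (y i))) + rnorm n (b - w)"
        by (intro rnorm_triangle rochberg_rep rochberg_add rochberg_diff rochberg_coord_proj y b w)
      also have "\<dots> \<le> (rnorm n (coord_proj {..<N} (y i)) + rnorm n (y i - coord_proj {..<N'} (y i))) + rnorm n (b - w)"
        by (intro add_right_mono rnorm_triangle rochberg_rep rochberg_diff rochberg_coord_proj y)
      also have "\<dots> < e" using head elim(1) w(4) by linarith
      finally show ?case unfolding near_block_def using w by blast
    qed
  qed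
qed

text \<open>The recursion carries triples of start, index and end, so that each block starts where
  the previous one ended. Keeping \<open>Q\<close> abstract permits conditions on a sequence and on
  its image to be met with the same cut points.\<close>

lemma gliding_hump:
  assumes Q: "\<And>m N. \<forall>\<^sub>F i in sequentially. \<forall>\<^sub>F N' in sequentially. Q m N N' i"
  obtains r p :: "nat \<Rightarrow> nat" where "strict_mono r" "mono p" "\<And>m. Q m (p m) (p (Suc m)) (r m)"
proof -
  have ex: "\<exists>i N'. i0 < i \<and> N \<le> N' \<and> Q m N N' i" for m N i0
  proof -
    have "\<forall>\<^sub>F i in sequentially. i0 < i \<and> (\<forall>\<^sub>F N' in sequentially. Q m N N' i)"
      using eventually_gt_at_top[of i0] Q by (rule eventually_conj)
    then obtain i where i: "i0 < i" "\<forall>\<^sub>F N' in sequentially. Q m N N' i"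
      using eventually_happens'[OF sequentially_bot] by blast
    have "\<forall>\<^sub>F N' in sequentially. N \<le> N' \<and> Q m N N' i"
      using eventually_ge_at_top[of N] i(2) by (rule eventually_conj)
    then obtain N' where "N \<le> N'" "Q m N N' i"
      using eventually_happens'[OF sequentially_bot] by blast
    with i show ?thesis by blast
  qed
  have "\<exists>f. \<forall>m. (case f m of (N, i, N') \<Rightarrow> N \<le> N' \<and> Q m N N' i) \<and>
      (case f m of (N, i, N') \<Rightarrow> case f (Suc m) of (N2, i2, N2') \<Rightarrow> N2 = N' \<and> i < i2)"
  proof (rule dependent_nat_choice)
    show "\<exists>x. case x of (N, i, N') \<Rightarrow> N \<le> N' \<and> Q 0 N N' i" using ex[of 0 0 0] by auto
    fix x :: "nat \<times> nat \<times> nat" and m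
    obtain N i N' where x: "x = (N, i, N')" by (cases x)
    obtain i2 N2 where "i < i2" "N' \<le> N2" "Q (Suc m) N' N2 i2" using ex by blast
    then show "\<exists>y. (case y of (N, i, N') \<Rightarrow> N \<le> N' \<and> Q (Suc m) N N' i) \<and>
      (case x of (N, i, N') \<Rightarrow> case y of (N2, i2, N2') \<Rightarrow> N2 = N' \<and> i < i2)"
      unfolding x by (intro exI[of _ "(N', i2, N2)"]) auto
  qed
  then obtain f where f: "\<And>m. (case f m of (N, i, N') \<Rightarrow> N \<le> N' \<and> Q m N N' i) \<and>
      (case f m of (N, i, N') \<Rightarrow> case f (Suc m) of (N2, i2, N2') \<Rightarrow> N2 = N' \<and> i < i2)" by blast
  define p where "p m = fst (f m)" for m
  define r where "r m = fst (snd (f m))" for m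
  have *: "p m \<le> p (Suc m) \<and> r m < r (Suc m) \<and> Q m (p m) (p (Suc m)) (r m)" for m
    using f[of m] unfolding p_def r_def by (cases "f m"; cases "f (Suc m)") auto
  show ?thesis
    by (rule that[of r p]) (use * in \<open>auto simp: strict_mono_Suc_iff mono_iff_le_Suc\<close>)
qed

lemma near_blocks_obtain:
  assumes "mono p" "\<And>m. near_block n l (e m) (p m) (p (Suc m)) (y m)"
  obtains w where "block_system n l (\<lambda>m. {p m..<p (Suc m)}) w" "\<And>m. rnorm n (y m - w m) < e m"
proof -
  obtain w where w: "\<And>m. w m \<in> rochberg n" "\<And>m. supported_in {p m..<p (Suc m)} (w m)"
     "\<And>m. vanishes_below l (w m)" "\<And>m. rnorm n (y m - w m) < e m"
    using assms(2) unfolding near_block_def by metis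
  have "block_system n l (\<lambda>m. {p m..<p (Suc m)}) w"
    unfolding block_system_def using w(1-3) mono_intervals_disjoint[OF assms(1)] by auto
  with w(4) that show ?thesis by blast
qed

lemma not_tendsto_zero_subsequence:
  fixes f :: "nat \<Rightarrow> real"
  assumes nn: "\<And>i. 0 \<le> f i" and nt: "\<not> f \<longlonglongrightarrow> 0"
  obtains d and r :: "nat \<Rightarrow> nat" where "d > 0" "strict_mono r" "\<And>i. d \<le> f (r i)"
proof -
  obtain d where d: "d > 0" "\<not> (\<exists>N. \<forall>i\<ge>N. f i < d)"
    using nt nn unfolding LIMSEQ_def by auto
  then have "\<exists>i\<ge>N. d \<le> f i" for N by (meson not_less)
  then have "\<exists>r. strict_mono (r :: nat \<Rightarrow> nat) \<and> (\<forall>m. d \<le> f (r m))"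
    by (rule subsequence_choice[where P = "\<lambda>m i. d \<le> f i"]) blast
  with d that show ?thesis by blast
qed

lemma additive_homogeneous_sum:
  fixes N :: nat and f :: "array \<Rightarrow> 'b::ab_group_add" and z :: "nat \<Rightarrow> array"
  assumes add: "\<And>x y. x \<in> rochberg n \<Longrightarrow> y \<in> rochberg n \<Longrightarrow> f (x + y) = f x + f y"
    and scal: "\<And>c x. x \<in> rochberg n \<Longrightarrow> f (scal c x) = sc c (f x)"
    and zero: "f 0 = 0" and z: "\<And>i. z i \<in> rochberg n"
  shows "f (lincomb N a z) = (\<Sum>i<N. sc (a i) (f (z i)))"
proof (induction N)
  case 0
  then show ?case by (simp only: lessThan_0 sum.empty zero)
next
  case (Suc N)
  have "f ((lincomb N a z) + scal (a N) (z N)) = f (lincomb N a z) + sc (a N) (f (z N))"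
    by (simp only: add scal rochberg_sum rochberg_scal z)
  then show ?case by (simp only: Suc sum.lessThan_Suc)
qed

lemma cnj_sgn_mult: "cnj (sgn w) * w = of_real (cmod w)"
proof (cases "w = 0")
  case False
  have "cnj (sgn w) * w = (w * cnj w) / of_real (cmod w)" by (simp add: sgn_eq)
  also have "\<dots> = of_real ((cmod w)\<^sup>2) / of_real (cmod w)" by (simp only: complex_norm_square)
  also have "\<dots> = of_real (cmod w)" using False by (simp add: power2_eq_square)
  finally show ?thesis .
qed simp

text \<open>A coordinatewise null sequence along which the functional stays away from zero would contain
  almost disjoint blocks on whose sums the functional grows linearly, whereas the norm of these sums
  grows sublinearly.\<close>

lemma functional_coord_null:
  fixes f :: "array \<Rightarrow> complex"
  assumes n: "n > 0" and y: "\<And>i. y i \<in> rochberg n" and bd: "\<And>i. rnorm n (y i) \<le> M" and null: "coord_null y"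
    and add: "\<And>x y. x \<in> rochberg n \<Longrightarrow> y \<in> rochberg n \<Longrightarrow> f (x + y) = f x + f y"
    and scal: "\<And>c x. x \<in> rochberg n \<Longrightarrow> f (scal c x) = c * f x"
    and K: "\<And>x. x \<in> rochberg n \<Longrightarrow> cmod (f x) \<le> K * rnorm n x"
  shows "(\<lambda>i. f (y i)) \<longlonglongrightarrow> 0"
proof (rule ccontr)
  assume "\<not> ?thesis"
  then have "\<not> (\<lambda>i. cmod (f (y i))) \<longlonglongrightarrow> 0" by (simp only: tendsto_norm_zero_iff not_False_eq_True)
  then have "\<exists>d r0. d > 0 \<and> strict_mono (r0 :: nat \<Rightarrow> nat) \<and> (\<forall>i. d \<le> cmod (f (y (r0 i))))"
    by (rule not_tendsto_zero_subsequence[where f = "\<lambda>i. cmod (f (y i))", OF norm_ge_zero]) blast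
  then obtain d and r0 :: "nat \<Rightarrow> nat" where r0: "d > 0" "strict_mono r0" "\<forall>i. d \<le> cmod (f (y (r0 i)))"
    by (elim exE conjE) (rule that)
  define x where "x i = y (r0 i)" for i
  have x: "x i \<in> rochberg n" for i unfolding x_def by (rule y)
  have xn: "coord_null x" unfolding x_def by (rule coord_null_subseq[OF null r0(2)])
  \<comment> \<open>At level 0 no entry has to vanish and the level assumption is void, so
    coordinatewise nullity alone yields near blocks.\<close>
  have ev: "\<forall>\<^sub>F i in sequentially. \<forall>\<^sub>F N' in sequentially. near_block n 0 ((1/2) ^ m) N N' (x i)" for m N
    by (rule eventually_near_block[OF x xn]) (auto simp: rnorm_order_0)
  obtain r p where rp: "strict_mono r" "mono p" "\<And>m. near_block n 0 ((1/2) ^ m) (p m) (p (Suc m)) (x (r m))"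
    using ev by (rule gliding_hump[where Q = "\<lambda>m N N' i. near_block n 0 ((1/2) ^ m) N N' (x i)"]) (rule that)
  obtain w where w: "block_system n 0 (\<lambda>m. {p m..<p (Suc m)}) w" "\<And>m. rnorm n (x (r m) - w m) < (1/2) ^ m"
    by (rule near_blocks_obtain[OF rp(2,3)]) (rule that)
  note wr = block_systemD(4)[OF w(1)]
  have M0: "0 \<le> M" using order_trans[OF rnorm_nonneg[OF rochberg_rep[OF y]] bd] .
  have wM: "rnorm n (w i) < M + 2" for i
  proof -
    have "rnorm n (w i) \<le> rnorm n (x (r i)) + rnorm n (w i - x (r i))"
      by (intro rnorm_triangle_sub rochberg_rep x wr)
    moreover have "rnorm n (w i - x (r i)) = rnorm n (x (r i) - w i)"
      by (intro rnorm_diff_commute rochberg_rep x wr)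
    moreover have "(1/2::real) ^ i \<le> 1" by (rule power_le_one) auto
    ultimately show ?thesis using w(2)[of i] bd[of "r0 (r i)"] unfolding x_def by linarith
  qed
  \<comment> \<open>Unimodular phases, where the value is nonzero, turn the functional on the sum
    into the sum of the moduli.\<close>
  define a where "a i = cnj (sgn (f (x (r i))))" for i
  have a1: "cmod (a i) \<le> 1" for i by (simp add: a_def norm_sgn)
  have af: "a i * f (x (r i)) = of_real (cmod (f (x (r i))))" for i
    unfolding a_def by (rule cnj_sgn_mult)
  \<comment> \<open>\<open>M + 4\<close> is the upper estimate for near blocks, with block bound
    \<open>M + 2\<close> and perturbation size 1. Below, \<open>e\<close> is chosen so that
    \<open>K' * e = d / 2\<close>, half of the linear growth rate.\<close>
  define K' where "K' = (\<bar>K\<bar> + 1) * (M + 4)"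
  have K': "K' > 0" unfolding K'_def using M0 by (intro mult_pos_pos) auto
  define e where "e = d / (2 * K')"
  have e: "e > 0" using r0 K' by (simp add: e_def)
  obtain B where B: "\<forall>N a. (\<forall>i<N. cmod (a i) \<le> 1) \<longrightarrow> rnorm n (base_array N a) \<le> B + e * real N"
    by (rule rnorm_base_array_sublinear[OF e, of n]) (rule that)
  have "real N * d \<le> K' * B + real N * (d / 2)" for N
  proof -
    define s where "s = (\<Sum>i<N. scal (a i) (x (r i)))"
    have s: "s \<in> rochberg n" unfolding s_def by (intro rochberg_sum rochberg_scal x)
    have "f 0 = 0" using add[OF rochberg_zero rochberg_zero] by simp
    then have "f s = (\<Sum>i<N. a i * f (x (r i)))"
      unfolding s_def by (intro additive_homogeneous_sum[where n = n] add scal x)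
    then have "f s = of_real (\<Sum>i<N. cmod (f (x (r i))))" by (simp add: af)
    then have fs: "cmod (f s) = (\<Sum>i<N. cmod (f (x (r i))))"
      by (simp only: norm_of_real abs_of_nonneg sum_nonneg norm_ge_zero)
    have "real N * d = (\<Sum>i<N. d)" by simp
    also have "\<dots> \<le> cmod (f s)" unfolding fs x_def using r0(3) by (intro sum_mono) blast
    also have "\<dots> \<le> K * rnorm n s" by (rule K[OF s])
    also have "\<dots> \<le> (\<bar>K\<bar> + 1) * rnorm n s"
      using rnorm_nonneg[OF rochberg_rep[OF s]] by (intro mult_right_mono) auto
    also have "\<dots> \<le> (\<bar>K\<bar> + 1) * ((M + 2 + 2 * 1) * rnorm (n - 0) (base_array N a))"
    proof (rule mult_left_mono)
      show "rnorm n s \<le> (M + 2 + 2 * 1) * rnorm (n - 0) (base_array N a)"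
        unfolding s_def
      proof (rule rnorm_near_blocks_upper[OF w(1) x wM])
        show "0 < M + 2" using M0 by simp
        show "0 < n" by fact
        show "rnorm n (x (r i) - w i) \<le> 1 * (1/2) ^ i" for i using less_imp_le[OF w(2)[of i]] by simp
      qed
    qed simp
    also have "\<dots> = K' * rnorm n (base_array N a)" by (simp add: K'_def)
    also have "\<dots> \<le> K' * (B + e * real N)" using K' B a1 by (intro mult_left_mono) auto
    also have "\<dots> = K' * B + real N * (d / 2)" using K' by (simp add: e_def field_simps)
    finally show ?thesis .
  qed
  moreover have "real N * d = real N * (d / 2) + real N * (d / 2)" for N by simp
  ultimately have bound: "real N * (d / 2) \<le> K' * B" for N by (metis add_le_cancel_right)
  obtain N :: nat where "real N > K' * B / (d / 2)" using reals_Archimedean2 by blast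
  then have "real N * (d / 2) > K' * B" using r0 by (subst (asm) pos_divide_less_eq) auto
  with bound[of N] show False by simp
qed

section \<open>Bounded operators and operators bounded below on a span\<close>

lemma bounded_operatorD:
  assumes "bounded_operator n T"
  shows "x \<in> rochberg n \<Longrightarrow> T x \<in> rochberg n"
    "x \<in> rochberg n \<Longrightarrow> y \<in> rochberg n \<Longrightarrow> T (x + y) = T x + T y"
    "x \<in> rochberg n \<Longrightarrow> T (scal c x) = scal c (T x)"
    "T 0 = 0"
    "x \<in> rochberg n \<Longrightarrow> y \<in> rochberg n \<Longrightarrow> T (x - y) = T x - T y"
    "\<exists>K>0. \<forall>x\<in>rochberg n. rnorm n (T x) \<le> K * rnorm n x"
proof -
  show T: "T x \<in> rochberg n" if "x \<in> rochberg n" for x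
    using assms that unfolding bounded_operator_def by blast
  show add: "T (x + y) = T x + T y" if "x \<in> rochberg n" "y \<in> rochberg n" for x y
    using assms that unfolding bounded_operator_def vadd_eq_plus by blast
  show sc: "T (scal c x) = scal c (T x)" if "x \<in> rochberg n" for x c
    using assms that unfolding bounded_operator_def by blast
  show "T 0 = 0" using sc[OF rochberg_zero, of 0] by (simp only: scal_zero_left)
  show "T (x - y) = T x - T y" if "x \<in> rochberg n" "y \<in> rochberg n"
  proof -
    have "T (x + scal (-1) y) = T x + scal (-1) (T y)" using that by (simp only: add sc rochberg_scal)
    then show ?thesis by (simp add: scal_minus_one)
  qed
  obtain K where K: "\<forall>x\<in>rochberg n. rnorm n (T x) \<le> K * rnorm n x"
    using assms unfolding bounded_operator_def by blast
  have "rnorm n (T x) \<le> (\<bar>K\<bar> + 1) * rnorm n x" if "x \<in> rochberg n" for x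
  proof -
    have "K * rnorm n x \<le> (\<bar>K\<bar> + 1) * rnorm n x"
      using rnorm_nonneg[OF rochberg_rep[OF that]] by (intro mult_right_mono) auto
    then show ?thesis using K that by fastforce
  qed
  then show "\<exists>K>0. \<forall>x\<in>rochberg n. rnorm n (T x) \<le> K * rnorm n x"
    by (intro exI[of _ "\<bar>K\<bar> + 1"]) auto
qed

text \<open>Each entry of \<open>T x\<close> with \<open>j < n\<close> is a bounded functional of
  \<open>x\<close>, so \<open>functional_coord_null\<close> applies; entries from position
  \<open>n\<close> on vanish.\<close>

lemma bounded_operator_coord_null:
  assumes n: "n > 0" and T: "bounded_operator n T" and y: "\<And>i. y i \<in> rochberg n"
    and bd: "\<And>i. rnorm n (y i) \<le> M" and null: "coord_null y"
  shows "coord_null (\<lambda>i. T (y i))"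
  unfolding coord_null_def
proof (intro allI)
  fix j k
  obtain K where K: "K > 0" "\<forall>x\<in>rochberg n. rnorm n (T x) \<le> K * rnorm n x"
    using bounded_operatorD(6)[OF T] by blast
  show "(\<lambda>i. T (y i) j k) \<longlonglongrightarrow> 0"
  proof (cases "j < n")
    case True
    show ?thesis
    proof (rule functional_coord_null[OF n y bd null, where f = "\<lambda>x. T x j k" and K = "4 ^ j * K"])
      show "T (x + y) j k = T x j k + T y j k" if "x \<in> rochberg n" "y \<in> rochberg n" for x y
        using bounded_operatorD(2)[OF T that] by simp
      show "T (scal c x) j k = c * T x j k" if "x \<in> rochberg n" for c x
        using bounded_operatorD(3)[OF T that] by simp
      fix x assume x: "x \<in> rochberg n"
      have "cmod (T x j k) \<le> 4 ^ j * rnorm n (T x)"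
        by (rule coord_le_rnorm[OF rochberg_rep[OF bounded_operatorD(1)[OF T x]] True])
      also have "\<dots> \<le> 4 ^ j * (K * rnorm n x)" using K x by (intro mult_left_mono) auto
      finally show "cmod (T x j k) \<le> 4 ^ j * K * rnorm n x" by simp
    qed
  next
    case False
    then have "T (y i) j k = 0" for i using bounded_operatorD(1)[OF T y] by (simp add: rochberg_iff)
    then show ?thesis by simp
  qed
qed

text \<open>More unknowns than homogeneous equations: one equation is solved for a pivot
  \<open>i0\<close> and substituted into the others, which lowers both counts by one.\<close>

lemma linear_dependence:
  fixes c :: "'i \<Rightarrow> 'b \<Rightarrow> complex"
  assumes "finite B" "finite I" "card B < card I"
  shows "\<exists>a. (\<exists>i\<in>I. a i \<noteq> 0) \<and> (\<forall>b\<in>B. (\<Sum>i\<in>I. a i * c i b) = 0)"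
  using assms
proof (induction B arbitrary: I c rule: finite_induct)
  case empty
  then have "I \<noteq> {}" by auto
  then show ?case by (intro exI[of _ "\<lambda>i. 1"]) auto
next
  case (insert b B)
  show ?case
  proof (cases "\<forall>i\<in>I. c i b = 0")
    case True
    have "card B < card I" using insert by simp
    then obtain a where "\<exists>i\<in>I. a i \<noteq> 0" "\<forall>b\<in>B. (\<Sum>i\<in>I. a i * c i b) = 0"
      using insert.IH[OF insert.prems(1)] by blast
    then show ?thesis using True by (intro exI[of _ a]) auto
  next
    case False
    then obtain i0 where i0: "i0 \<in> I" "c i0 b \<noteq> 0" by auto
    define J where "J = I - {i0}"
    define c' where "c' i b' = c i b' - c i b / c i0 b * c i0 b'" for i b'
    have J: "finite J" "card B < card J" using insert i0 by (auto simp: J_def card_Diff_singleton)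
    then obtain a where a: "\<exists>i\<in>J. a i \<noteq> 0" "\<forall>b'\<in>B. (\<Sum>i\<in>J. a i * c' i b') = 0"
      using insert.IH[of J c'] by blast
    define a' where "a' = a(i0 := - (\<Sum>i\<in>J. a i * c i b) / c i0 b)"
    have sum: "(\<Sum>i\<in>I. a' i * c i b') = - (\<Sum>i\<in>J. a i * c i b) / c i0 b * c i0 b' + (\<Sum>i\<in>J. a i * c i b')" for b'
    proof -
      have "(\<Sum>i\<in>I. a' i * c i b') = a' i0 * c i0 b' + (\<Sum>i\<in>J. a' i * c i b')"
        unfolding J_def using insert.prems(1) i0(1) by (rule sum.remove)
      also have "(\<Sum>i\<in>J. a' i * c i b') = (\<Sum>i\<in>J. a i * c i b')"
        by (intro sum.cong) (auto simp: a'_def J_def)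
      finally show ?thesis by (simp add: a'_def)
    qed
    have "(\<Sum>i\<in>I. a' i * c i b') = (\<Sum>i\<in>J. a i * c' i b')" for b'
    proof -
      have "(\<Sum>i\<in>J. a i * c' i b') = (\<Sum>i\<in>J. a i * c i b' - a i * c i b * (c i0 b' / c i0 b))"
        by (intro sum.cong refl) (simp add: c'_def right_diff_distrib)
      also have "\<dots> = (\<Sum>i\<in>J. a i * c i b') - (\<Sum>i\<in>J. a i * c i b) * (c i0 b' / c i0 b)"
        by (simp only: sum_subtractf sum_distrib_right)
      finally show ?thesis unfolding sum by simp
    qed
    then have "\<forall>b'\<in>insert b B. (\<Sum>i\<in>I. a' i * c i b') = 0"
      using a(2) i0(2) by (auto simp: c'_def)
    moreover have "\<exists>i\<in>I. a' i \<noteq> 0" using a(1) by (auto simp: a'_def J_def)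
    ultimately show ?thesis by blast
  qed
qed

text \<open>The witness is the closure of the span of \<open>z\<close>. The estimate
  \<open>low\<close> passes to it by density and boundedness of \<open>T\<close>, while
  \<open>coef\<close> makes the \<open>z i\<close> linearly independent, so the subspace is
  infinite-dimensional.\<close>

lemma bounded_below_not_strictly_singular:
  fixes z :: "nat \<Rightarrow> array"
  assumes T: "bounded_operator n T" and z: "\<And>i. z i \<in> rochberg n" and c: "c > 0" "c' > 0"
    and low: "\<And>N a. c * rnorm n (lincomb N a z) \<le> rnorm n (T (lincomb N a z))"
    and coef: "\<And>N a i. i < N \<Longrightarrow> c' * cmod (a i) \<le> rnorm n (T (lincomb N a z))"
  shows "\<not> strictly_singular n T"
proof
  assume ss: "strictly_singular n T"
  obtain K where K: "K > 0" "\<forall>x\<in>rochberg n. rnorm n (T x) \<le> K * rnorm n x"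
    using bounded_operatorD(6)[OF T] by blast
  define L where "L = {\<Sum>i<N. scal (a i) (z i) | N a. True}"
  have LI: "(lincomb N a z) \<in> L" for N a unfolding L_def by auto
  have LR: "x \<in> rochberg n" if "x \<in> L" for x
    using that unfolding L_def by (auto intro!: rochberg_sum rochberg_scal z)
  have extend: "(lincomb N a z) = (\<Sum>i<N'. scal (if i < N then a i else 0) (z i))" if "N \<le> N'" for N N' :: nat and a
  proof (rule sum.mono_neutral_cong_left)
    show "\<forall>i\<in>{..<N'} - {..<N}. scal (if i < N then a i else 0) (z i) = 0" by (auto simp: scal_zero_left)
  qed (use that in auto)
  have Ladd: "x + y \<in> L" if "x \<in> L" "y \<in> L" for x y
  proof -
    obtain N a M b where x: "x = (lincomb N a z)" and y: "y = (\<Sum>i<M. scal (b i) (z i))"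
      using \<open>x \<in> L\<close> \<open>y \<in> L\<close> unfolding L_def by blast
    have eq: "x + y = (\<Sum>i<max N M. scal ((if i < N then a i else 0) + (if i < M then b i else 0)) (z i))"
      unfolding x y extend[of N "max N M", OF max.cobounded1] extend[of M "max N M", OF max.cobounded2]
        scal_left_distrib sum.distrib ..
    show ?thesis unfolding eq by (rule LI)
  qed
  have Lscal: "scal t x \<in> L" if "x \<in> L" for x t
  proof -
    obtain N a where x: "x = (lincomb N a z)" using \<open>x \<in> L\<close> unfolding L_def by blast
    have eq: "scal t x = (\<Sum>i<N. scal (t * a i) (z i))"
      unfolding x by (auto simp: fun_eq_iff sum_array_apply sum_distrib_left mult.assoc)
    show ?thesis unfolding eq by (rule LI)
  qed
  have zL: "z i \<in> L" for i
  proof -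
    have eq: "z i = (\<Sum>l<Suc i. scal (if l = i then 1 else 0) (z l))"
      by (auto simp: fun_eq_iff sum_array_apply if_distrib[of "\<lambda>t. t * _"] cong: if_cong)
    show ?thesis unfolding eq by (rule LI)
  qed
  have L0: "0 \<in> L" using Lscal[OF zL[of 0], of 0] by (simp only: scal_zero_left)
  define Y where "Y = {x \<in> rochberg n. \<forall>e>0. \<exists>y\<in>L. rnorm n (x - y) < e}"
  have LY: "L \<subseteq> Y"
  proof
    fix x assume "x \<in> L"
    then show "x \<in> Y" unfolding Y_def using LR by (auto simp: rnorm_zero intro!: bexI[of _ x])
  qed
  have "closed_subspace n Y"
    unfolding closed_subspace_def vadd_eq_plus vsub_eq_minus
  proof (intro conjI ballI allI impI)
    show "Y \<subseteq> rochberg n" by (auto simp: Y_def)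
    show "(\<lambda>j k. 0) \<in> Y" using LY L0 by (auto simp: zero_fun_def)
  next
    fix x y assume x: "x \<in> Y" and y: "y \<in> Y"
    have xr: "x \<in> rochberg n" and yr: "y \<in> rochberg n" using x y by (auto simp: Y_def)
    have "\<exists>v\<in>L. rnorm n (x + y - v) < e" if e: "e > 0" for e
    proof -
      have "e / 2 > 0" using e by simp
      then obtain a b where ab: "a \<in> L" "rnorm n (x - a) < e/2" "b \<in> L" "rnorm n (y - b) < e/2"
        using x y unfolding Y_def by blast
      have "rnorm n ((x - a) + (y - b)) \<le> rnorm n (x - a) + rnorm n (y - b)"
        by (intro rnorm_triangle rochberg_rep rochberg_diff xr yr LR ab)
      moreover have "(x - a) + (y - b) = x + y - (a + b)" by simp
      ultimately have "rnorm n (x + y - (a + b)) < e" using ab by simp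
      then show ?thesis using Ladd[OF ab(1,3)] by blast
    qed
    then show "x + y \<in> Y" unfolding Y_def using rochberg_add[OF xr yr] by blast
  next
    fix x t assume x: "x \<in> Y"
    have xr: "x \<in> rochberg n" using x by (auto simp: Y_def)
    have "\<exists>v\<in>L. rnorm n (scal t x - v) < e" if e: "e > 0" for e
    proof -
      have "e / (cmod t + 1) > 0" using e by (simp add: add_nonneg_pos)
      then obtain a where a: "a \<in> L" "rnorm n (x - a) < e / (cmod t + 1)" using x unfolding Y_def by blast
      have "rnorm n (scal t (x - a)) \<le> cmod t * rnorm n (x - a)"
        by (intro rnorm_scal_le rochberg_rep rochberg_diff xr LR a)
      also have "\<dots> \<le> (cmod t + 1) * rnorm n (x - a)"
        by (intro mult_right_mono rnorm_nonneg rochberg_rep rochberg_diff xr LR a) auto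
      also have "\<dots> < (cmod t + 1) * (e / (cmod t + 1))"
        using a by (intro mult_strict_left_mono) (auto intro: add_nonneg_pos)
      also have "\<dots> = e"
      proof -
        have "cmod t + 1 \<noteq> 0" using norm_ge_zero[of t] by linarith
        then show ?thesis by simp
      qed
      finally show ?thesis using Lscal[OF a(1), of t] unfolding scal_right_diff by blast
    qed
    then show "scal t x \<in> Y" unfolding Y_def using rochberg_scal[OF xr] by blast
  next
    fix s :: "nat \<Rightarrow> array" and x assume h: "(\<forall>i. s i \<in> Y) \<and> x \<in> rochberg n \<and> (\<lambda>i. rnorm n (s i - x)) \<longlonglongrightarrow> 0"
    have "\<exists>v\<in>L. rnorm n (x - v) < e" if e: "e > 0" for e
    proof -
      have e2: "e / 2 > 0" using e by simp
      have "\<forall>\<^sub>F i in sequentially. rnorm n (s i - x) < e / 2" using h e2 by (intro order_tendstoD(2)) auto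
      then obtain i where i: "rnorm n (s i - x) < e / 2" using eventually_happens'[OF sequentially_bot] by blast
      have "s i \<in> Y" using h by blast
      then have si: "s i \<in> rochberg n" "\<forall>e>0. \<exists>y\<in>L. rnorm n (s i - y) < e" by (auto simp: Y_def)
      then obtain a where a: "a \<in> L" "rnorm n (s i - a) < e / 2" using e2 by blast
      have "rnorm n ((s i - a) - (s i - x)) \<le> rnorm n (s i - a) + rnorm n (s i - x)"
        by (intro rnorm_triangle_diff rochberg_rep rochberg_diff si(1) LR[OF a(1)] conjunct1[OF conjunct2[OF h]])
      moreover have "(s i - a) - (s i - x) = x - a" by simp
      ultimately have "rnorm n (x - a) < e" using a i by simp
      then show ?thesis using a by blast
    qed
    then show "x \<in> Y" unfolding Y_def using h by blast
  qed
  moreover have "infinite_dimensional Y"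
    unfolding infinite_dimensional_def
  proof (intro allI impI notI)
    fix B :: "array set" assume B: "finite B" "Y \<subseteq> {(\<lambda>j k. \<Sum>b\<in>B. c b * b j k) | c. True}"
    have "\<exists>c. z i = (\<lambda>j k. \<Sum>b\<in>B. c b * b j k)" for i
      using zL[of i] LY B(2) by blast
    then obtain g where g: "\<And>i. z i = (\<lambda>j k. \<Sum>b\<in>B. g i b * b j k)" by metis
    \<comment> \<open>One vector more than \<open>B\<close> has elements: some nontrivial
      combination of the \<open>z i\<close> vanishes, which contradicts \<open>coef\<close>.\<close>
    define N where "N = Suc (card B)"
    obtain a where a: "\<exists>i\<in>{..<N}. a i \<noteq> 0" "\<forall>b\<in>B. (\<Sum>i\<in>{..<N}. a i * g i b) = 0"
      using linear_dependence[OF B(1), of "{..<N}" g] by (auto simp: N_def)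
    have "(lincomb N a z) j k = 0" for j k
    proof -
      have "(lincomb N a z) j k = (\<Sum>i<N. \<Sum>b\<in>B. a i * g i b * b j k)"
        unfolding sum_array_apply scal_apply g by (simp add: sum_distrib_left mult.assoc)
      also have "\<dots> = (\<Sum>b\<in>B. (\<Sum>i<N. a i * g i b) * b j k)"
        by (subst sum.swap) (simp add: sum_distrib_right)
      also have "\<dots> = 0" using a(2) by (intro sum.neutral) auto
      finally show ?thesis .
    qed
    then have s0: "(lincomb N a z) = 0" by (intro ext) simp
    obtain i where i: "i < N" "a i \<noteq> 0" using a(1) by auto
    have "c' * cmod (a i) \<le> 0"
      using coef[OF i(1), of a] unfolding s0 bounded_operatorD(4)[OF T] rnorm_zero .
    then show False using c(2) i(2) by (simp add: mult_le_0_iff)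
  qed
  moreover have "iso_on n T Y"
    unfolding iso_on_def
  proof (intro exI[of _ c] conjI ballI)
    show "c > 0" by fact
    fix x assume x: "x \<in> Y"
    have xr: "x \<in> rochberg n" using x by (auto simp: Y_def)
    show "c * rnorm n x \<le> rnorm n (T x)"
    proof (rule field_le_epsilon)
      fix e :: real assume e: "e > 0"
      \<comment> \<open>Replacing \<open>x\<close> by \<open>v\<close> costs \<open>c\<close> times
        their distance on the left and \<open>K\<close> times it on the right.\<close>
      have "e / (c + K) > 0" using e c K by (simp add: add_pos_pos)
      then obtain v where v: "v \<in> L" "rnorm n (x - v) < e / (c + K)" using x unfolding Y_def by blast
      note vr = LR[OF v(1)]
      have 1: "c * rnorm n v \<le> rnorm n (T v)" using v(1) low unfolding L_def by blast
      have "rnorm n (T v) \<le> rnorm n (T x) + rnorm n (T v - T x)"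
        by (intro rnorm_triangle_sub rochberg_rep bounded_operatorD(1)[OF T] xr vr)
      moreover have "rnorm n (T v - T x) = rnorm n (T x - T v)"
        by (intro rnorm_diff_commute rochberg_rep bounded_operatorD(1)[OF T] xr vr)
      moreover have "rnorm n (T x - T v) \<le> K * rnorm n (x - v)"
        unfolding bounded_operatorD(5)[OF T xr vr, symmetric] using K(2) rochberg_diff[OF xr vr] by blast
      ultimately have 2: "rnorm n (T v) \<le> rnorm n (T x) + K * rnorm n (x - v)" by linarith
      have "rnorm n x \<le> rnorm n v + rnorm n (x - v)" by (intro rnorm_triangle_sub rochberg_rep xr vr)
      then have "c * rnorm n x \<le> c * rnorm n v + c * rnorm n (x - v)"
        using c(1) by (simp add: mult_left_mono flip: distrib_left)
      also have "\<dots> \<le> rnorm n (T x) + (c + K) * rnorm n (x - v)" using 1 2 by (simp add: distrib_right)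
      also have "\<dots> \<le> rnorm n (T x) + (c + K) * (e / (c + K))"
        using v(2) c K by (intro add_left_mono mult_left_mono) auto
      also have "(c + K) * (e / (c + K)) = e" using c K by simp
      finally show "c * rnorm n x \<le> rnorm n (T x) + e" .
    qed
  qed
  ultimately show False using ss unfolding strictly_singular_def by blast
qed

section \<open>Strictly singular operators\<close>

text \<open>If the level did not rise, a subsequence of \<open>u\<close> would satisfy the upper block estimate at level
  \<open>k\<close> and its image the lower block estimate at some level \<open>j \<le> k\<close>, so \<open>T\<close> would be bounded below
  on the span of that subsequence.\<close>

theorem strictly_singular_raises_level:
  assumes T: "strictly_singular n T" and u: "\<And>i. u i \<in> rochberg n" and bd: "\<And>i. rnorm n (u i) \<le> M"
    and null: "coord_null u" and lev: "(\<lambda>i. rnorm k (u i)) \<longlonglongrightarrow> 0" and k: "k < n"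
  shows "(\<lambda>i. rnorm (Suc k) (T (u i))) \<longlonglongrightarrow> 0"
proof (rule ccontr)
  have bo: "bounded_operator n T" using T by (simp add: strictly_singular_def)
  note TR = bounded_operatorD(1)[OF bo]
  have n: "n > 0" using k by simp
  have M0: "0 \<le> M" using order_trans[OF rnorm_nonneg[OF rochberg_rep[OF u]] bd] .
  obtain K where K: "K > 0" "\<forall>x\<in>rochberg n. rnorm n (T x) \<le> K * rnorm n x"
    using bounded_operatorD(6)[OF bo] by blast
  have Suck: "representable (Suc k) (T (u i))" for i
    using k by (intro rochberg_representable[OF TR[OF u]]) simp
  assume "\<not> ?thesis"
  then have "\<exists>d r0. d > 0 \<and> strict_mono (r0 :: nat \<Rightarrow> nat) \<and> (\<forall>i. d \<le> rnorm (Suc k) (T (u (r0 i))))"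
    by (rule not_tendsto_zero_subsequence[where f = "\<lambda>i. rnorm (Suc k) (T (u i))", OF rnorm_nonneg[OF Suck]]) blast
  then obtain d and r0 :: "nat \<Rightarrow> nat" where r0: "d > 0" "strict_mono r0" "\<forall>i. d \<le> rnorm (Suc k) (T (u (r0 i)))"
    by (elim exE conjE) (rule that)
  \<comment> \<open>The image need not fail to be null first at level \<open>Suc k\<close>;
    \<open>j\<close> is the level reached along a suitable subsequence.\<close>
  have "\<exists>j r1 d'. j \<le> k \<and> strict_mono (r1 :: nat \<Rightarrow> nat) \<and> d' > 0 \<and>
    (\<lambda>i. rnorm j (T (u (r0 (r1 i))))) \<longlonglongrightarrow> 0 \<and> (\<forall>i. d' \<le> rnorm (Suc j) (T (u (r0 (r1 i)))))"
    by (rule level_subsequence[where n = n and d = d and x = "\<lambda>i. T (u (r0 i))"])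
       (use rochberg_rep[OF TR[OF u]] r0 k in auto)
  then obtain j and r1 :: "nat \<Rightarrow> nat" and d' where r1: "j \<le> k" "strict_mono r1" "d' > 0"
    "(\<lambda>i. rnorm j (T (u (r0 (r1 i))))) \<longlonglongrightarrow> 0" "\<forall>i. d' \<le> rnorm (Suc j) (T (u (r0 (r1 i))))"
    by (elim exE conjE) (rule that)
  define U where "U i = u (r0 (r1 i))" for i
  have sm: "strict_mono (\<lambda>i. r0 (r1 i))" using r0(2) r1(2) by (simp add: strict_mono_def)
  have U: "U i \<in> rochberg n" "rnorm n (U i) \<le> M" for i unfolding U_def by (rule u, rule bd)
  have Unull: "coord_null U" unfolding U_def by (rule coord_null_subseq[OF null sm])
  have Ulev: "(\<lambda>i. rnorm k (U i)) \<longlonglongrightarrow> 0"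
    using LIMSEQ_subseq_LIMSEQ[OF lev sm] by (simp add: U_def o_def)
  have TU: "T (U i) \<in> rochberg n" for i by (rule TR[OF U(1)])
  have TUnull: "coord_null (\<lambda>i. T (U i))" by (rule bounded_operator_coord_null[OF n bo U Unull])
  have TUlev: "(\<lambda>i. rnorm j (T (U i))) \<longlonglongrightarrow> 0" using r1(4) by (simp only: U_def)
  have TUlow: "d' \<le> rnorm (Suc j) (T (U i))" for i using r1(5) by (simp only: U_def)
  have TUM: "rnorm n (T (U i)) \<le> K * M" for i
  proof -
    have "rnorm n (T (U i)) \<le> K * rnorm n (U i)" using K(2) U(1) by blast
    also have "\<dots> \<le> K * M" using K(1) U(2) by (intro mult_left_mono) auto
    finally show ?thesis .
  qed
  have jn: "j < n" using r1(1) k by simp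
  define M' where "M' = K * M + d' + 1"
  have M': "0 < M'" unfolding M'_def using K M0 r1 by (intro add_nonneg_pos add_nonneg_nonneg) auto
  have d2: "0 < d' / 2" using r1 by simp
  obtain c h where ch: "0 < c" "0 < h"
    "\<forall>A w y N a. block_system n j A w \<and> (\<forall>i. y i \<in> rochberg n) \<and>
       (\<forall>i. rnorm n (w i) < M' \<and> d' / 2 \<le> rnorm (Suc j) (w i)) \<and>
       (\<forall>i. rnorm n (y i - w i) \<le> h * (1/2) ^ i) \<longrightarrow>
       c * rnorm (n - j) (base_array N a) \<le> rnorm n (lincomb N a y)"
    by (rule rnorm_near_blocks_lower[OF jn M' d2]) (rule that)
  define g where "g = min h (d' / 2)"
  have g: "0 < g" "g \<le> h" "g \<le> d' / 2" using ch r1 by (auto simp: g_def)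
  define e where "e m = g * (1/2) ^ m" for m :: nat
  have e: "0 < e m" "e m \<le> g" "e m \<le> h * (1/2) ^ m" for m
  proof -
    show "0 < e m" using g by (simp add: e_def)
    have "g * (1/2) ^ m \<le> g * 1" using g by (intro mult_left_mono power_le_one) auto
    then show "e m \<le> g" by (simp add: e_def)
    show "e m \<le> h * (1/2) ^ m" unfolding e_def using g by (intro mult_right_mono) auto
  qed
  \<comment> \<open>Arguments and images are approximated over the same coordinate intervals but at
    their own levels, so both block estimates apply to one subsequence.\<close>
  have ev: "\<forall>\<^sub>F i in sequentially. \<forall>\<^sub>F N' in sequentially.
      near_block n k (e m) N N' (U i) \<and> near_block n j (e m) N N' (T (U i))" for m N
    using eventually_near_block[OF U(1) Unull Ulev less_imp_le[OF k] e(1)[of m], of N]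
      eventually_near_block[OF TU TUnull TUlev less_imp_le[OF jn] e(1)[of m], of N]
    by eventually_elim (rule eventually_conj)
  obtain r p where rp: "strict_mono r" "mono p"
    "\<And>m. near_block n k (e m) (p m) (p (Suc m)) (U (r m)) \<and> near_block n j (e m) (p m) (p (Suc m)) (T (U (r m)))"
    using ev
    by (rule gliding_hump[where Q = "\<lambda>m N N' i. near_block n k (e m) N N' (U i) \<and> near_block n j (e m) N N' (T (U i))"])
       (rule that)
  define z where "z m = U (r m)" for m
  have z: "z m \<in> rochberg n" "T (z m) \<in> rochberg n" for m unfolding z_def by (rule U, rule TU)
  obtain w where w: "block_system n k (\<lambda>m. {p m..<p (Suc m)}) w" "\<And>m. rnorm n (z m - w m) < e m"
    by (rule near_blocks_obtain[OF rp(2), of n k e z]) (use rp(3) in \<open>auto simp: z_def intro: that\<close>)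
  obtain v where v: "block_system n j (\<lambda>m. {p m..<p (Suc m)}) v" "\<And>m. rnorm n (T (z m) - v m) < e m"
    by (rule near_blocks_obtain[OF rp(2), of n j e "\<lambda>m. T (z m)"]) (use rp(3) in \<open>auto simp: z_def intro: that\<close>)
  note wr = block_systemD(4)[OF w(1)] and vr = block_systemD(4)[OF v(1)]
  have near_norm: "rnorm n b \<le> rnorm n x + rnorm n (x - b)" if "x \<in> rochberg n" "b \<in> rochberg n" for x b
    using rnorm_triangle_sub[of n b x] rnorm_diff_commute[of n b x] that rochberg_rep by auto
  define C where "C = M + d' + 1 + 2 * h"
  have C: "C > 0" unfolding C_def using M0 r1 ch by simp
  have upper: "rnorm n (lincomb N a z) \<le> C * rnorm (n - k) (base_array N a)" for N a
    unfolding C_def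
  proof (rule rnorm_near_blocks_upper[OF w(1) z(1)])
    show "rnorm n (w i) < M + d' + 1" for i
      using near_norm[OF z(1)[of i] wr[of i]] w(2)[of i] e(2)[of i] g(3) U(2)[of "r i"] r1(3)
      unfolding z_def by linarith
    show "0 < M + d' + 1" using M0 r1 by simp
    show "rnorm n (z i - w i) \<le> h * (1/2) ^ i" for i using w(2)[of i] e(3)[of i] by linarith
  qed (rule k)
  have lower: "c * rnorm (n - j) (base_array N a) \<le> rnorm n (\<Sum>i<N. scal (a i) (T (z i)))" for N a
  proof (rule ch(3)[rule_format], intro conjI allI)
    show "block_system n j (\<lambda>m. {p m..<p (Suc m)}) v" by (rule v)
    show "T (z i) \<in> rochberg n" for i by (rule z)
    show "rnorm n (v i) < M'" for i
      using near_norm[OF z(2)[of i] vr[of i]] v(2)[of i] e(2)[of i] g(3) TUM[of "r i"] r1(3)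
      unfolding z_def M'_def by linarith
    show "d' / 2 \<le> rnorm (Suc j) (v i)" for i
    proof -
      have "rnorm (Suc j) (T (z i)) \<le> rnorm (Suc j) (v i) + rnorm (Suc j) (T (z i) - v i)"
        using jn by (intro rnorm_triangle_sub rochberg_representable[OF z(2)] rochberg_representable[OF vr]) auto
      moreover have "rnorm (Suc j) (T (z i) - v i) \<le> rnorm n (T (z i) - v i)"
        using jn by (intro rnorm_mono rochberg_rep rochberg_diff z vr) auto
      moreover have "d' \<le> rnorm (Suc j) (T (z i))" unfolding z_def by (rule TUlow)
      ultimately show ?thesis using v(2)[of i] e(2)[of i] g(3) by linarith
    qed
    show "rnorm n (T (z i) - v i) \<le> h * (1/2) ^ i" for i using v(2)[of i] e(3)[of i] by linarith
  qed
  have Tsum: "T (lincomb N a z) = (\<Sum>i<N. scal (a i) (T (z i)))" for N a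
    by (rule additive_homogeneous_sum[where n = n])
       (intro bounded_operatorD[OF bo] z(1) | assumption)+
  have "\<not> strictly_singular n T"
  proof (rule bounded_below_not_strictly_singular[OF bo z(1), of "c / C" c])
    show "c / C > 0" "c > 0" using ch C by auto
    fix N a
    \<comment> \<open>The upper estimate of order \<open>n - k\<close> is weakened to order
      \<open>n - j\<close>, where the lower estimate for the images takes over.\<close>
    have "rnorm (n - k) (base_array N a) \<le> rnorm (n - j) (base_array N a)"
      using r1(1) by (intro rnorm_mono base_array_representable) auto
    then have "C * rnorm (n - k) (base_array N a) \<le> C * rnorm (n - j) (base_array N a)"
      using C by (intro mult_left_mono) auto
    then have "rnorm n (lincomb N a z) \<le> C * rnorm (n - j) (base_array N a)"
      using upper[of a N] by linarith
    then have "c / C * rnorm n (lincomb N a z) \<le> c / C * (C * rnorm (n - j) (base_array N a))"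
      using ch C by (intro mult_left_mono) auto
    also have "\<dots> = c * rnorm (n - j) (base_array N a)" using C by simp
    also have "\<dots> \<le> rnorm n (T (lincomb N a z))" unfolding Tsum by (rule lower)
    finally show "c / C * rnorm n (lincomb N a z) \<le> rnorm n (T (lincomb N a z))" .
    fix i assume i: "i < N"
    have "c * cmod (a i) \<le> c * rnorm (n - j) (base_array N a)"
      using ch jn i by (intro mult_left_mono coeff_le_rnorm_base_array) auto
    also have "\<dots> \<le> rnorm n (T (lincomb N a z))" unfolding Tsum by (rule lower)
    finally show "c * cmod (a i) \<le> rnorm n (T (lincomb N a z))" .
  qed
  with T show False by simp
qed

section \<open>Products of strictly singular operators and compactness\<close>

lemma compose_ops_Nil: "compose_ops [] x = x"
  and compose_ops_Cons: "compose_ops (T # Ts) x = T (compose_ops Ts x)"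
  by (simp_all add: compose_ops_def)

lemma bounded_operator_compose:
  assumes "\<And>T. T \<in> set Ts \<Longrightarrow> bounded_operator n T"
  shows "bounded_operator n (compose_ops Ts)"
  using assms
proof (induction Ts)
  case Nil
  have "\<exists>K. \<forall>x\<in>rochberg n. rnorm n x \<le> K * rnorm n x" by (intro exI[of _ 1]) simp
  then show ?case unfolding bounded_operator_def compose_ops_Nil by simp
next
  case (Cons T Ts)
  have T: "bounded_operator n T" and R: "bounded_operator n (compose_ops Ts)" using Cons by auto
  note t = bounded_operatorD[OF T] and r = bounded_operatorD[OF R]
  obtain K where K: "K > 0" "\<forall>x\<in>rochberg n. rnorm n (T x) \<le> K * rnorm n x" using t(6) by blast
  obtain L where L: "L > 0" "\<forall>x\<in>rochberg n. rnorm n (compose_ops Ts x) \<le> L * rnorm n x" using r(6) by blast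
  have "rnorm n (T (compose_ops Ts x)) \<le> (K * L) * rnorm n x" if x: "x \<in> rochberg n" for x
  proof -
    have "rnorm n (T (compose_ops Ts x)) \<le> K * rnorm n (compose_ops Ts x)" using K(2) r(1)[OF x] by blast
    also have "\<dots> \<le> K * (L * rnorm n x)" using K(1) L(2) x by (intro mult_left_mono) auto
    finally show ?thesis by simp
  qed
  then have "\<exists>K. \<forall>x\<in>rochberg n. rnorm n (T (compose_ops Ts x)) \<le> K * rnorm n x" by blast
  then show ?case
    unfolding bounded_operator_def compose_ops_Cons vadd_eq_plus by (simp add: t(1-3) r(1-3))
qed

text \<open>Starting from the void level 0, each factor adds one level. The induction also needs the
  intermediate sequence to stay bounded and coordinatewise null, which holds for any product of
  bounded operators.\<close>

lemma compose_strictly_singular_level: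
  assumes "\<And>T. T \<in> set Ts \<Longrightarrow> strictly_singular n T" "length Ts \<le> n" "n > 0"
    and u: "\<And>i. u i \<in> rochberg n" and bd: "\<And>i. rnorm n (u i) \<le> M" and null: "coord_null u"
  shows "(\<lambda>i. rnorm (length Ts) (compose_ops Ts (u i))) \<longlonglongrightarrow> 0"
  using assms(1,2)
proof (induction Ts)
  case Nil
  then show ?case by (simp add: rnorm_order_0)
next
  case (Cons T Ts)
  have bo: "bounded_operator n (compose_ops Ts)"
    using Cons.prems(1) by (intro bounded_operator_compose) (auto simp: strictly_singular_def)
  obtain K where K: "K > 0" "\<forall>x\<in>rochberg n. rnorm n (compose_ops Ts x) \<le> K * rnorm n x"
    using bounded_operatorD(6)[OF bo] by blast
  have bK: "rnorm n (compose_ops Ts (u i)) \<le> K * M" for i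
  proof -
    have "rnorm n (compose_ops Ts (u i)) \<le> K * rnorm n (u i)" using K(2) u by blast
    also have "\<dots> \<le> K * M" using K(1) bd by (intro mult_left_mono) auto
    finally show ?thesis .
  qed
  have "(\<lambda>i. rnorm (Suc (length Ts)) (T (compose_ops Ts (u i)))) \<longlonglongrightarrow> 0"
  proof (rule strictly_singular_raises_level[OF _ bounded_operatorD(1)[OF bo u] bK])
    show "coord_null (\<lambda>i. compose_ops Ts (u i))"
      by (rule bounded_operator_coord_null[OF \<open>n > 0\<close> bo u bd null])
  qed (use Cons in auto)
  then show ?case by (simp add: compose_ops_Cons)
qed

text \<open>Diagonal extraction over the countable set of index pairs. Nothing is claimed about
  membership of the limit in the space.\<close>

lemma coordinatewise_convergent_subsequence:
  assumes s: "\<And>i. s i \<in> rochberg n" and bd: "\<And>i. rnorm n (s i) \<le> M"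
  obtains r :: "nat \<Rightarrow> nat" and l where "strict_mono r" "\<And>j k. (\<lambda>i. s (r i) j k) \<longlonglongrightarrow> l j k"
proof -
  have M: "0 \<le> M" using order_trans[OF rnorm_nonneg[OF rochberg_rep[OF s]] bd] .
  have b: "norm (s i (fst x) (snd x)) \<le> 4 ^ n * M" for i x
  proof (cases "fst x < n")
    case True
    have "norm (s i (fst x) (snd x)) \<le> 4 ^ fst x * rnorm n (s i)"
      by (rule coord_le_rnorm[OF rochberg_rep[OF s] True])
    also have "\<dots> \<le> 4 ^ n * M"
      using True M bd rnorm_nonneg[OF rochberg_rep[OF s]] by (intro mult_mono power_increasing) auto
    finally show ?thesis .
  next
    case False
    then show ?thesis using s[of i] M by (simp add: rochberg_iff)
  qed
  have "\<exists>r. strict_mono (r :: nat \<Rightarrow> nat) \<and> (\<forall>x. \<exists>l. (\<lambda>i. s (r i) (fst x) (snd x)) \<longlonglongrightarrow> l)"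
    by (rule function_convergent_subsequence[of "UNIV :: (nat \<times> nat) set" "\<lambda>i x. s i (fst x) (snd x)", OF _ b]) auto
  then obtain r :: "nat \<Rightarrow> nat" where r: "strict_mono r" "\<forall>x. \<exists>l. (\<lambda>i. s (r i) (fst x) (snd x)) \<longlonglongrightarrow> l"
    by (elim exE conjE) (rule that)
  have "\<exists>l. (\<lambda>i. s (r i) j k) \<longlonglongrightarrow> l" for j k using r(2)[rule_format, of "(j, k)"] by simp
  then obtain l where l: "\<And>j k. (\<lambda>i. s (r i) j k) \<longlonglongrightarrow> l j k" by metis
  with r that show ?thesis by blast
qed

theorem theorem5p9:
  fixes n :: nat and S :: "nat \<Rightarrow> (nat \<Rightarrow> nat \<Rightarrow> complex) \<Rightarrow> (nat \<Rightarrow> nat \<Rightarrow> complex)"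
  assumes "n \<ge> 1"
    and "\<forall>i\<in>{1..n}. strictly_singular n (S i)"
  shows "compact_operator n (compose_ops (map S [1..<n+1]))"
proof -
  define Ts where "Ts = map S [1..<n+1]"
  define P where "P = compose_ops Ts"
  have n: "n > 0" using assms by simp
  have len: "length Ts = n" by (simp add: Ts_def)
  have ss: "strictly_singular n T" if "T \<in> set Ts" for T
    using that assms(2) by (auto simp: Ts_def)
  have bo: "bounded_operator n P"
    unfolding P_def using ss by (intro bounded_operator_compose) (simp add: strictly_singular_def)
  have "\<exists>(r::nat\<Rightarrow>nat) L. strict_mono r \<and> L \<in> rochberg n \<and> (\<lambda>i. rnorm n (P (s (r i)) - L)) \<longlonglongrightarrow> 0"
    if s: "\<And>i. s i \<in> rochberg n" and M: "\<And>i. rnorm n (s i) \<le> M" for s M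
  proof -
    obtain r :: "nat \<Rightarrow> nat" and l where r: "strict_mono r" "\<And>j k. (\<lambda>i. s (r i) j k) \<longlonglongrightarrow> l j k"
      by (rule coordinatewise_convergent_subsequence[OF s M]) (rule that)
    have Ps: "P (s (r i)) \<in> rochberg n" for i by (rule bounded_operatorD(1)[OF bo s])
    \<comment> \<open>The coordinatewise limit \<open>l\<close> cannot be subtracted, as it is not
      known to lie in the space; differences of terms are used instead and completeness supplies the
      limit.\<close>
    have cauchy: "\<exists>N. \<forall>p\<ge>N. \<forall>q\<ge>N. rnorm n (P (s (r p)) - P (s (r q))) < e" if e: "e > 0" for e
    proof (rule ccontr)
      assume "\<not> ?thesis"
      then have "\<forall>N. \<exists>p q. p \<ge> N \<and> q \<ge> N \<and> e \<le> rnorm n (P (s (r p)) - P (s (r q)))" by (meson not_less)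
      then obtain p q where pq: "\<And>N. p N \<ge> N" "\<And>N. q N \<ge> N"
        "\<And>N. e \<le> rnorm n (P (s (r (p N))) - P (s (r (q N))))" by metis
      define u where "u N = s (r (p N)) - s (r (q N))" for N
      have u: "u N \<in> rochberg n" for N unfolding u_def by (intro rochberg_diff s)
      have ub: "rnorm n (u N) \<le> M + M" for N
        unfolding u_def
        by (rule order_trans[OF rnorm_triangle_diff[OF rochberg_rep[OF s] rochberg_rep[OF s]] add_mono[OF M M]])
      \<comment> \<open>The chosen indices tend to infinity but need not increase, so convergence is
        transferred by filters instead of subsequences.\<close>
      have p: "filterlim p at_top sequentially" and q: "filterlim q at_top sequentially"
        using pq(1,2) by (auto intro: filterlim_at_top_mono[OF filterlim_ident])
      have "(\<lambda>N. u N j k) \<longlonglongrightarrow> l j k - l j k" for j k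
        unfolding u_def fun_diff_def
        by (intro tendsto_diff filterlim_compose[OF r(2) p] filterlim_compose[OF r(2) q])
      then have "coord_null u" unfolding coord_null_def by simp
      \<comment> \<open>\<open>n\<close> factors reach level \<open>n\<close>, where
        \<open>rnorm\<close> is the norm of the space.\<close>
      then have "(\<lambda>N. rnorm (length Ts) (P (u N))) \<longlonglongrightarrow> 0"
        unfolding P_def using ss n len by (intro compose_strictly_singular_level[OF _ _ _ u ub]) auto
      then have "\<forall>\<^sub>F N in sequentially. rnorm n (P (u N)) < e" using e unfolding len by (rule order_tendstoD(2))
      then obtain N where "rnorm n (P (u N)) < e" using eventually_happens'[OF sequentially_bot] by blast
      moreover have "P (u N) = P (s (r (p N))) - P (s (r (q N)))"
        unfolding u_def by (intro bounded_operatorD(5)[OF bo] s)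
      ultimately show False using pq(3)[of N] by simp
    qed
    obtain L where "L \<in> rochberg n" "(\<lambda>i. rnorm n (P (s (r i)) - L)) \<longlonglongrightarrow> 0"
      by (rule rochberg_complete[where x = "\<lambda>i. P (s (r i))", OF Ps cauchy]) (assumption, rule that)
    with r(1) show ?thesis by blast
  qed
  then show ?thesis
    unfolding compact_operator_def vsub_eq_minus Ts_def[symmetric] P_def[symmetric] using bo by blast
qed

end
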